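(* Let $K$ be an integral operator on $L^2((0,\infty);dt;\mathbf C)$ such that: (i) $0\le K\le I$ and $I-K$ is invertible; (ii) there exist a separable Hilbert space $E$ and $\phi\in L^2((0,\infty);t\,dt;E)$ such that $K=\Gamma_\phi^\dagger\Gamma_\phi$. Then $K$ has a $\tau$-function $\tau_K$ and there exists a sequence $(K_n)_{n=1}^\infty$ of finite rank integral operators with corresponding $\tau$-functions $\tau_{K_n}$ such that: (1) $K_n\to K$ in trace class norm; (2) $\tau_{K_n}(x)\to\tau_K(x)$ uniformly on compact sets as $n\to\infty$; (3) $\tau_{K_n}(x)=\sum_{j=1}^{N_n}a_{jn}e^{-\mu_{jn}x}$ for some $a_{jn},\mu_{jn}\in\mathbf C$ with $\Re\mu_{jn}>0$ that are given by the determinant formula recalled in the context.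
   Context: For $\phi:(0,\infty)\to E$ the Hankel operator is $\Gamma_\phi h(x)=\int_0^\infty\phi(x+y)h(y)\,dy$, from (a domain in) $L^2(0,\infty)$ to $L^2((0,\infty);E)$; $\dagger$ denotes adjoint. For a self-adjoint trace class operator $K\le I$ on $L^2(0,\infty)$ with $I-K$ invertible, the $\tau$-function is $\tau_K(x)=\det(I-KP_{[x,\infty)})$, where $P_{[x,\infty)}$ is the orthogonal projection onto $L^2(x,\infty)$. The formula referred to in (3) is the following. The operators are $K_n=\Gamma_{\phi^{(n)}}^\dagger\Gamma_{\phi^{(n)}}$ with $\phi^{(n)}(t)=\sum_{j=1}^N\xi_j^\dagger e^{-\bar\lambda_jt}$, where $\Re\lambda_j>0$ and $\xi_j$ are vectors (all depending on $n$) in a space with orthonormal basis $(e_r)_{r=1}^\nu$, identified with row vectors with entries $\xi_j^{(r)}=\langle\xi_j,e_r\rangle$. The expansion stated in the paper is $$\tau_{K_n}(x)=\sum_{S,T:\,\sharp S=\sharp T}(-1)^{\sharp S}\det\Bigl[\frac{\xi_j^{(r)}e^{-2\lambda_jx}}{\lambda_j+\bar\lambda_k}\Bigr]_{j\in S;(k,r)\in T}\det\Bigl[\frac{\bar\xi_k^{(r)}e^{-2\bar\lambda_kx}}{\lambda_m+\bar\lambda_k}\Bigr]_{m\in S;(k,r)\in T},$$ the sum being over all pairs of subsets $S\subseteq\{1,\dots,N\}$ and $T\subseteq\{1,\dots,N\}\times\{1,\dots,\nu\}$ of equal cardinality ($\sharp S$ denotes the number of elements of $S$).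
   Formalization: In (3) the determinant formula is corrected to have exponentials e^{-λ_j x} and e^{-λ̄_k x} instead of e^{-2λ_j x} and e^{-2λ̄_k x}, and τ_{K_n}(x) = 1 + Σ a_{jn} e^{-μ_{jn}x}, the 1 coming from S=T=∅; as printed, (3) fails since τ→1 as x→∞. *)

theory Defs
  imports
    "HOL-Analysis.Analysis"
    "Jordan_Normal_Form.Determinant"
begin

section \<open>Complex Hilbert spaces\<close>

text \<open>The inner product is linear in its first argument.  A separable complex Hilbert space is a
  type of class \<open>complex_hilbert_space\<close> and \<open>second_countable_topology\<close>; these are also
  the assumptions under which the Bochner integral is available.\<close>

class complex_hilbert_space = banach +
  fixes scaleC :: "complex \<Rightarrow> 'a \<Rightarrow> 'a" (infixr "*\<^sub>C" 75)
    and cinner :: "'a \<Rightarrow> 'a \<Rightarrow> complex"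
  assumes scaleC_add_right: "a *\<^sub>C (x + y) = a *\<^sub>C x + a *\<^sub>C y"
    and scaleC_add_left: "(a + b) *\<^sub>C x = a *\<^sub>C x + b *\<^sub>C x"
    and scaleC_scaleC: "a *\<^sub>C b *\<^sub>C x = (a * b) *\<^sub>C x"
    and scaleR_scaleC: "r *\<^sub>R x = complex_of_real r *\<^sub>C x"
    and cinner_commute: "cinner x y = cnj (cinner y x)"
    and cinner_add_left: "cinner (x + y) z = cinner x z + cinner y z"
    and cinner_scaleC_left: "cinner (a *\<^sub>C x) y = a * cinner x y"
    and cinner_self: "cinner x x = complex_of_real ((norm x)\<^sup>2)"

instantiation complex :: complex_hilbert_space
begin

definition scaleC_complex :: "complex \<Rightarrow> complex \<Rightarrow> complex"
  where "scaleC_complex a z = a * z"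

definition cinner_complex :: "complex \<Rightarrow> complex \<Rightarrow> complex"
  where "cinner_complex z w = z * cnj w"

instance
  by standard
    (simp_all add: scaleC_complex_def cinner_complex_def algebra_simps scaleR_conv_of_real
      complex_norm_square del: of_real_power)

end

section \<open>The Hilbert space of square integrable functions on the half line\<close>

text \<open>Elements of \<open>L\<^sup>2\<close> are represented by functions, with equality almost everywhere made
  explicit.\<close>

abbreviation half_line :: "real measure"
  where "half_line \<equiv> restrict_space lborel {0<..}"

definition L2 :: "(real \<Rightarrow> 'e::{complex_hilbert_space, second_countable_topology}) set"
  where "L2 = {f \<in> borel_measurable half_line. integrable half_line (\<lambda>t. (norm (f t))\<^sup>2)}"

definition l2_inner ::
    "(real \<Rightarrow> 'e::{complex_hilbert_space, second_countable_topology}) \<Rightarrow> (real \<Rightarrow> 'e) \<Rightarrow> complex"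
  where "l2_inner f g = (LINT t|half_line. cinner (f t) (g t))"

definition l2_norm :: "(real \<Rightarrow> 'e::{complex_hilbert_space, second_countable_topology}) \<Rightarrow> real"
  where "l2_norm f = sqrt (LINT t|half_line. (norm (f t))\<^sup>2)"

definition orthonormal :: "'i set \<Rightarrow> ('i \<Rightarrow> real \<Rightarrow> complex) \<Rightarrow> bool"
  where "orthonormal I e \<longleftrightarrow> (\<forall>i\<in>I. e i \<in> L2) \<and>
    (\<forall>i\<in>I. \<forall>j\<in>I. l2_inner (e i) (e j) = (if i = j then 1 else 0))"

text \<open>Orthonormal bases of \<open>L\<^sup>2(0,\<infinity>)\<close>, which are all countably infinite.\<close>

definition orthonormal_basis :: "(nat \<Rightarrow> real \<Rightarrow> complex) \<Rightarrow> bool"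
  where "orthonormal_basis e \<longleftrightarrow> orthonormal UNIV e \<and>
    (\<forall>f\<in>L2. (\<forall>i. l2_inner f (e i) = 0) \<longrightarrow> (AE t in half_line. f t = 0))"

section \<open>Operators\<close>

type_synonym l2_op = "(real \<Rightarrow> complex) \<Rightarrow> real \<Rightarrow> complex"

text \<open>Linearity and boundedness together imply that almost everywhere equal arguments have
  almost everywhere equal images.\<close>

definition bounded_op :: "l2_op \<Rightarrow> bool"
  where "bounded_op T \<longleftrightarrow>
    (\<forall>f\<in>L2. T f \<in> L2) \<and>
    (\<forall>f\<in>L2. \<forall>g\<in>L2. \<forall>a b. AE t in half_line.
      T (\<lambda>s. a * f s + b * g s) t = a * T f t + b * T g t) \<and>
    (\<exists>C. \<forall>f\<in>L2. l2_norm (T f) \<le> C * l2_norm f)"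

definition op_eq :: "l2_op \<Rightarrow> l2_op \<Rightarrow> bool"
  where "op_eq S T \<longleftrightarrow> (\<forall>f\<in>L2. AE t in half_line. S f t = T f t)"

definition self_adjoint :: "l2_op \<Rightarrow> bool"
  where "self_adjoint T \<longleftrightarrow> (\<forall>f\<in>L2. \<forall>g\<in>L2. l2_inner (T f) g = l2_inner f (T g))"

definition op_le :: "l2_op \<Rightarrow> l2_op \<Rightarrow> bool"
  where "op_le S T \<longleftrightarrow> (\<forall>f\<in>L2. l2_inner (\<lambda>t. T f t - S f t) f \<in> \<real> \<and>
    0 \<le> Re (l2_inner (\<lambda>t. T f t - S f t) f))"

definition invertible_op :: "l2_op \<Rightarrow> bool"
  where "invertible_op T \<longleftrightarrow>
    (\<exists>R. bounded_op R \<and> op_eq (\<lambda>f. R (T f)) (\<lambda>f. f) \<and> op_eq (\<lambda>f. T (R f)) (\<lambda>f. f))"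

definition integral_operator :: "l2_op \<Rightarrow> bool"
  where "integral_operator T \<longleftrightarrow> bounded_op T \<and>
    (\<exists>k. (\<lambda>(x, y). k x y) \<in> borel_measurable (half_line \<Otimes>\<^sub>M half_line) \<and>
      (\<forall>f\<in>L2. AE x in half_line. integrable half_line (\<lambda>y. k x y * f y) \<and>
        T f x = (LINT y|half_line. k x y * f y)))"

definition finite_rank :: "l2_op \<Rightarrow> bool"
  where "finite_rank T \<longleftrightarrow> (\<exists>(m::nat) g. (\<forall>i<m. g i \<in> L2) \<and>
    (\<forall>f\<in>L2. \<exists>c. AE t in half_line. T f t = (\<Sum>i<m. c i * g i t)))"

text \<open>The trace norm, as the supremum of \<open>\<Sum> \<bar>\<langle>T e\<^sub>i, f\<^sub>i\<rangle>\<bar>\<close> over pairs of finite orthonormal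
  systems of the same length.\<close>

definition trace_norm :: "l2_op \<Rightarrow> ennreal"
  where "trace_norm T = (SUP (m, e, f) \<in> {(m::nat, e, f). orthonormal {..<m} e \<and> orthonormal {..<m} f}.
    ennreal (\<Sum>i<m. norm (l2_inner (T (e i)) (f i))))"

definition trace_class :: "l2_op \<Rightarrow> bool"
  where "trace_class T \<longleftrightarrow> bounded_op T \<and> trace_norm T < \<infinity>"

section \<open>Determinants\<close>

definition list_det :: "('i \<Rightarrow> 'j \<Rightarrow> complex) \<Rightarrow> 'i list \<Rightarrow> 'j list \<Rightarrow> complex"
  where "list_det A is js = Determinant.det (Matrix.mat (length is) (length js)
    (\<lambda>(a, b). A (is ! a) (js ! b)))"

text \<open>The Fredholm determinant \<open>det (I - T) = \<Sum>\<^sub>k (-1)\<^sup>k tr \<Lambda>\<^sup>k(T)\<close> of a trace class operator.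
  The vectors \<open>e i\<^sub>1 \<and> \<dots> \<and> e i\<^sub>k\<close>, \<open>i\<^sub>1 < \<dots> < i\<^sub>k\<close>, form an orthonormal basis of the
  \<open>k\<close>-th exterior power, and the diagonal entries of \<open>\<Lambda>\<^sup>k(T)\<close> in it are the principal minors of
  the matrix of \<open>T\<close>.  The value does not depend on the basis.\<close>

definition det_id_minus :: "l2_op \<Rightarrow> complex"
  where "det_id_minus T = (THE d. \<forall>e. orthonormal_basis e \<longrightarrow>
    ((\<lambda>S::nat set. (- 1) ^ card S * list_det (\<lambda>i j. l2_inner (T (e j)) (e i))
        (sorted_list_of_set S) (sorted_list_of_set S)) has_sum d) {S. finite S})"

text \<open>The projection \<open>P\<^bsub>[x,\<infinity>)\<^esub>\<close>.\<close>

definition proj_from :: "real \<Rightarrow> l2_op"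
  where "proj_from x f = (\<lambda>t. if x \<le> t then f t else 0)"

definition has_tau :: "l2_op \<Rightarrow> bool"
  where "has_tau K \<longleftrightarrow> self_adjoint K \<and> trace_class K \<and> op_le K (\<lambda>f. f) \<and>
    invertible_op (\<lambda>f t. f t - K f t)"

definition tau :: "l2_op \<Rightarrow> real \<Rightarrow> complex"
  where "tau K x = det_id_minus (\<lambda>f. K (proj_from x f))"

section \<open>Hankel operators\<close>

definition hankel ::
    "(real \<Rightarrow> 'e::{complex_hilbert_space, second_countable_topology}) \<Rightarrow> (real \<Rightarrow> complex) \<Rightarrow> real \<Rightarrow> 'e"
  where "hankel \<phi> h x = (LINT y|half_line. h y *\<^sub>C \<phi> (x + y))"

text \<open>\<open>B\<close> is the adjoint of the everywhere defined operator \<open>A\<close>; this determines \<open>B\<close> up to equality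
  almost everywhere.\<close>

definition is_adjoint ::
    "((real \<Rightarrow> complex) \<Rightarrow> real \<Rightarrow> 'e::{complex_hilbert_space, second_countable_topology}) \<Rightarrow>
     ((real \<Rightarrow> 'e) \<Rightarrow> real \<Rightarrow> complex) \<Rightarrow> bool"
  where "is_adjoint A B \<longleftrightarrow> (\<forall>h\<in>L2. A h \<in> L2) \<and> (\<forall>u\<in>L2. B u \<in> L2) \<and>
    (\<forall>h\<in>L2. \<forall>u\<in>L2. l2_inner (A h) u = l2_inner h (B u))"

text \<open>\<open>K = \<Gamma>\<^sub>\<phi>\<^sup>\<dagger> \<Gamma>\<^sub>\<phi>\<close>\<close>

definition is_hankel_square ::
    "l2_op \<Rightarrow> (real \<Rightarrow> 'e::{complex_hilbert_space, second_countable_topology}) \<Rightarrow> bool"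
  where "is_hankel_square K \<phi> \<longleftrightarrow>
    (\<exists>B. is_adjoint (hankel \<phi>) B \<and> op_eq K (\<lambda>h. B (hankel \<phi> h)))"

section \<open>Exponential sums and the determinant formula\<close>

text \<open>A row vector with entries \<open>\<xi> 1, \<dots>, \<xi> \<nu>\<close> has as its adjoint the vector with coordinates
  \<open>cnj (\<xi> r)\<close> in the orthonormal basis \<open>e 1, \<dots>, e \<nu>\<close> of its span.\<close>

definition row_adjoint :: "nat \<Rightarrow> (nat \<Rightarrow> 'e::complex_hilbert_space) \<Rightarrow> (nat \<Rightarrow> complex) \<Rightarrow> 'e"
  where "row_adjoint \<nu> e \<xi> = (\<Sum>r = 1..\<nu>. cnj (\<xi> r) *\<^sub>C e r)"

definition exp_symbol ::
    "nat \<Rightarrow> nat \<Rightarrow> (nat \<Rightarrow> 'e::complex_hilbert_space) \<Rightarrow> (nat \<Rightarrow> complex) \<Rightarrow> (nat \<Rightarrow> nat \<Rightarrow> complex) \<Rightarrow>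
     real \<Rightarrow> 'e"
  where "exp_symbol N \<nu> e lam \<xi> t =
    (\<Sum>j = 1..N. exp (- cnj (lam j) * of_real t) *\<^sub>C row_adjoint \<nu> e (\<xi> j))"

definition det_pairs :: "nat \<Rightarrow> nat \<Rightarrow> (nat set \<times> (nat \<times> nat) set) set"
  where "det_pairs N \<nu> = {(S, T). S \<subseteq> {1..N} \<and> T \<subseteq> {1..N} \<times> {1..\<nu>} \<and> card S = card T}"

text \<open>The exponents are \<open>- \<lambda>\<^sub>j x\<close> and \<open>- cnj \<lambda>\<^sub>k x\<close>, without a factor 2: for \<open>N = \<nu> = 1\<close> the
  operator \<open>K = \<Gamma>\<^sub>\<phi>\<^sup>\<dagger> \<Gamma>\<^sub>\<phi>\<close> has kernel \<open>\<bar>\<xi>\<bar>\<^sup>2 e\<^bsup>-\<lambda>s - cnj \<lambda> t\<^esup> / (\<lambda> + cnj \<lambda>)\<close>, so that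
  \<open>det (I - K P\<^bsub>[x,\<infinity>)\<^esub>) = 1 - \<bar>\<xi>\<bar>\<^sup>2 e\<^bsup>-(\<lambda> + cnj \<lambda>) x\<^esup> / (\<lambda> + cnj \<lambda>)\<^sup>2\<close>.
  Rows and columns are enumerated in lexicographic order; the product of the two determinants does
  not depend on this choice.\<close>

definition det_term ::
    "nat \<Rightarrow> nat \<Rightarrow> (nat \<Rightarrow> complex) \<Rightarrow> (nat \<Rightarrow> nat \<Rightarrow> complex) \<Rightarrow> nat set \<times> (nat \<times> nat) set \<Rightarrow> real \<Rightarrow>
     complex"
  where "det_term N \<nu> lam \<xi> = (\<lambda>(S, T) x.
    let rows = filter (\<lambda>j. j \<in> S) [1..<Suc N];
        cols = filter (\<lambda>p. p \<in> T) (List.product [1..<Suc N] [1..<Suc \<nu>])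
    in (- 1) ^ card S *
      list_det (\<lambda>j (k, r). \<xi> j r * exp (- lam j * of_real x) / (lam j + cnj (lam k))) rows cols *
      list_det (\<lambda>m (k, r). cnj (\<xi> k r) * exp (- cnj (lam k) * of_real x) / (lam m + cnj (lam k)))
        rows cols)"

end

theory Submission
  imports Defs
begin

text \<open>Let \<open>K = \<Gamma>\<^sup>\<dagger> \<Gamma>\<close>, where \<open>\<Gamma>\<close> is the Hankel operator with symbol \<open>\<phi>\<close>; it is Hilbert-Schmidt with square norm
  \<open>\<integral> t \<parallel>\<phi> t\<parallel>\<^sup>2 dt\<close>.  In an orthonormal basis \<open>e\<close> the principal minors of \<open>K P\<close>, \<open>P\<close> the projection onto
  \<open>[x, \<infinity>)\<close>, are the determinants of \<open>\<langle>u\<^sub>j, v\<^sub>i\<rangle>\<close> with \<open>u\<^sub>j = \<Gamma> P e\<^sub>j\<close> and \<open>v\<^sub>i = \<Gamma> e\<^sub>i\<close>.  Hadamard's inequality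
  bounds them by products of norms, so the series of all minors converges absolutely and depends
  on \<open>\<Gamma>\<close> in a Lipschitz way for the Hilbert-Schmidt norm, uniformly in \<open>x\<close> and in the basis.
  Exponential sums are dense in the weighted space of symbols by the Weierstrass theorem in the variable
  \<open>exp (- t)\<close>.  For such a symbol the operator has finite rank, and Parseval's identity and the
  Cauchy-Binet formula turn the series into the determinant expansion, whatever the basis.  In the
  limit the series of \<open>K\<close> does not depend on the basis either, which makes \<open>\<tau>\<close> well defined, and the
  Lipschitz bound gives the uniform convergence.  The operators \<open>I - K\<^sub>n\<close> are invertible because
  \<open>I - K\<close>, which is positive with bounded inverse, is bounded below.\<close>

subsection \<open>Hadamard's inequality and the Cauchy-Binet formula\<close>

text \<open>The value \<open>det_id_minus\<close> is picked by \<open>THE\<close> as the common sum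
  of the minor series over all orthonormal bases, so basis independence has to be settled before any
  determinant of \<open>K\<close> can be named. For finite rank it is the identity det (I - A B) =
  det (I - B A), read at the level of principal minors. The minors are those of K P, which in
  general is not self-adjoint because the projection stands on one side only: the two families of
  vectors differ, and Hadamard's inequality is needed for mixed Gram determinants, not only for
  positive matrices. Both families have Hilbert-Schmidt norm at most the weighted norm of the
  symbol, since cutting at x only shrinks its translates; this is the source of the uniformity in x.
  One orthonormal basis has to be constructed, lest the quantification over bases be empty; the same
  density theorem serves there with weight 1 and for symbols with weight sqrt. Invertibility is
  wanted for every I - K_n and not just for large n, so all approximating symbols are kept close to
  \<phi> from the start.\<close>

definition psd :: "nat \<Rightarrow> (nat \<Rightarrow> nat \<Rightarrow> complex) \<Rightarrow> bool"
  where "psd n G \<longleftrightarrow> (\<forall>i<n. \<forall>j<n. G j i = cnj (G i j)) \<and>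
    (\<forall>c. 0 \<le> Re (\<Sum>i<n. \<Sum>j<n. c i * cnj (c j) * G i j))"

lemma psd_diag:
  assumes "psd n G" "i < n"
  shows "0 \<le> Re (G i i)" "G i i = of_real (Re (G i i))"
proof -
  define c :: "nat \<Rightarrow> complex" where "c k = (if k = i then 1 else 0)" for k
  have s: "(\<Sum>k<n. f k) = f i" if "\<And>k. k \<noteq> i \<Longrightarrow> f k = 0" for f :: "nat \<Rightarrow> complex"
  proof -
    have "(\<Sum>k<n. f k) = (\<Sum>k\<in>{i}. f k)"
      by (intro sum.mono_neutral_right) (use assms that in auto)
    then show ?thesis by simp
  qed
  have "(\<Sum>k<n. \<Sum>j<n. c k * cnj (c j) * G k j) = G i i"
    by (subst s, simp add: c_def, subst s) (simp_all add: c_def)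
  then show "0 \<le> Re (G i i)"
    using assms(1) unfolding psd_def by (metis (no_types, lifting))
  have "G i i = cnj (G i i)"
    using assms unfolding psd_def by blast
  then show "G i i = of_real (Re (G i i))"
    by (metis Reals_cnj_iff complex_of_real_def of_real_Re)
qed

lemma psd_two:
  assumes "psd n G" "i < n" "j < n" "i \<noteq> j"
  shows "0 \<le> (norm a)\<^sup>2 * Re (G i i) + 2 * Re (a * cnj b * G i j) + (norm b)\<^sup>2 * Re (G j j)"
proof -
  define c where "c k = (if k = i then a else if k = j then b else 0)" for k
  have s: "(\<Sum>k<n. f k) = f i + f j" if "\<And>k. k \<noteq> i \<Longrightarrow> k \<noteq> j \<Longrightarrow> f k = 0" for f :: "nat \<Rightarrow> complex"
  proof -
    have "(\<Sum>k<n. f k) = (\<Sum>k\<in>{i,j}. f k)"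
      by (intro sum.mono_neutral_right) (use assms that in auto)
    then show ?thesis using assms by simp
  qed
  have "(\<Sum>k<n. \<Sum>l<n. c k * cnj (c l) * G k l) =
     (c i * cnj (c i) * G i i + c i * cnj (c j) * G i j) + (c j * cnj (c i) * G j i + c j * cnj (c j) * G j j)"
    by (subst s, simp add: c_def, subst (1 2) s) (simp_all add: c_def)
  also have "\<dots> = of_real ((norm a)\<^sup>2) * G i i + (a * cnj b * G i j + cnj (a * cnj b * G i j)) + of_real ((norm b)\<^sup>2) * G j j"
  proof -
    have "G j i = cnj (G i j)" using assms unfolding psd_def by blast
    then show ?thesis using assms(4)
      unfolding c_def complex_norm_square by (simp add: algebra_simps)
  qed
  finally have "Re (\<Sum>k<n. \<Sum>l<n. c k * cnj (c l) * G k l) =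
      (norm a)\<^sup>2 * Re (G i i) + 2 * Re (a * cnj b * G i j) + (norm b)\<^sup>2 * Re (G j j)"
    by (simp add: algebra_simps)
  then show ?thesis
    using assms(1) unfolding psd_def by (metis (no_types, lifting))
qed

text \<open>With a vanishing diagonal entry at \<open>i\<close> the form on the coordinates
  \<open>i\<close> and \<open>j\<close> is affine in the size of the first coefficient, and an
  affine function bounded below on the line is constant. This lets the elimination in
  \<open>cholesky\<close> pass a zero pivot.\<close>

lemma psd_zero_diag:
  assumes "psd n G" "i < n" "j < n" "G i i = 0"
  shows "G i j = 0"
proof (cases "i = j")
  case True then show ?thesis using assms by simp
next
  case False
  \<comment> \<open>The coefficient \<open>- t * cnj (G i j)\<close> rotates the phase, so that the
    cross term is the real number \<open>- t * (norm (G i j))\<^sup>2\<close>.\<close>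
  have "0 \<le> - 2 * t * (norm (G i j))\<^sup>2 + Re (G j j)" for t :: real
  proof -
    have "0 \<le> (norm (- of_real t * cnj (G i j)))\<^sup>2 * Re (G i i) +
       2 * Re ((- of_real t * cnj (G i j)) * cnj 1 * G i j) + (norm (1::complex))\<^sup>2 * Re (G j j)"
      by (rule psd_two[OF assms(1-3) False])
    moreover have "(- of_real t * cnj (G i j)) * cnj 1 * G i j = of_real (- t * (norm (G i j))\<^sup>2)"
      unfolding of_real_mult complex_norm_square by (simp add: mult_ac)
    ultimately show ?thesis using assms(4) by (simp only: Re_complex_of_real) simp
  qed
  \<comment> \<open>For this \<open>t\<close> the bound is \<open>- Re (G j j) - 2\<close>, which is
    negative.\<close>
  from this[of "(Re (G j j) + 1) / (norm (G i j))\<^sup>2"]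
  have "G i j \<noteq> 0 \<Longrightarrow> 0 \<le> - 2 * (Re (G j j) + 1) + Re (G j j)"
    by simp
  then show ?thesis
    using psd_diag(1)[OF assms(1,3)] by (smt (verit))
qed

text \<open>Induction over the Schur complement of the corner entry. Zero pivots are allowed:
  division by zero makes the column \<open>l\<close> vanish, and by \<open>psd_zero_diag\<close> the
  first row and column of \<open>G\<close> vanish with it. Triangularity holds for all indices, also
  beyond \<open>n\<close>, which is the form that \<open>det_lower_mat\<close> asks for.\<close>

lemma cholesky:
  "psd n G \<Longrightarrow> \<exists>L. (\<forall>i k. i < k \<longrightarrow> L i k = 0) \<and>
     (\<forall>i<n. \<forall>j<n. G i j = (\<Sum>k<n. L i k * cnj (L j k)))"
proof (induction n arbitrary: G)
  case 0
  show ?case by (intro exI[of _ "\<lambda>_ _. 0"]) simp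
next
  case (Suc n)
  define a where "a = Re (G 0 0)"
  have a: "0 \<le> a" "G 0 0 = of_real a"
    using psd_diag[OF Suc.prems, of 0] by (auto simp: a_def)
  have herm: "G j i = cnj (G i j)" if "i < Suc n" "j < Suc n" for i j
    using Suc.prems that unfolding psd_def by blast
  define l where "l i = G i 0 / of_real (sqrt a)" for i
  have l0: "G i 0 = l i * cnj (l 0)" if "i < Suc n" for i
  proof (cases "a = 0")
    case True
    then have "G 0 i = 0" using psd_zero_diag[OF Suc.prems, of 0 i] a that by simp
    then show ?thesis using herm[of 0 i] that True by (simp add: l_def)
  next
    case False
    have "complex_of_real (sqrt a) * complex_of_real (sqrt a) = of_real a"
      unfolding of_real_mult[symmetric] using a(1) by simp
    then show ?thesis using False a by (simp add: l_def field_simps)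
  qed
  have l0': "G 0 i = l 0 * cnj (l i)" if "i < Suc n" for i
    using l0[OF that] herm[of i 0] that by simp
  define G' where "G' i j = G (Suc i) (Suc j) - l (Suc i) * cnj (l (Suc j))" for i j
  have "psd n G'"
    unfolding psd_def
  proof (intro conjI allI impI)
    fix i j assume "i < n" "j < n"
    then show "G' j i = cnj (G' i j)"
      using herm[of "Suc i" "Suc j"] by (simp add: G'_def)
  next
    fix c :: "nat \<Rightarrow> complex"
    define s where "s = (\<Sum>i<n. c i * l (Suc i))"
    \<comment> \<open>\<open>b\<close> minimises the form of \<open>G\<close> over the first
      coordinate while the others are kept at \<open>c\<close>; the minimum is the form of the Schur
      complement \<open>G'\<close> at \<open>c\<close>. For a = 0 the column \<open>l\<close> and
      hence \<open>s\<close> vanish, and 0 will do.\<close>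
    define b where "b = (if a = 0 then 0 else - s / l 0)"
    define d where "d i = (case i of 0 \<Rightarrow> b | Suc i \<Rightarrow> c i)" for i
    have bs: "b * l 0 + s = 0"
    proof (cases "a = 0")
      case True
      then have "s = 0" unfolding s_def l_def by simp
      then show ?thesis using True by (simp add: b_def)
    next
      case False
      then have "l 0 \<noteq> 0" using a by (simp add: l_def)
      then show ?thesis using False by (simp add: b_def)
    qed
    have "(\<Sum>i<Suc n. \<Sum>j<Suc n. d i * cnj (d j) * G i j) =
        (b * cnj b * (l 0 * cnj (l 0)) + (\<Sum>j<n. b * cnj (c j) * (l 0 * cnj (l (Suc j))))) +
        (\<Sum>i<n. c i * cnj b * (l (Suc i) * cnj (l 0)) + (\<Sum>j<n. c i * cnj (c j) * G (Suc i) (Suc j)))"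
      unfolding sum.lessThan_Suc_shift d_def using l0 l0' by simp
    also have "\<dots> = (b * l 0 + s) * cnj (b * l 0) + b * l 0 * cnj s + (\<Sum>i<n. \<Sum>j<n. c i * cnj (c j) * G (Suc i) (Suc j))"
      by (simp add: s_def sum.distrib sum_distrib_left sum_distrib_right algebra_simps)
    also have "\<dots> = (\<Sum>i<n. \<Sum>j<n. c i * cnj (c j) * G (Suc i) (Suc j)) - s * cnj s"
    proof -
      have "b * l 0 = - s" using bs by (simp add: eq_neg_iff_add_eq_0)
      then show ?thesis using bs by simp
    qed
    also have "s * cnj s = (\<Sum>i<n. \<Sum>j<n. c i * cnj (c j) * (l (Suc i) * cnj (l (Suc j))))"
      by (simp add: s_def sum_distrib_left sum_distrib_right mult_ac) (rule sum.swap)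
    finally have "(\<Sum>i<Suc n. \<Sum>j<Suc n. d i * cnj (d j) * G i j) =
       (\<Sum>i<n. \<Sum>j<n. c i * cnj (c j) * G' i j)"
      by (simp add: G'_def sum_subtractf[symmetric] right_diff_distrib)
    then show "0 \<le> Re (\<Sum>i<n. \<Sum>j<n. c i * cnj (c j) * G' i j)"
      using Suc.prems unfolding psd_def by (metis (no_types, lifting))
  qed
  from Suc.IH[OF this] obtain L' where L': "\<And>i k. i < k \<Longrightarrow> L' i k = 0"
    "\<And>i j. i < n \<Longrightarrow> j < n \<Longrightarrow> G' i j = (\<Sum>k<n. L' i k * cnj (L' j k))"
    by blast
  define L where "L i k = (if k = 0 then l i else if i = 0 then 0 else L' (i - 1) (k - 1))" for i k
  have "(\<Sum>k<Suc n. L i k * cnj (L j k)) = G i j" if ij: "i < Suc n" "j < Suc n" for i j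
  proof -
    have "(\<Sum>k<Suc n. L i k * cnj (L j k)) = l i * cnj (l j) +
        (if i = 0 \<or> j = 0 then 0 else G' (i - 1) (j - 1))"
      unfolding sum.lessThan_Suc_shift using ij L'(2)[of "i - 1" "j - 1"] by (auto simp: L_def)
    also have "\<dots> = G i j"
      using ij l0[of i] l0'[of j] by (cases i; cases j) (auto simp: G'_def)
    finally show ?thesis .
  qed
  moreover have "L i k = 0" if "i < k" for i k
    using that L'(1)[of "i - 1" "k - 1"] by (auto simp: L_def)
  ultimately show ?case by (intro exI[of _ L]) simp
qed

lemma det_mult_mat:
  fixes A B :: "nat \<Rightarrow> nat \<Rightarrow> complex"
  shows "Determinant.det (Matrix.mat n n (\<lambda>(i, j). \<Sum>k<n. A i k * B k j)) =
    Determinant.det (Matrix.mat n n (\<lambda>(i, j). A i j)) * Determinant.det (Matrix.mat n n (\<lambda>(i, j). B i j))"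
proof -
  have "Matrix.mat n n (\<lambda>(i, j). \<Sum>k<n. A i k * B k j) =
      Matrix.mat n n (\<lambda>(i, j). A i j) * Matrix.mat n n (\<lambda>(i, j). B i j)"
    by (rule eq_matI) (auto simp: scalar_prod_def atLeast0LessThan)
  then show ?thesis by (simp add: Determinant.det_mult[of _ n])
qed

lemma det_lower_mat:
  fixes A :: "nat \<Rightarrow> nat \<Rightarrow> complex"
  assumes "\<And>i k. i < k \<Longrightarrow> A i k = 0"
  shows "Determinant.det (Matrix.mat n n (\<lambda>(i, j). A i j)) = (\<Prod>i<n. A i i)"
proof -
  have "Determinant.det (Matrix.mat n n (\<lambda>(i, j). A i j)) = prod_list (diag_mat (Matrix.mat n n (\<lambda>(i, j). A i j)))"
    by (rule det_lower_triangular[of n]) (auto simp: assms)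
  also have "\<dots> = (\<Prod>i<n. A i i)"
    by (simp add: diag_mat_def prod.list_conv_set_nth atLeast0LessThan)
  finally show ?thesis .
qed

lemma det_conj_transpose:
  fixes A :: "nat \<Rightarrow> nat \<Rightarrow> complex"
  shows "Determinant.det (Matrix.mat n n (\<lambda>(i, j). cnj (A j i))) = cnj (Determinant.det (Matrix.mat n n (\<lambda>(i, j). A i j)))"
proof -
  have "Determinant.det (Matrix.mat n n (\<lambda>(i, j). cnj (A j i))) = Determinant.det (transpose_mat (Matrix.mat n n (\<lambda>(i, j). cnj (A i j))))"
    by (rule arg_cong[of _ _ Determinant.det], rule eq_matI) auto
  also have "\<dots> = Determinant.det (Matrix.mat n n (\<lambda>(i, j). cnj (A i j)))"
    by (rule det_transpose[of _ n]) auto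
  also have "\<dots> = cnj (Determinant.det (Matrix.mat n n (\<lambda>(i, j). A i j)))"
    by (subst (1 2) det_def'[of _ n]) (auto simp: atLeast0LessThan intro!: sum.cong prod.cong)
  finally show ?thesis .
qed

lemma sqrt_prod: "sqrt (\<Prod>i<n. f i) = (\<Prod>i<n. sqrt (f i))" for f :: "nat \<Rightarrow> real"
  by (induction n) (auto simp: real_sqrt_mult)

text \<open>In Cholesky coordinates the determinant is the product of the square moduli of the
  \<open>L i i\<close>, and the diagonal entry of \<open>G\<close> is the square norm of the whole
  row \<open>i\<close> of \<open>L\<close>, of which that is one summand.\<close>

lemma hadamard_psd:
  assumes "psd n G"
  shows "norm (Determinant.det (Matrix.mat n n (\<lambda>(i, j). G i j))) \<le> (\<Prod>i<n. Re (G i i))"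
proof -
  from cholesky[OF assms] obtain L where L: "\<And>i k. i < k \<Longrightarrow> L i k = 0"
    "\<And>i j. i < n \<Longrightarrow> j < n \<Longrightarrow> G i j = (\<Sum>k<n. L i k * cnj (L j k))" by blast
  have "Matrix.mat n n (\<lambda>(i, j). G i j) = Matrix.mat n n (\<lambda>(i, j). \<Sum>k<n. L i k * (\<lambda>k j. cnj (L j k)) k j)"
    by (rule eq_matI) (auto simp: L(2))
  then have "Determinant.det (Matrix.mat n n (\<lambda>(i, j). G i j)) = (\<Prod>i<n. L i i) * cnj (\<Prod>i<n. L i i)"
    using det_mult_mat[of n L "\<lambda>k j. cnj (L j k)"] by (simp add: det_conj_transpose det_lower_mat L(1))
  then have "norm (Determinant.det (Matrix.mat n n (\<lambda>(i, j). G i j))) = (\<Prod>i<n. (norm (L i i))\<^sup>2)"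
    by (simp add: norm_mult prod_norm[symmetric] power2_eq_square prod.distrib)
  also have "\<dots> \<le> (\<Prod>i<n. Re (G i i))"
  proof (intro prod_mono conjI)
    fix i assume i: "i \<in> {..<n}"
    have "Re (G i i) = (\<Sum>k<n. (norm (L i k))\<^sup>2)"
      using L(2)[of i i] i by (simp add: complex_norm_square[symmetric] del: of_real_power)
    also have "\<dots> \<ge> (norm (L i i))\<^sup>2"
      using i by (intro member_le_sum) auto
    finally show "(norm (L i i))\<^sup>2 \<le> Re (G i i)" .
  qed auto
  finally show ?thesis .
qed

text \<open>The indices below \<open>n\<close> stand for the vectors \<open>v\<close>, those from \<open>n\<close> on for the vectors \<open>u\<close>:
  in the Cholesky coordinates the \<open>v\<close> are supported on the first \<open>n\<close> coordinates.\<close>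

lemma hadamard_mixed:
  assumes "psd (2 * n) G"
  shows "norm (Determinant.det (Matrix.mat n n (\<lambda>(i, j). G (n + j) i))) \<le>
    (\<Prod>i<n. sqrt (Re (G i i)) * sqrt (Re (G (n + i) (n + i))))"
proof -
  from cholesky[OF assms] obtain L where L: "\<And>i k. i < k \<Longrightarrow> L i k = 0"
    "\<And>i j. i < 2*n \<Longrightarrow> j < 2*n \<Longrightarrow> G i j = (\<Sum>k<2*n. L i k * cnj (L j k))" by blast
  define W where "W j k = L (n + j) k" for j k
  have eq: "G i j = (\<Sum>k<n. L i k * cnj (L j k))" if "i < 2*n" "j < n" for i j
    unfolding L(2)[OF that(1), of j, OF trans_less_add1[OF that(2), of n, folded mult_2]]
    by (intro sum.mono_neutral_right) (use that L(1) in auto)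
  have "Matrix.mat n n (\<lambda>(i, j). G (n + j) i) = Matrix.mat n n (\<lambda>(i, j). \<Sum>k<n. cnj (L i k) * (\<lambda>k j. W j k) k j)"
    by (rule eq_matI) (auto simp: eq W_def mult_ac)
  then have "Determinant.det (Matrix.mat n n (\<lambda>(i, j). G (n + j) i)) =
      (\<Prod>i<n. cnj (L i i)) * Determinant.det (Matrix.mat n n (\<lambda>(i, j). W j i))"
    using det_mult_mat[of n "\<lambda>i k. cnj (L i k)" "\<lambda>k j. W j k"]
    by (simp add: det_lower_mat[of "\<lambda>i k. cnj (L i k)"] L(1))
  then have n1: "norm (Determinant.det (Matrix.mat n n (\<lambda>(i, j). G (n + j) i))) =
      (\<Prod>i<n. norm (L i i)) * norm (Determinant.det (Matrix.mat n n (\<lambda>(i, j). W j i)))"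
    by (simp add: norm_mult prod_norm[symmetric])
  have Gd: "Re (G i i) = (\<Sum>k<2*n. (norm (L i k))\<^sup>2)" if "i < 2*n" for i
    using L(2)[of i i] that by (simp add: complex_norm_square[symmetric] del: of_real_power)
  \<comment> \<open>\<open>H\<close> is the Gram matrix of the vectors \<open>u\<close> projected to
    the first \<open>n\<close> coordinates. Its determinant is the square modulus of the factor
    still to be bounded, so the positive case applies, and projecting only lowers the
    diagonal.\<close>
  define H where "H i j = (\<Sum>k<n. W i k * cnj (W j k))" for i j
  have "psd n H"
    unfolding psd_def
  proof (intro conjI allI impI)
    fix c :: "nat \<Rightarrow> complex"
    have "(\<Sum>i<n. \<Sum>j<n. c i * cnj (c j) * H i j) = (\<Sum>i<n. \<Sum>j<n. \<Sum>k<n. (c i * W i k) * cnj (c j * W j k))"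
      by (simp add: H_def sum_distrib_left mult_ac)
    also have "\<dots> = (\<Sum>i<n. \<Sum>k<n. \<Sum>j<n. (c i * W i k) * cnj (c j * W j k))"
      by (intro sum.cong refl sum.swap)
    also have "\<dots> = (\<Sum>k<n. \<Sum>i<n. \<Sum>j<n. (c i * W i k) * cnj (c j * W j k))"
      by (rule sum.swap)
    also have "\<dots> = (\<Sum>k<n. of_real ((norm (\<Sum>i<n. c i * W i k))\<^sup>2))"
      unfolding complex_norm_square cnj_sum sum_product ..
    finally show "0 \<le> Re (\<Sum>i<n. \<Sum>j<n. c i * cnj (c j) * H i j)"
      by (simp add: sum_nonneg)
  qed (auto simp: H_def mult_ac)
  have "Determinant.det (Matrix.mat n n (\<lambda>(i, j). H i j)) =
      Determinant.det (Matrix.mat n n (\<lambda>(i, j). W i j)) * cnj (Determinant.det (Matrix.mat n n (\<lambda>(i, j). W i j)))"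
    unfolding H_def using det_mult_mat[of n W "\<lambda>k j. cnj (W j k)"] by (simp add: det_conj_transpose)
  moreover have "Determinant.det (Matrix.mat n n (\<lambda>(i, j). W j i)) = Determinant.det (Matrix.mat n n (\<lambda>(i, j). W i j))"
    by (subst det_transpose[of "Matrix.mat n n (\<lambda>(i, j). W i j)" n, symmetric])
       (auto intro!: arg_cong[of _ _ Determinant.det])
  ultimately have "(norm (Determinant.det (Matrix.mat n n (\<lambda>(i, j). W j i))))\<^sup>2 =
      norm (Determinant.det (Matrix.mat n n (\<lambda>(i, j). H i j)))"
    by (simp add: norm_mult power2_eq_square)
  also have "\<dots> \<le> (\<Prod>i<n. Re (H i i))"
    by (rule hadamard_psd[OF \<open>psd n H\<close>])
  also have "\<dots> \<le> (\<Prod>i<n. Re (G (n + i) (n + i)))"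
  proof (intro prod_mono conjI)
    fix i assume i: "i \<in> {..<n}"
    have H: "Re (H i i) = (\<Sum>k<n. (norm (L (n + i) k))\<^sup>2)"
      by (simp add: H_def W_def complex_norm_square[symmetric] del: of_real_power)
    then show "0 \<le> Re (H i i)" by (simp add: sum_nonneg)
    show "Re (H i i) \<le> Re (G (n + i) (n + i))"
      unfolding H using i by (subst Gd) (auto intro!: sum_mono2)
  qed
  finally have "norm (Determinant.det (Matrix.mat n n (\<lambda>(i, j). W j i))) \<le> sqrt (\<Prod>i<n. Re (G (n + i) (n + i)))"
    using real_le_rsqrt by blast
  also have "\<dots> = (\<Prod>i<n. sqrt (Re (G (n + i) (n + i))))"
    by (rule sqrt_prod)
  finally have n2: "norm (Determinant.det (Matrix.mat n n (\<lambda>(i, j). W j i))) \<le> \<dots>" .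
  have n3: "(\<Prod>i<n. norm (L i i)) \<le> (\<Prod>i<n. sqrt (Re (G i i)))"
  proof (intro prod_mono conjI)
    fix i assume i: "i \<in> {..<n}"
    have "(norm (L i i))\<^sup>2 \<le> Re (G i i)"
      using i by (subst Gd) (auto intro!: member_le_sum[of i _ "\<lambda>k. (norm (L i k))\<^sup>2"])
    then show "norm (L i i) \<le> sqrt (Re (G i i))" by (rule real_le_rsqrt)
  qed auto
  show ?thesis
    unfolding n1 prod.distrib using n2 n3
    by (intro mult_mono order_trans[OF _ n3]) (auto intro: prod_nonneg)
qed

section \<open>Leibniz expansion and the Cauchy-Binet formula for determinants indexed by
  lists\<close>

lemma list_det_leibniz:
  assumes "length is = length js"
  shows "list_det A is js = (\<Sum>p | p permutes {0..<length is}.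
    signof p * (\<Prod>a = 0..<length is. A (is ! a) (js ! p a)))"
proof -
  have "list_det A is js = (\<Sum>p | p permutes {0..<length is}. signof p * (\<Prod>a = 0..<length is.
      Matrix.mat (length is) (length js) (\<lambda>(a, b). A (is ! a) (js ! b)) $$ (a, p a)))"
    unfolding list_det_def by (rule det_def') (simp add: assms)
  also have "\<dots> = (\<Sum>p | p permutes {0..<length is}. signof p * (\<Prod>a = 0..<length is. A (is ! a) (js ! p a)))"
    using assms by (intro sum.cong refl arg_cong2[of _ _ _ _ times] prod.cong) auto
  finally show ?thesis .
qed

lemma list_det_transpose:
  assumes "length is = length js"
  shows "list_det A is js = list_det (\<lambda>j i. A i j) js is"
proof -
  have "list_det (\<lambda>j i. A i j) js is =
      Determinant.det (transpose_mat (Matrix.mat (length is) (length js) (\<lambda>(a, b). A (is ! a) (js ! b))))"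
    unfolding list_det_def by (rule arg_cong[of _ _ Determinant.det], rule eq_matI) auto
  then show ?thesis
    unfolding list_det_def by (subst (asm) det_transpose[of _ "length js"]) (auto simp: assms)
qed

text \<open>Expanding every row of the product gives a sum over maps \<open>f\<close> from positions
  to \<open>K\<close>. A map with a repeated value produces two equal rows; the injective maps with
  image \<open>T\<close> differ by permutations, which assemble the determinant of \<open>A\<close>.
  The enumeration \<open>en\<close> is arbitrary, since a change of order alters both factors by the
  same sign.\<close>

lemma cauchy_binet:
  fixes A :: "'i \<Rightarrow> 'k \<Rightarrow> complex" and B :: "'k \<Rightarrow> 'j \<Rightarrow> complex"
  assumes "finite K" "length is = length js"
    and en: "\<And>T. T \<subseteq> K \<Longrightarrow> distinct (en T) \<and> set (en T) = T"
  shows "list_det (\<lambda>i j. \<Sum>k\<in>K. A i k * B k j) is js =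
    (\<Sum>T | T \<subseteq> K \<and> card T = length is. list_det A is (en T) * list_det B (en T) js)"
proof -
  define n where "n = length is"
  define F where "F = PiE {0..<n} (\<lambda>_. K)"
  define D where "D f = Determinant.det (Matrix.mat n n (\<lambda>(a, b). B (f a) (js ! b)))" for f
  define h where "h f = (\<Prod>a = 0..<n. A (is ! a) (f a)) * D f" for f
  have finF: "finite F"
    unfolding F_def using assms(1) by (intro finite_PiE) auto
  have D: "D f = (\<Sum>p | p permutes {0..<n}. signof p * (\<Prod>a = 0..<n. B (f a) (js ! p a)))" for f
    unfolding D_def by (subst det_def'[of _ n]) (auto intro!: sum.cong prod.cong)
  have "list_det (\<lambda>i j. \<Sum>k\<in>K. A i k * B k j) is js =
      (\<Sum>p | p permutes {0..<n}. signof p * (\<Sum>f\<in>F. \<Prod>a = 0..<n. A (is ! a) (f a) * B (f a) (js ! p a)))"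
    unfolding list_det_leibniz[OF assms(2)] n_def[symmetric] F_def
    by (subst prod_sum_PiE) (auto simp: assms(1))
  also have "\<dots> = (\<Sum>f\<in>F. h f)"
    unfolding sum_distrib_left h_def D prod.distrib
    by (subst sum.swap) (simp add: mult_ac)
  also have "\<dots> = (\<Sum>f | f \<in> F \<and> inj_on f {0..<n}. h f)"
  proof (intro sum.mono_neutral_right ballI finF)
    fix f assume "f \<in> F - {f \<in> F. inj_on f {0..<n}}"
    then obtain a b where ab: "a < n" "b < n" "a \<noteq> b" "f a = f b"
      unfolding inj_on_def by auto
    have "D f = 0"
      unfolding D_def
      by (rule det_identical_rows[of _ n a b]) (use ab in \<open>auto intro!: eq_vecI simp: Matrix.row_def\<close>)
    then show "h f = 0" by (simp add: h_def)
  qed auto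
  also have "\<dots> = (\<Sum>T | T \<subseteq> K \<and> card T = n. \<Sum>f | f \<in> {f \<in> F. inj_on f {0..<n}} \<and> f ` {0..<n} = T. h f)"
    by (rule sum.group[symmetric]) (use finF assms(1) in \<open>auto simp: F_def card_image\<close>)
  also have "\<dots> = (\<Sum>T | T \<subseteq> K \<and> card T = n. list_det A is (en T) * list_det B (en T) js)"
  proof (intro sum.cong refl)
    fix T assume T: "T \<in> {T. T \<subseteq> K \<and> card T = n}"
    have e: "distinct (en T)" "set (en T) = T" "length (en T) = n"
      using en[of T] T distinct_card[of "en T"] by auto
    define g where "g = (!) (en T)"
    have g: "bij_betw g {0..<n} T"
      using bij_betw_nth[OF e(1), of "{0..<n}" T] e by (auto simp: g_def atLeast0LessThan)
    define gi where "gi = the_inv_into {0..<n} g"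
    have gi: "gi (g a) = a" if "a < n" for a
      unfolding gi_def by (rule the_inv_into_f_f) (use that g in \<open>auto simp: bij_betw_def\<close>)
    have ginv: "g (gi t) = t" "gi t < n" if "t \<in> T" for t
      using that g f_the_inv_into_f_bij_betw[OF g] the_inv_into_into[of g "{0..<n}" t "{0..<n}"]
      by (auto simp: gi_def bij_betw_def)
    \<comment> \<open>An injective \<open>f\<close> with image \<open>T\<close> is \<open>g\<close>
      after a permutation \<open>s\<close>. The two sides use different defaults: \<open>f\<close>
      is \<open>undefined\<close> off the positions, being an element of \<open>PiE\<close>, while
      \<open>s\<close> is the identity there.\<close>
    have "(\<Sum>f | f \<in> {f \<in> F. inj_on f {0..<n}} \<and> f ` {0..<n} = T. h f) =
        (\<Sum>s | s permutes {0..<n}. (\<Prod>a = 0..<n. A (is ! a) (g (s a))) * (signof s * list_det B (en T) js))"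
    proof (rule sum.reindex_bij_witness[where
          i = "\<lambda>s a. if a \<in> {0..<n} then g (s a) else undefined" and
          j = "\<lambda>f a. if a < n then gi (f a) else a"])
      fix f assume f: "f \<in> {f \<in> {f \<in> F. inj_on f {0..<n}}. f ` {0..<n} = T}"
      have fT: "f a \<in> T" if "a < n" for a using f that by auto
      show "(\<lambda>a. if a \<in> {0..<n} then g ((\<lambda>a. if a < n then gi (f a) else a) a) else undefined) = f"
        using f fT ginv by (auto simp: F_def PiE_def extensional_def)
      define s where "s = (\<lambda>a. if a < n then gi (f a) else a)"
      have gs: "g (s a) = f a" "s a < n" if "a < n" for a
        using fT[OF that] ginv that by (auto simp: s_def)
      have "inj_on s {0..<n}"
      proof (rule inj_onI)
        fix a b assume ab: "a \<in> {0..<n}" "b \<in> {0..<n}" "s a = s b"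
        then have "f a = f b" using gs(1)[of a] gs(1)[of b] by simp
        then show "a = b" using f ab by (auto dest: inj_onD)
      qed
      moreover have "s ` {0..<n} \<subseteq> {0..<n}" using gs(2) by auto
      ultimately have "bij_betw s {0..<n} {0..<n}"
        by (intro bij_betw_imageI endo_inj_surj) auto
      then show s: "(\<lambda>a. if a < n then gi (f a) else a) \<in> {s. s permutes {0..<n}}"
        unfolding s_def[symmetric] by (auto intro!: bij_imp_permutes simp: s_def)
      have "D f = Determinant.det (Matrix.mat n n (\<lambda>(i, j). Matrix.mat n n (\<lambda>(a, b). B (g a) (js ! b)) $$ (s i, j)))"
        unfolding D_def by (rule arg_cong[of _ _ Determinant.det], rule eq_matI) (auto simp: gs)
      also have "\<dots> = signof s * Determinant.det (Matrix.mat n n (\<lambda>(a, b). B (g a) (js ! b)))"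
        by (rule det_permute_rows) (use s in \<open>auto simp: s_def\<close>)
      also have "Determinant.det (Matrix.mat n n (\<lambda>(a, b). B (g a) (js ! b))) = list_det B (en T) js"
        unfolding list_det_def using e assms(2) by (simp add: g_def n_def)
      finally show "(\<Prod>a = 0..<n. A (is ! a) (g (if a < n then gi (f a) else a))) *
          (signof (\<lambda>a. if a < n then gi (f a) else a) * list_det B (en T) js) = h f"
        unfolding h_def s_def[symmetric] using gs by (auto simp: s_def)
    next
      fix s assume s: "s \<in> {s. s permutes {0..<n}}"
      then have sn: "s a < n" if "a < n" for a
        using that permutes_in_image[of s "{0..<n}" a] by auto
      show "(\<lambda>a. if a < n then gi (if a \<in> {0..<n} then g (s a) else undefined) else a) = s"
        using s gi sn by (auto simp: permutes_def)
      have img: "(\<lambda>a. g (s a)) ` {0..<n} = T"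
      proof -
        have "s ` {0..<n} = {0..<n}" using permutes_image[of s "{0..<n}"] s by simp
        then show ?thesis using g by (metis bij_betw_def image_image)
      qed
      have "inj_on (\<lambda>a. g (s a)) {0..<n}"
      proof (rule inj_onI)
        fix a b assume ab: "a \<in> {0..<n}" "b \<in> {0..<n}" "g (s a) = g (s b)"
        then have "s a = s b"
          using g sn by (auto simp: bij_betw_def dest: inj_onD)
        then show "a = b" using permutes_inj[of s] s by (auto dest: injD)
      qed
      then have "inj_on (\<lambda>a. if a \<in> {0..<n} then g (s a) else undefined) {0..<n}"
        by (subst inj_on_cong[where g = "\<lambda>a. g (s a)"]) auto
      then show "(\<lambda>a. if a \<in> {0..<n} then g (s a) else undefined) \<in>
          {f \<in> {f \<in> F. inj_on f {0..<n}}. f ` {0..<n} = T}"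
        using img T
        by (auto simp: F_def PiE_def extensional_def cong: image_cong_simp)
    qed
    also have "\<dots> = list_det A is (en T) * list_det B (en T) js"
      by (subst list_det_leibniz[of "is" "en T"])
         (auto simp: e n_def[symmetric] g_def sum_distrib_right sum_distrib_left mult_ac)
    finally show "(\<Sum>f | f \<in> {f \<in> F. inj_on f {0..<n}} \<and> f ` {0..<n} = T. h f) = \<dots>" .
  qed
  finally show ?thesis by (simp add: n_def)
qed

subsection \<open>Inner products\<close>

lemma scaleC_one [simp]: "1 *\<^sub>C x = x" for x :: "'a::complex_hilbert_space"
  using scaleR_scaleC[of 1 x] by simp

lemma scaleC_zero_left [simp]: "0 *\<^sub>C x = 0" for x :: "'a::complex_hilbert_space"
  using scaleR_scaleC[of 0 x] by simp

lemma scaleC_zero_right [simp]: "a *\<^sub>C 0 = (0 :: 'a::complex_hilbert_space)"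
  using scaleC_add_right[of a 0 "0 :: 'a"] by simp

lemma scaleC_minus_left [simp]: "(- a) *\<^sub>C x = - (a *\<^sub>C x)" for x :: "'a::complex_hilbert_space"
  using scaleC_add_left[of a "- a" x] by (simp add: eq_neg_iff_add_eq_0 add.commute)

lemma scaleC_minus_right [simp]: "a *\<^sub>C (- x) = - (a *\<^sub>C x)" for x :: "'a::complex_hilbert_space"
  using scaleC_add_right[of a x "- x"] by (simp add: eq_neg_iff_add_eq_0 add.commute)

lemma scaleC_diff_right: "a *\<^sub>C (x - y) = a *\<^sub>C x - a *\<^sub>C y" for x :: "'a::complex_hilbert_space"
  using scaleC_add_right[of a x "- y"] by simp

lemma scaleC_sum_right: "a *\<^sub>C (\<Sum>i\<in>I. f i) = (\<Sum>i\<in>I. a *\<^sub>C f i)"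
  for f :: "'i \<Rightarrow> 'a::complex_hilbert_space"
  by (induction I rule: infinite_finite_induct) (auto simp: scaleC_add_right)

lemma scaleC_complex [simp]: "a *\<^sub>C z = a * z" for z :: complex
  by (simp add: scaleC_complex_def)

lemma cinner_complex [simp]: "cinner z w = z * cnj w" for z :: complex
  by (simp add: cinner_complex_def)

lemma cinner_add_right: "cinner x (y + z) = cinner x y + cinner x z"
  by (metis cinner_add_left cinner_commute complex_cnj_add)

lemma cinner_scaleC_right: "cinner x (a *\<^sub>C y) = cnj a * cinner x y"
  by (metis cinner_scaleC_left cinner_commute complex_cnj_mult)

lemma cinner_zero_left [simp]: "cinner 0 y = 0"
  using cinner_scaleC_left[of 0 0 y] by simp

lemma cinner_zero_right [simp]: "cinner x 0 = 0"
  using cinner_scaleC_right[of x 0 0] by simp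

lemma cinner_minus_left: "cinner (- x) y = - cinner x y"
  using cinner_scaleC_left[of "-1" x y] by simp

lemma cinner_minus_right: "cinner x (- y) = - cinner x y"
  using cinner_scaleC_right[of x "-1" y] by simp

lemma cinner_diff_left: "cinner (x - y) z = cinner x z - cinner y z"
  using cinner_add_left[of x "- y" z] by (simp add: cinner_minus_left)

lemma cinner_diff_right: "cinner x (y - z) = cinner x y - cinner x z"
  using cinner_add_right[of x y "- z"] by (simp add: cinner_minus_right)

lemma cinner_sum_left: "cinner (\<Sum>i\<in>I. f i) y = (\<Sum>i\<in>I. cinner (f i) y)"
  by (induction I rule: infinite_finite_induct) (auto simp: cinner_add_left)

lemma cinner_sum_right: "cinner x (\<Sum>i\<in>I. f i) = (\<Sum>i\<in>I. cinner x (f i))"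
  by (induction I rule: infinite_finite_induct) (auto simp: cinner_add_right)

lemma norm_scaleC: "norm (a *\<^sub>C x) = norm a * norm x" for x :: "'a::complex_hilbert_space"
proof -
  have "complex_of_real ((norm (a *\<^sub>C x))\<^sup>2) = (a * cnj a) * cinner x x"
    unfolding cinner_self[symmetric] by (simp add: cinner_scaleC_left cinner_scaleC_right)
  also have "\<dots> = of_real ((norm a)\<^sup>2) * of_real ((norm x)\<^sup>2)"
    unfolding cinner_self complex_norm_square ..
  finally have "complex_of_real ((norm (a *\<^sub>C x))\<^sup>2) = of_real ((norm a * norm x)\<^sup>2)"
    unfolding power_mult_distrib of_real_mult .
  then have "(norm (a *\<^sub>C x))\<^sup>2 = (norm a * norm x)\<^sup>2"
    using of_real_eq_iff by blast
  then show ?thesis by (simp add: power2_eq_iff_nonneg)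
qed

text \<open>The discriminant argument detached from any inner product: it is applied to
  \<open>cinner\<close>, to \<open>l2_inner\<close> and to the form of I - K in
  \<open>square_coercive\<close>. Definiteness is not assumed, hence the separate case c =
  0.\<close>

lemma quadratic_cauchy_schwarz:
  fixes a c :: real and b :: complex
  assumes "0 \<le> c" and *: "\<And>z. 0 \<le> a + 2 * Re (z * b) + (norm z)\<^sup>2 * c"
  shows "(norm b)\<^sup>2 \<le> a * c"
proof (cases "c = 0")
  case True
  have "0 \<le> a - 2 * t * (norm b)\<^sup>2" for t
  proof -
    have "- of_real t * cnj b * b = of_real (- t * (norm b)\<^sup>2)"
      unfolding of_real_mult complex_norm_square by (simp add: mult_ac)
    then show ?thesis using *[of "- of_real t * cnj b"] True unfolding \<open>- of_real t * cnj b * b = _\<close> Re_complex_of_real by (auto simp: mult.assoc)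
  qed
  note * = this
  have "0 \<le> a" using *[of 0] by simp
  moreover have "b \<noteq> 0 \<Longrightarrow> 0 \<le> a - 2 * (a + 1)" using *[of "(a + 1) / (norm b)\<^sup>2"] by simp
  ultimately have "b = 0" by (smt (verit))
  then show ?thesis using True by simp
next
  case False
  \<comment> \<open>\<open>- cnj b / c\<close> is the minimiser of the quadratic expression.\<close>
  have e: "- (of_real (1 / c) * cnj b) * b = of_real (- (norm b)\<^sup>2 / c)"
    unfolding of_real_divide of_real_minus complex_norm_square by (simp add: mult_ac)
  have n: "(norm (- (of_real (1 / c) * cnj b)))\<^sup>2 * c = (norm b)\<^sup>2 / c"
    using False assms(1) by (simp add: norm_mult power2_eq_square norm_divide)
  have "0 \<le> a - (norm b)\<^sup>2 / c"
    using *[of "- (of_real (1 / c) * cnj b)"] unfolding e n by simp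
  then show ?thesis using False assms(1) by (simp add: field_simps)
qed

lemma norm_add_scaleC_square:
  "(norm (x + a *\<^sub>C y))\<^sup>2 = (norm x)\<^sup>2 + 2 * Re (cnj a * cinner x y) + (norm a)\<^sup>2 * (norm y)\<^sup>2"
  for x :: "'a::complex_hilbert_space"
proof -
  have "complex_of_real ((norm (x + a *\<^sub>C y))\<^sup>2) =
      cinner x x + (cnj a * cinner x y + cnj (cnj a * cinner x y)) + (a * cnj a) * cinner y y"
    unfolding cinner_self[symmetric] by (simp add: cinner_add_left cinner_add_right cinner_scaleC_left
      cinner_scaleC_right cinner_commute[of y x] algebra_simps)
  also have "\<dots> = of_real ((norm x)\<^sup>2 + 2 * Re (cnj a * cinner x y) + (norm a)\<^sup>2 * (norm y)\<^sup>2)"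
    unfolding cinner_self complex_norm_square[symmetric] complex_add_cnj by simp
  finally show ?thesis using of_real_eq_iff by blast
qed

lemma norm_cinner_le: "norm (cinner x y) \<le> norm x * norm y" for x :: "'a::complex_hilbert_space"
proof -
  have "(norm (cinner x y))\<^sup>2 \<le> (norm x)\<^sup>2 * (norm y)\<^sup>2"
  proof (rule quadratic_cauchy_schwarz)
    fix z show "0 \<le> (norm x)\<^sup>2 + 2 * Re (z * cinner x y) + (norm z)\<^sup>2 * (norm y)\<^sup>2"
      using norm_add_scaleC_square[of x "cnj z" y] by (metis complex_cnj_cnj complex_mod_cnj zero_le_power2)
  qed simp
  then show ?thesis by (intro power2_le_imp_le[OF _ mult_nonneg_nonneg]) (simp_all add: power_mult_distrib)
qed

lemma bounded_bilinear_cinner: "bounded_bilinear (cinner :: 'a::complex_hilbert_space \<Rightarrow> 'a \<Rightarrow> complex)"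
  by (rule bounded_bilinear.intro)
     (auto simp: cinner_add_left cinner_add_right scaleR_scaleC cinner_scaleC_left cinner_scaleC_right
       intro!: exI[of _ 1] norm_cinner_le)

lemma bounded_bilinear_scaleC: "bounded_bilinear (scaleC :: complex \<Rightarrow> 'a::complex_hilbert_space \<Rightarrow> 'a)"
  by (rule bounded_bilinear.intro)
     (auto simp: scaleC_add_left scaleC_add_right scaleR_scaleC scaleC_scaleC norm_scaleC mult.commute
       intro!: exI[of _ 1])

lemma borel_measurable_cinner [measurable]:
  fixes f g :: "'x \<Rightarrow> 'a::{complex_hilbert_space, second_countable_topology}"
  assumes "f \<in> borel_measurable M" "g \<in> borel_measurable M"
  shows "(\<lambda>x. cinner (f x) (g x)) \<in> borel_measurable M"
  using assms
  by (rule borel_measurable_continuous_Pair)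
     (intro bounded_bilinear.continuous_on[OF bounded_bilinear_cinner] continuous_intros)

lemma borel_measurable_scaleC [measurable]:
  fixes g :: "'x \<Rightarrow> 'a::{complex_hilbert_space, second_countable_topology}"
  assumes "f \<in> borel_measurable M" "g \<in> borel_measurable M"
  shows "(\<lambda>x. f x *\<^sub>C g x) \<in> borel_measurable M"
  using assms
  by (rule borel_measurable_continuous_Pair)
     (intro bounded_bilinear.continuous_on[OF bounded_bilinear_scaleC] continuous_intros)

lemma integral_cinner_left:
  fixes f :: "'x \<Rightarrow> 'a::{complex_hilbert_space, second_countable_topology}"
  shows "integrable M f \<Longrightarrow> (LINT x|M. cinner (f x) y) = cinner (LINT x|M. f x) y"
  by (rule integral_bounded_linear[OF bounded_bilinear.bounded_linear_left[OF bounded_bilinear_cinner]])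

lemma integral_scaleC_left:
  fixes y :: "'a::{complex_hilbert_space, second_countable_topology}"
  shows "integrable M f \<Longrightarrow> (LINT x|M. f x *\<^sub>C y) = (LINT x|M. f x) *\<^sub>C y"
  by (rule integral_bounded_linear[OF bounded_bilinear.bounded_linear_left[OF bounded_bilinear_scaleC]])

subsection \<open>Square integrable functions\<close>

lemma L2_measurable: "f \<in> L2 \<Longrightarrow> f \<in> borel_measurable half_line"
  by (simp add: L2_def)

lemma L2_integrable: "f \<in> L2 \<Longrightarrow> integrable half_line (\<lambda>t. (norm (f t))\<^sup>2)"
  by (simp add: L2_def)

lemma L2_zero [simp]: "(\<lambda>t. 0) \<in> L2"
  by (simp add: L2_def)

lemma L2_add:
  assumes "f \<in> L2" "g \<in> L2" shows "(\<lambda>t. f t + g t) \<in> L2"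
proof -
  note [measurable] = L2_measurable[OF assms(1)] L2_measurable[OF assms(2)]
  have "integrable half_line (\<lambda>t. (norm (f t + g t))\<^sup>2)"
  proof (rule Bochner_Integration.integrable_bound)
    show "integrable half_line (\<lambda>t. 2 * (norm (f t))\<^sup>2 + 2 * (norm (g t))\<^sup>2)"
      using assms by (intro Bochner_Integration.integrable_add integrable_mult_right L2_integrable)
    have "(norm (f t + g t))\<^sup>2 \<le> 2 * (norm (f t))\<^sup>2 + 2 * (norm (g t))\<^sup>2" for t
    proof -
      have "(norm (f t + g t))\<^sup>2 \<le> (norm (f t) + norm (g t))\<^sup>2"
        by (intro power_mono norm_triangle_ineq) auto
      also have "\<dots> \<le> 2 * (norm (f t))\<^sup>2 + 2 * (norm (g t))\<^sup>2"
        using zero_le_power2[of "norm (f t) - norm (g t)"] by (simp add: power2_eq_square algebra_simps)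
      finally show ?thesis .
    qed
    then show "AE t in half_line. norm ((norm (f t + g t))\<^sup>2) \<le> norm (2 * (norm (f t))\<^sup>2 + 2 * (norm (g t))\<^sup>2)"
      by (intro AE_I2) simp
  qed measurable
  then show ?thesis by (simp add: L2_def)
qed

lemma L2_scaleC:
  assumes "f \<in> L2" shows "(\<lambda>t. a *\<^sub>C f t) \<in> L2"
  using assms by (auto simp: L2_def norm_scaleC power_mult_distrib)

lemma L2_mult: "f \<in> L2 \<Longrightarrow> (\<lambda>t. a * f t) \<in> L2" for f :: "real \<Rightarrow> complex"
  using L2_scaleC[of f a] by simp

lemma L2_diff:
  assumes "f \<in> L2" "g \<in> L2" shows "(\<lambda>t. f t - g t) \<in> L2"
  using L2_add[OF assms(1) L2_scaleC[OF assms(2), of "-1"]] by simp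

lemma L2_sum: "(\<And>i. i \<in> I \<Longrightarrow> f i \<in> L2) \<Longrightarrow> (\<lambda>t. \<Sum>i\<in>I. f i t) \<in> L2"
  by (induction I rule: infinite_finite_induct) (auto intro: L2_add)

lemma integrable_norm_mult:
  assumes "f \<in> L2" "g \<in> L2"
  shows "integrable half_line (\<lambda>t. norm (f t) * norm (g t))"
proof -
  note [measurable] = L2_measurable[OF assms(1)] L2_measurable[OF assms(2)]
  have *: "integrable half_line (\<lambda>t. (norm (f t))\<^sup>2 + (norm (g t))\<^sup>2)"
    using assms by (intro Bochner_Integration.integrable_add L2_integrable)
  have **: "norm (f t) * norm (g t) \<le> (norm (f t))\<^sup>2 + (norm (g t))\<^sup>2" for t
    using sum_squares_bound[of "norm (f t)" "norm (g t)"] mult_nonneg_nonneg[of "norm (f t)" "norm (g t)"]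
    unfolding mult.assoc using norm_ge_zero[of "f t"] norm_ge_zero[of "g t"] by linarith
  show "integrable half_line (\<lambda>t. norm (f t) * norm (g t))"
    using * by (rule Bochner_Integration.integrable_bound) (auto intro!: AE_I2 order_trans[OF **])
qed

lemma integrable_cinner:
  assumes "f \<in> L2" "g \<in> L2"
  shows "integrable half_line (\<lambda>t. cinner (f t) (g t))"
proof -
  note [measurable] = L2_measurable[OF assms(1)] L2_measurable[OF assms(2)]
  show ?thesis
    using integrable_norm_mult[OF assms] by (rule Bochner_Integration.integrable_bound)
      (auto intro!: AE_I2 norm_cinner_le)
qed

lemma integrable_scaleC:
  assumes "f \<in> L2" "g \<in> L2"
  shows "integrable half_line (\<lambda>t. f t *\<^sub>C g t)"
proof -
  note [measurable] = L2_measurable[OF assms(1)] L2_measurable[OF assms(2)]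
  show ?thesis
    using integrable_norm_mult[OF assms] by (rule Bochner_Integration.integrable_bound)
     (auto simp: norm_scaleC intro!: AE_I2)
qed

lemma l2_norm_nonneg [simp]: "0 \<le> l2_norm f"
  by (simp add: l2_norm_def)

lemma l2_norm_square: "(l2_norm f)\<^sup>2 = (LINT t|half_line. (norm (f t))\<^sup>2)"
  by (simp add: l2_norm_def)

lemma l2_inner_self: "l2_inner f f = of_real ((l2_norm f)\<^sup>2)"
  by (simp add: l2_inner_def cinner_self l2_norm_square del: of_real_power)

lemma l2_inner_commute: "l2_inner f g = cnj (l2_inner g f)"
proof -
  have "l2_inner f g = (LINT t|half_line. cnj (cinner (g t) (f t)))"
    unfolding l2_inner_def by (intro Bochner_Integration.integral_cong refl cinner_commute)
  then show ?thesis unfolding l2_inner_def by simp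
qed

lemma l2_inner_add_left:
  "f \<in> L2 \<Longrightarrow> g \<in> L2 \<Longrightarrow> h \<in> L2 \<Longrightarrow> l2_inner (\<lambda>t. f t + g t) h = l2_inner f h + l2_inner g h"
  by (simp add: l2_inner_def cinner_add_left integrable_cinner)

lemma l2_inner_diff_left:
  "f \<in> L2 \<Longrightarrow> g \<in> L2 \<Longrightarrow> h \<in> L2 \<Longrightarrow> l2_inner (\<lambda>t. f t - g t) h = l2_inner f h - l2_inner g h"
  by (simp add: l2_inner_def cinner_diff_left integrable_cinner)

lemma l2_inner_scaleC_left: "l2_inner (\<lambda>t. a *\<^sub>C f t) h = a * l2_inner f h"
  by (simp add: l2_inner_def cinner_scaleC_left)

lemma l2_inner_zero_left [simp]: "l2_inner (\<lambda>t. 0) h = 0"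
  by (simp add: l2_inner_def)

lemma l2_inner_sum_left:
  assumes "\<And>i. i \<in> I \<Longrightarrow> f i \<in> L2" "h \<in> L2"
  shows "l2_inner (\<lambda>t. \<Sum>i\<in>I. f i t) h = (\<Sum>i\<in>I. l2_inner (f i) h)"
  using assms by (simp add: l2_inner_def cinner_sum_left Bochner_Integration.integral_sum integrable_cinner)

lemma l2_inner_add_right:
  "f \<in> L2 \<Longrightarrow> g \<in> L2 \<Longrightarrow> h \<in> L2 \<Longrightarrow> l2_inner h (\<lambda>t. f t + g t) = l2_inner h f + l2_inner h g"
  by (simp add: l2_inner_def cinner_add_right integrable_cinner)

lemma l2_inner_diff_right:
  "f \<in> L2 \<Longrightarrow> g \<in> L2 \<Longrightarrow> h \<in> L2 \<Longrightarrow> l2_inner h (\<lambda>t. f t - g t) = l2_inner h f - l2_inner h g"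
  by (simp add: l2_inner_def cinner_diff_right integrable_cinner)

lemma l2_inner_scaleC_right: "l2_inner h (\<lambda>t. a *\<^sub>C f t) = cnj a * l2_inner h f"
  by (simp add: l2_inner_def cinner_scaleC_right)

lemma l2_inner_mult_left: "l2_inner (\<lambda>t. a * f t) h = a * l2_inner f h" for f :: "real \<Rightarrow> complex"
  using l2_inner_scaleC_left[of a f h] by simp

lemma l2_inner_mult_right: "l2_inner h (\<lambda>t. a * f t) = cnj a * l2_inner h f" for f :: "real \<Rightarrow> complex"
  using l2_inner_scaleC_right[of h a f] by simp

lemma l2_inner_sum_right:
  assumes "\<And>i. i \<in> I \<Longrightarrow> f i \<in> L2" "h \<in> L2"
  shows "l2_inner h (\<lambda>t. \<Sum>i\<in>I. f i t) = (\<Sum>i\<in>I. l2_inner h (f i))"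
  using assms by (simp add: l2_inner_def cinner_sum_right Bochner_Integration.integral_sum integrable_cinner)

lemma l2_inner_cong_AE:
  assumes "AE t in half_line. f t = f' t" "AE t in half_line. g t = g' t"
    and "f \<in> L2" "f' \<in> L2" "g \<in> L2" "g' \<in> L2"
  shows "l2_inner f g = l2_inner f' g'"
proof -
  note [measurable] = assms(3-6)[THEN L2_measurable]
  show ?thesis unfolding l2_inner_def
    by (rule integral_cong_AE) (use assms(1,2) in auto)
qed

lemma l2_norm_cong_AE:
  assumes "AE t in half_line. f t = f' t" and "f \<in> L2" "f' \<in> L2"
  shows "l2_norm f = l2_norm f'"
proof -
  note [measurable] = assms(2-3)[THEN L2_measurable]
  show ?thesis unfolding l2_norm_def
    by (rule arg_cong[of _ _ sqrt], rule integral_cong_AE) (use assms(1) in auto)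
qed

lemma l2_norm_add_square:
  assumes "f \<in> L2" "g \<in> L2"
  shows "(l2_norm (\<lambda>t. f t + a *\<^sub>C g t))\<^sup>2 =
    (l2_norm f)\<^sup>2 + 2 * Re (cnj a * l2_inner f g) + (norm a)\<^sup>2 * (l2_norm g)\<^sup>2"
proof -
  define R where "R t = Re (cnj a * cinner (f t) (g t))" for t
  have i: "integrable half_line R"
    unfolding R_def by (intro integrable_Re integrable_mult_right integrable_cinner assms)
  have r: "(LINT t|half_line. R t) = Re (cnj a * l2_inner f g)"
    unfolding l2_inner_def R_def by (subst integral_Re) (auto intro!: integrable_cinner assms)
  show ?thesis
    unfolding l2_norm_square norm_add_scaleC_square R_def[symmetric] r[symmetric]
    using i assms[THEN L2_integrable] by simp
qed

lemma l2_cauchy_schwarz: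
  assumes "f \<in> L2" "g \<in> L2"
  shows "norm (l2_inner f g) \<le> l2_norm f * l2_norm g"
proof -
  have "(norm (l2_inner f g))\<^sup>2 \<le> (l2_norm f)\<^sup>2 * (l2_norm g)\<^sup>2"
  proof (rule quadratic_cauchy_schwarz)
    fix z show "0 \<le> (l2_norm f)\<^sup>2 + 2 * Re (z * l2_inner f g) + (norm z)\<^sup>2 * (l2_norm g)\<^sup>2"
      using l2_norm_add_square[OF assms, of "cnj z"] by (metis complex_cnj_cnj complex_mod_cnj zero_le_power2)
  qed simp
  then show ?thesis by (intro power2_le_imp_le[OF _ mult_nonneg_nonneg]) (simp_all add: power_mult_distrib)
qed

lemma l2_norm_triangle:
  assumes "f \<in> L2" "g \<in> L2"
  shows "l2_norm (\<lambda>t. f t + g t) \<le> l2_norm f + l2_norm g"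
proof (rule power2_le_imp_le)
  have "(l2_norm (\<lambda>t. f t + g t))\<^sup>2 = (l2_norm f)\<^sup>2 + 2 * Re (l2_inner f g) + (l2_norm g)\<^sup>2"
    using l2_norm_add_square[OF assms, of 1] by simp
  moreover have "Re (l2_inner f g) \<le> l2_norm f * l2_norm g"
    using l2_cauchy_schwarz[OF assms] complex_Re_le_cmod[of "l2_inner f g"] by linarith
  ultimately show "(l2_norm (\<lambda>t. f t + g t))\<^sup>2 \<le> (l2_norm f + l2_norm g)\<^sup>2"
    by (simp add: power2_sum)
qed simp

lemma l2_norm_scaleC: "l2_norm (\<lambda>t. a *\<^sub>C f t) = norm a * l2_norm f"
  by (simp add: l2_norm_def norm_scaleC power_mult_distrib real_sqrt_mult)

lemma l2_norm_mult: "l2_norm (\<lambda>t. a * f t) = norm a * l2_norm f" for f :: "real \<Rightarrow> complex"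
  using l2_norm_scaleC[of a f] by simp

lemma l2_norm_zero [simp]: "l2_norm (\<lambda>t. 0) = 0"
  by (simp add: l2_norm_def)

lemma l2_norm_minus_commute: "l2_norm (\<lambda>t. f t - g t) = l2_norm (\<lambda>t. g t - f t)"
  by (simp add: l2_norm_def norm_minus_commute)

lemma l2_norm_triangle_diff:
  assumes "f \<in> L2" "g \<in> L2" "h \<in> L2"
  shows "l2_norm (\<lambda>t. f t - h t) \<le> l2_norm (\<lambda>t. f t - g t) + l2_norm (\<lambda>t. g t - h t)"
  using l2_norm_triangle[OF L2_diff[OF assms(1,2)] L2_diff[OF assms(2,3)]] by simp

lemma l2_norm_sum:
  "(\<And>i. i \<in> I \<Longrightarrow> f i \<in> L2) \<Longrightarrow> l2_norm (\<lambda>t. \<Sum>i\<in>I. f i t) \<le> (\<Sum>i\<in>I. l2_norm (f i))"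
proof (induction I rule: infinite_finite_induct)
  case (insert i I)
  then show ?case
    using l2_norm_triangle[of "f i" "\<lambda>t. \<Sum>i\<in>I. f i t"] L2_sum[of I f] by fastforce
qed auto

lemma l2_norm_eq_0:
  assumes "f \<in> L2" "l2_norm f = 0"
  shows "AE t in half_line. f t = 0"
proof -
  have "(LINT t|half_line. (norm (f t))\<^sup>2) = 0"
    using assms(2) l2_norm_square[of f] by simp
  then show ?thesis
    by (subst (asm) integral_nonneg_eq_0_iff_AE) (use assms(1) in \<open>auto simp: L2_def\<close>)
qed

text \<open>The form at \<open>c\<close> is the square norm of the combination of the
  \<open>f i\<close> with coefficients \<open>c\<close>.\<close>

lemma psd_gram:
  assumes "\<And>i. i < n \<Longrightarrow> f i \<in> L2"
  shows "psd n (\<lambda>i j. l2_inner (f i) (f j))"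
  unfolding psd_def
proof (intro conjI allI impI)
  fix c :: "nat \<Rightarrow> complex"
  have *: "(\<lambda>t. c i *\<^sub>C f i t) \<in> L2" if "i < n" for i using assms that by (intro L2_scaleC)
  define S where "S t = (\<Sum>i<n. c i *\<^sub>C f i t)" for t
  have SL2: "S \<in> L2" unfolding S_def by (rule L2_sum) (use * in auto)
  have "l2_inner S S = (\<Sum>i<n. c i * l2_inner (f i) S)"
    unfolding S_def[abs_def]
    by (subst l2_inner_sum_left) (use * SL2 in \<open>auto simp: l2_inner_scaleC_left S_def[abs_def]\<close>)
  also have "\<dots> = (\<Sum>i<n. c i * (\<Sum>j<n. cnj (c j) * l2_inner (f i) (f j)))"
    unfolding S_def[abs_def]
    by (intro sum.cong refl, subst l2_inner_sum_right) (use * assms in \<open>auto simp: l2_inner_scaleC_right\<close>)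
  finally have "l2_inner S S = (\<Sum>i<n. \<Sum>j<n. c i * cnj (c j) * l2_inner (f i) (f j))"
    by (simp add: sum_distrib_left mult_ac)
  then show "0 \<le> Re (\<Sum>i<n. \<Sum>j<n. c i * cnj (c j) * l2_inner (f i) (f j))"
    by (metis l2_inner_self Re_complex_of_real zero_le_power2)
qed (rule l2_inner_commute)

subsection \<open>Exponentials on the half line\<close>

text \<open>The cut is written with \<open>if\<close> inside the integrand because
  \<open>proj_from\<close> produces it in this shape; x = 0 gives the full integral. Integrability
  comes from the real exponential of rate \<open>Re c\<close>, the value from the fundamental
  theorem of calculus on [x, \<infinity>).\<close>

lemma integral_exp_half_line:
  fixes c :: complex
  assumes c: "0 < Re c" and x: "0 \<le> x"
  shows "integrable half_line (\<lambda>t. if x \<le> t then exp (- c * of_real t) else 0)" (is ?I)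
    and "(LINT t|half_line. (if x \<le> t then exp (- c * of_real t) else 0)) = exp (- c * of_real x) / c" (is ?L)
proof -
  have c0: "c \<noteq> 0" using c by auto
  have "(\<lambda>t. exp (- Re c * t)) absolutely_integrable_on {x..}"
    using integrable_on_exp_minus_to_infinity[OF c, of x] by (intro nonnegative_absolutely_integrable_1) auto
  then have re: "set_integrable lborel {x..} (\<lambda>t. exp (- Re c * t))"
    unfolding set_integrable_def by (subst (asm) integrable_completion) auto
  have I: "set_integrable lborel {x..} (\<lambda>t. exp (- c * of_real t))"
    unfolding set_integrable_def
    by (rule Bochner_Integration.integrable_bound[OF re[unfolded set_integrable_def]])
       (auto simp: indicator_def norm_exp_eq_Re intro!: AE_I2)
  have I': "set_integrable lborel (einterval (ereal x) \<infinity>) (\<lambda>t. exp (- c * of_real t))"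
    by (rule set_integrable_subset[OF I]) (auto simp: einterval_iff)
  \<comment> \<open>For x = 0 the two integrands differ at the origin, which does not belong to the
    half line.\<close>
  have eq: "(\<lambda>t. indicator {0<..} t *\<^sub>R (if x \<le> t then exp (- c * complex_of_real t) else 0)) t =
      indicator {x..} t *\<^sub>R exp (- c * of_real t)" if "t \<noteq> 0" for t
    using that x by (auto simp: indicator_def)
  have ae: "AE t in lborel. indicator {x..} t *\<^sub>R exp (- c * complex_of_real t) =
      indicator {0<..} t *\<^sub>R (if x \<le> t then exp (- c * complex_of_real t) else 0)"
    using AE_lborel_singleton[of 0] by eventually_elim (use eq in simp)
  have [measurable]: "(\<lambda>t. indicator {0<..} t *\<^sub>R (if x \<le> t then exp (- c * complex_of_real t) else 0)) \<in> borel_measurable lborel"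
    by measurable
  have "integrable lborel (\<lambda>t. indicator {0<..} t *\<^sub>R (if x \<le> t then exp (- c * complex_of_real t) else 0))"
    using I unfolding set_integrable_def by (subst integrable_cong_AE[OF _ _ ae, symmetric]) auto
  then show ?I
    by (subst integrable_restrict_space) auto
  have "(LBINT t=ereal x..\<infinity>. exp (- c * of_real t)) = 0 - (- exp (- c * of_real x) / c)"
  proof (rule interval_integral_FTC_integrable[where F = "\<lambda>t. - exp (- c * of_real t) / c"])
    show "((\<lambda>t. - exp (- c * complex_of_real t) / c) has_vector_derivative exp (- c * of_real t)) (at t)" for t
    proof -
      have "((\<lambda>z. - exp (- c * z) / c) has_field_derivative exp (- c * of_real t)) (at (of_real t))"
        by (auto intro!: derivative_eq_intros simp: c0)
      then show ?thesis by (rule has_vector_derivative_real_field)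
    qed
    show "isCont (\<lambda>t. exp (- c * complex_of_real t)) t" for t
      by (intro continuous_intros)
    show "(((\<lambda>t. - exp (- c * complex_of_real t) / c) \<circ> real_of_ereal) \<longlongrightarrow> - exp (- c * of_real x) / c) (at_right (ereal x))"
      unfolding o_def by (intro tendsto_intros lim_real_of_ereal) (auto simp: ereal_tendsto_simps c0)
    have "((\<lambda>t. exp (- Re c * t)) \<longlongrightarrow> 0) at_top"
      by (rule filterlim_compose[OF exp_at_bot filterlim_tendsto_neg_mult_at_bot[OF tendsto_const _ filterlim_ident]])
         (use c in auto)
    then have "((\<lambda>t. - exp (- c * complex_of_real t) / c) \<longlongrightarrow> 0) at_top"
      by (rule Lim_null_comparison[OF _ tendsto_mult_left_zero[where c = "inverse (norm c)"], rotated])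
         (auto simp: norm_exp_eq_Re norm_mult norm_inverse norm_divide divide_inverse)
    then show "(((\<lambda>t. - exp (- c * complex_of_real t) / c) \<circ> real_of_ereal) \<longlongrightarrow> 0) (at_left \<infinity>)"
      by (simp add: ereal_tendsto_simps o_assoc[symmetric])
  qed (use I' in auto)
  moreover have "(LBINT t=ereal x..\<infinity>. exp (- c * of_real t)) = (LINT t|lborel. indicator {x..} t *\<^sub>R exp (- c * of_real t))"
    by (subst interval_integral_to_infinity_eq)
       (auto simp: set_lebesgue_integral_def indicator_def intro!: integral_cong_AE
         intro: eventually_mono[OF AE_lborel_singleton[of x]])
  ultimately have "(LINT t|lborel. indicator {x..} t *\<^sub>R exp (- c * of_real t)) = exp (- c * of_real x) / c"
    by simp
  then show ?L
    by (subst integral_restrict_space) (auto simp: integral_cong_AE[OF _ _ ae, symmetric])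
qed

lemma L2_exp:
  assumes "0 < Re c" shows "(\<lambda>t. exp (- c * of_real t)) \<in> L2"
proof -
  have "integrable half_line (\<lambda>t. if 0 \<le> t then exp (- of_real (2 * Re c) * complex_of_real t) else 0)"
    using assms by (intro integral_exp_half_line) auto
  then have "integrable half_line (\<lambda>t. Re (if 0 \<le> t then exp (- of_real (2 * Re c) * complex_of_real t) else 0))"
    by (rule integrable_Re)
  also have "?this \<longleftrightarrow> integrable half_line (\<lambda>t. (norm (exp (- c * complex_of_real t)))\<^sup>2)"
    by (intro Bochner_Integration.integrable_cong refl)
       (auto simp: space_restrict_space norm_exp_eq_Re exp_double[symmetric] Re_exp)
  moreover have "(\<lambda>t. exp (- c * complex_of_real t)) \<in> borel_measurable half_line"
    by (intro measurable_restrict_space1) (simp add: borel_measurable_continuous_onI continuous_intros)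
  ultimately show ?thesis by (simp add: L2_def)
qed

subsection \<open>Completeness\<close>

lemma L2_nn_integral:
  assumes "f \<in> L2"
  shows "(\<integral>\<^sup>+t. ennreal ((norm (f t))\<^sup>2) \<partial>half_line) = ennreal ((l2_norm f)\<^sup>2)"
  unfolding l2_norm_square using assms by (intro nn_integral_eq_integral L2_integrable) auto

lemma L2_I_nn_integral:
  assumes "f \<in> borel_measurable half_line" "(\<integral>\<^sup>+t. ennreal ((norm (f t))\<^sup>2) \<partial>half_line) \<le> ennreal (b\<^sup>2)" "0 \<le> b"
  shows "f \<in> L2" "l2_norm f \<le> b"
proof -
  note [measurable] = assms(1)
  have "integrable half_line (\<lambda>t. (norm (f t))\<^sup>2)"
    using le_less_trans[OF assms(2) ennreal_less_top] by (intro integrableI_bounded) auto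
  then show f: "f \<in> L2" by (simp add: L2_def)
  show "l2_norm f \<le> b"
    using assms(2,3) unfolding L2_nn_integral[OF f] by (simp add: ennreal_le_iff power2_le_iff_abs_le)
qed

text \<open>Riesz-Fischer along a rapidly convergent subsequence. Integrating the increments against
  a fixed square integrable \<open>r\<close> and using Cauchy-Schwarz gives a finite integral of
  their sum, hence absolute convergence almost everywhere, without a triangle inequality for
  infinite sums; Fatou's lemma bounds the distance to the limit.\<close>

lemma L2_complete:
  fixes s :: "nat \<Rightarrow> real \<Rightarrow> 'e::{complex_hilbert_space, second_countable_topology}"
  assumes s: "\<And>n. s n \<in> L2"
    and cauchy: "\<And>e. 0 < e \<Longrightarrow> \<exists>N. \<forall>m\<ge>N. \<forall>n\<ge>N. l2_norm (\<lambda>t. s m t - s n t) \<le> e"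
  shows "\<exists>f\<in>L2. (\<lambda>n. l2_norm (\<lambda>t. s n t - f t)) \<longlonglongrightarrow> 0"
proof -
  note [measurable] = L2_measurable[OF s]
  have "\<exists>N. \<forall>m\<ge>N. \<forall>n\<ge>N. l2_norm (\<lambda>t. s m t - s n t) \<le> (1/2)^j" for j :: nat
    by (rule cauchy) simp
  then obtain N where N: "\<And>j m n. m \<ge> N j \<Longrightarrow> n \<ge> N j \<Longrightarrow> l2_norm (\<lambda>t. s m t - s n t) \<le> (1/2)^j"
    by metis
  \<comment> \<open>Taking the maximum of all thresholds up to \<open>j\<close> makes
    \<open>k j\<close> admissible for each of them even if \<open>N\<close> is not monotone.\<close>
  define k where "k j = Max (N ` {..j}) + j" for j
  have kN: "N i \<le> k j" if "i \<le> j" for i j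
    using that unfolding k_def by (intro trans_le_add1 Max_ge) auto
  have kj: "j \<le> k j" for j by (simp add: k_def)
  define d where "d j t = s (k (Suc j)) t - s (k j) t" for j t
  have d: "d j \<in> L2" "l2_norm (d j) \<le> (1/2)^j" for j
    unfolding d_def using N[OF kN kN, of j "Suc j" j] by (auto intro!: L2_diff s)
  note [measurable] = L2_measurable[OF d(1)]
  \<comment> \<open>Any nowhere vanishing element of \<open>L2\<close> would do: the factor
    \<open>norm (r t)\<close> is cancelled pointwise after summability is known.\<close>
  define r where "r t = exp (- 1 * complex_of_real t)" for t
  have r: "r \<in> L2" unfolding r_def by (rule L2_exp) simp
  note [measurable] = L2_measurable[OF r]
  have rr: "(\<lambda>t. complex_of_real (norm (r t))) \<in> L2" "l2_norm (\<lambda>t. complex_of_real (norm (r t))) = l2_norm r"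
    using r by (auto simp: L2_def l2_norm_def)
  have dd: "(\<lambda>t. complex_of_real (norm (d j t))) \<in> L2" "l2_norm (\<lambda>t. complex_of_real (norm (d j t))) = l2_norm (d j)" for j
    using d[of j] by (auto simp: L2_def l2_norm_def)
  have b: "(LINT t|half_line. norm (d j t) * norm (r t)) \<le> (1/2)^j * l2_norm r" for j
  proof -
    have "norm (l2_inner (\<lambda>t. complex_of_real (norm (d j t))) (\<lambda>t. complex_of_real (norm (r t)))) \<le> l2_norm (d j) * l2_norm r"
      using l2_cauchy_schwarz[OF dd(1) rr(1)] by (simp add: dd(2) rr(2))
    moreover have "l2_inner (\<lambda>t. complex_of_real (norm (d j t))) (\<lambda>t. complex_of_real (norm (r t))) =
        of_real (LINT t|half_line. norm (d j t) * norm (r t))"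
      unfolding l2_inner_def by (simp flip: of_real_mult)
    moreover have "l2_norm (d j) * l2_norm r \<le> (1/2)^j * l2_norm r"
      using d(2) by (intro mult_right_mono) auto
    ultimately show ?thesis by (simp add: abs_le_iff)
  qed
  have "(\<integral>\<^sup>+t. (\<Sum>j. ennreal (norm (d j t) * norm (r t))) \<partial>half_line) =
      (\<Sum>j. \<integral>\<^sup>+t. ennreal (norm (d j t) * norm (r t)) \<partial>half_line)"
    by (rule nn_integral_suminf) measurable
  also have "\<dots> = (\<Sum>j. ennreal (LINT t|half_line. norm (d j t) * norm (r t)))"
    by (intro suminf_cong nn_integral_eq_integral integrable_norm_mult d r) auto
  also have "\<dots> \<le> (\<Sum>j. ennreal ((1/2)^j * l2_norm r))"
    by (intro suminf_le ennreal_leI b) auto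
  also have "\<dots> = ennreal (\<Sum>j. (1/2)^j * l2_norm r)"
    by (intro suminf_ennreal2 summable_mult2 summable_geometric) auto
  finally have "(\<integral>\<^sup>+t. (\<Sum>j. ennreal (norm (d j t) * norm (r t))) \<partial>half_line) \<noteq> \<infinity>"
    by (auto simp: top_unique)
  then have "AE t in half_line. (\<Sum>j. ennreal (norm (d j t) * norm (r t))) \<noteq> \<infinity>"
    by (intro nn_integral_PInf_AE) auto
  then have conv: "AE t in half_line. convergent (\<lambda>j. s (k j) t)"
  proof eventually_elim
    case (elim t)
    have "summable (\<lambda>j. norm (d j t) * norm (r t))"
      using elim by (intro summable_suminf_not_top) auto
    then have "summable (\<lambda>j. norm (d j t))"
      using summable_mult2[of "\<lambda>j. norm (d j t) * norm (r t)" "inverse (norm (r t))"]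
      by (simp add: r_def mult.assoc)
    then have "summable (\<lambda>j. d j t)" by (rule summable_norm_cancel)
    then have "convergent (\<lambda>n. \<Sum>j<n. d j t)" by (simp add: summable_iff_convergent)
    moreover have "(\<Sum>j<n. d j t) = s (k n) t - s (k 0) t" for n
      unfolding d_def by (rule sum_lessThan_telescope)
    ultimately have "convergent (\<lambda>n. s (k n) t - s (k 0) t + s (k 0) t)"
      by (intro convergent_add convergent_const) simp
    then show ?case by simp
  qed
  define f where "f t = lim (\<lambda>j. s (k j) t)" for t
  have [measurable]: "f \<in> borel_measurable half_line"
    unfolding f_def by measurable
  have lim: "AE t in half_line. (\<lambda>j. s (k j) t) \<longlonglongrightarrow> f t"
    using conv unfolding f_def by (simp add: convergent_LIMSEQ_iff)
  \<comment> \<open>Fatou along the subsequence with \<open>n\<close> kept fixed. Membership of the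
    difference in \<open>L2\<close> is part of the claim, and \<open>f \<in> L2\<close> follows from
    it.\<close>
  have bound: "(\<lambda>t. s n t - f t) \<in> L2 \<and> l2_norm (\<lambda>t. s n t - f t) \<le> (1/2)^i" if "N i \<le> n" for n i
  proof -
    have "(\<integral>\<^sup>+t. ennreal ((norm (s n t - f t))\<^sup>2) \<partial>half_line) =
        (\<integral>\<^sup>+t. liminf (\<lambda>j. ennreal ((norm (s n t - s (k j) t))\<^sup>2)) \<partial>half_line)"
      by (intro nn_integral_cong_AE, use lim in eventually_elim)
         (intro lim_imp_Liminf[symmetric] tendsto_intros, auto)
    also have "\<dots> \<le> liminf (\<lambda>j. \<integral>\<^sup>+t. ennreal ((norm (s n t - s (k j) t))\<^sup>2) \<partial>half_line)"
      by (rule nn_integral_liminf) measurable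
    also have "\<dots> \<le> ennreal (((1/2)^i)\<^sup>2)"
    proof (rule order_trans[OF Liminf_le_Limsup Limsup_bounded], simp, rule eventually_mono[OF eventually_ge_at_top[of i]])
      fix j assume "i \<le> j"
      then show "(\<integral>\<^sup>+t. ennreal ((norm (s n t - s (k j) t))\<^sup>2) \<partial>half_line) \<le> ennreal (((1/2)^i)\<^sup>2)"
        unfolding L2_nn_integral[OF L2_diff[OF s s]]
        using N[OF that kN, of j] by (intro ennreal_leI power_mono) auto
    qed
    finally show ?thesis
      by (intro conjI L2_I_nn_integral[of "\<lambda>t. s n t - f t" "(1/2)^i"]) auto
  qed
  have "f \<in> L2"
    using L2_diff[OF s[of "N 0"] conjunct1[OF bound[of 0 "N 0"]]] by simp
  moreover have "(\<lambda>n. l2_norm (\<lambda>t. s n t - f t)) \<longlonglongrightarrow> 0"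
  proof (rule LIMSEQ_I)
    fix e :: real assume "0 < e"
    then obtain i where i: "(1/2)^i < e" using real_arch_pow_inv[of e "1/2"] by auto
    have "norm (l2_norm (\<lambda>t. s n t - f t) - 0) < e" if "n \<ge> N i" for n
      using bound[OF that] i by simp
    then show "\<exists>N. \<forall>n\<ge>N. norm (l2_norm (\<lambda>t. s n t - f t) - 0) < e" by blast
  qed
  ultimately show ?thesis by blast
qed

subsection \<open>Orthonormal systems\<close>

lemma orthonormalD:
  assumes "orthonormal I e"
  shows "i \<in> I \<Longrightarrow> e i \<in> L2" "i \<in> I \<Longrightarrow> j \<in> I \<Longrightarrow> l2_inner (e i) (e j) = (if i = j then 1 else 0)"
  using assms by (auto simp: orthonormal_def)

lemma orthonormal_mono: "orthonormal I e \<Longrightarrow> J \<subseteq> I \<Longrightarrow> orthonormal J e"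
  unfolding orthonormal_def by blast

lemma orthonormal_combination:
  assumes "finite I" "orthonormal I e"
  shows "(\<lambda>t. \<Sum>i\<in>I. c i * e i t) \<in> L2"
    and "j \<in> I \<Longrightarrow> l2_inner (\<lambda>t. \<Sum>i\<in>I. c i * e i t) (e j) = c j"
    and "(l2_norm (\<lambda>t. \<Sum>i\<in>I. c i * e i t))\<^sup>2 = (\<Sum>i\<in>I. (norm (c i))\<^sup>2)"
proof -
  note e = orthonormalD[OF assms(2)]
  show L: "(\<lambda>t. \<Sum>i\<in>I. c i * e i t) \<in> L2"
    by (intro L2_sum L2_mult e)
  have ip: "l2_inner (\<lambda>t. \<Sum>i\<in>I. c i * e i t) (e j) = c j" if "j \<in> I" for j
    using that assms(1) by (simp add: l2_inner_sum_left L2_mult e l2_inner_mult_left if_distrib cong: if_cong)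
  then show "j \<in> I \<Longrightarrow> l2_inner (\<lambda>t. \<Sum>i\<in>I. c i * e i t) (e j) = c j" .
  have "l2_inner (\<lambda>t. \<Sum>i\<in>I. c i * e i t) (\<lambda>t. \<Sum>i\<in>I. c i * e i t) = (\<Sum>i\<in>I. cnj (c i) * c i)"
    by (subst l2_inner_sum_right) (auto simp: L L2_mult e l2_inner_mult_right ip)
  also have "\<dots> = of_real (\<Sum>i\<in>I. (norm (c i))\<^sup>2)"
    unfolding of_real_sum complex_norm_square by (simp add: mult.commute)
  finally show "(l2_norm (\<lambda>t. \<Sum>i\<in>I. c i * e i t))\<^sup>2 = (\<Sum>i\<in>I. (norm (c i))\<^sup>2)"
    unfolding l2_inner_self of_real_eq_iff .
qed

lemma bessel:
  assumes "finite I" "orthonormal I e" "f \<in> L2"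
  shows "(l2_norm (\<lambda>t. f t - (\<Sum>i\<in>I. l2_inner f (e i) * e i t)))\<^sup>2 =
      (l2_norm f)\<^sup>2 - (\<Sum>i\<in>I. (norm (l2_inner f (e i)))\<^sup>2)"
    and "(\<Sum>i\<in>I. (norm (l2_inner f (e i)))\<^sup>2) \<le> (l2_norm f)\<^sup>2"
proof -
  note e = orthonormalD[OF assms(2)]
  define s where "s t = (\<Sum>i\<in>I. l2_inner f (e i) * e i t)" for t
  note s = orthonormal_combination[OF assms(1,2), where c = "\<lambda>i. l2_inner f (e i)", folded s_def]
  have "l2_inner f s = (\<Sum>i\<in>I. cnj (l2_inner f (e i)) * l2_inner f (e i))"
    unfolding s_def by (subst l2_inner_sum_right) (auto simp: assms L2_mult e l2_inner_mult_right)
  also have "\<dots> = of_real (\<Sum>i\<in>I. (norm (l2_inner f (e i)))\<^sup>2)"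
    unfolding of_real_sum complex_norm_square by (simp add: mult.commute)
  finally have fs: "l2_inner f s = \<dots>" .
  have "(l2_norm (\<lambda>t. f t - s t))\<^sup>2 = (l2_norm f)\<^sup>2 - (\<Sum>i\<in>I. (norm (l2_inner f (e i)))\<^sup>2)"
    using l2_norm_add_square[OF assms(3) s(1), of "-1"] by (simp add: fs s(3))
  then show eq: "(l2_norm (\<lambda>t. f t - (\<Sum>i\<in>I. l2_inner f (e i) * e i t)))\<^sup>2 =
      (l2_norm f)\<^sup>2 - (\<Sum>i\<in>I. (norm (l2_inner f (e i)))\<^sup>2)"
    unfolding s_def .
  show "(\<Sum>i\<in>I. (norm (l2_inner f (e i)))\<^sup>2) \<le> (l2_norm f)\<^sup>2"
    using eq zero_le_power2[of "l2_norm (\<lambda>t. f t - (\<Sum>i\<in>I. l2_inner f (e i) * e i t))"] by linarith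
qed

text \<open>Bessel's inequality makes the partial sums Cauchy. Their limit \<open>g\<close> has the
  same coefficients as \<open>f\<close>, and the basis property, stated as triviality of the
  orthogonal complement, forces f = g almost everywhere.\<close>

lemma orthonormal_expansion:
  assumes e: "orthonormal_basis e" and f: "f \<in> L2"
  shows "(\<lambda>n. l2_norm (\<lambda>t. (\<Sum>i<n. l2_inner f (e i) * e i t) - f t)) \<longlonglongrightarrow> 0"
proof -
  have on: "orthonormal UNIV e" using e by (simp add: orthonormal_basis_def)
  have onI: "orthonormal I e" for I using orthonormal_mono[OF on] by auto
  note eL = orthonormalD[OF on, simplified]
  define c where "c i = l2_inner f (e i)" for i
  define s where "s n t = (\<Sum>i<n. c i * e i t)" for n t
  have sL: "s n \<in> L2" for n
    unfolding s_def[abs_def] by (intro orthonormal_combination onI) auto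
  have "summable (\<lambda>i. (norm (c i))\<^sup>2)"
    using bessel(2)[OF _ onI f] by (intro summableI_nonneg_bounded[of _ "(l2_norm f)\<^sup>2"]) (auto simp: c_def)
  then have cau: "Cauchy (\<lambda>n. \<Sum>i<n. (norm (c i))\<^sup>2)"
    by (simp add: summable_iff_convergent convergent_Cauchy)
  have sd: "(l2_norm (\<lambda>t. s m t - s n t))\<^sup>2 = (\<Sum>i<m. (norm (c i))\<^sup>2) - (\<Sum>i<n. (norm (c i))\<^sup>2)" if "n \<le> m" for m n
  proof -
    have "s m t - s n t = (\<Sum>i\<in>{n..<m}. c i * e i t)" for t
      unfolding s_def using sum.atLeastLessThan_concat[of 0 n m "\<lambda>i. c i * e i t"] that
      by (simp add: atLeast0LessThan algebra_simps)
    moreover have "(\<Sum>i<m. (norm (c i))\<^sup>2) - (\<Sum>i<n. (norm (c i))\<^sup>2) = (\<Sum>i\<in>{n..<m}. (norm (c i))\<^sup>2)"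
      using sum.atLeastLessThan_concat[of 0 n m "\<lambda>i. (norm (c i))\<^sup>2"] that
      by (simp add: atLeast0LessThan algebra_simps)
    ultimately show ?thesis
      using orthonormal_combination(3)[OF _ onI, where I = "{n..<m}" and c = c] by simp
  qed
  have "\<exists>N. \<forall>m\<ge>N. \<forall>n\<ge>N. l2_norm (\<lambda>t. s m t - s n t) \<le> \<epsilon>" if "0 < \<epsilon>" for \<epsilon>
  proof -
    have "0 < \<epsilon>\<^sup>2" using that by simp
    from CauchyD[OF cau this] obtain N where
      N: "\<forall>m\<ge>N. \<forall>n\<ge>N. norm ((\<Sum>i<m. (norm (c i))\<^sup>2) - (\<Sum>i<n. (norm (c i))\<^sup>2)) < \<epsilon>\<^sup>2" ..
    have *: "l2_norm (\<lambda>t. s m t - s n t) \<le> \<epsilon>" if "m \<ge> N" "n \<ge> N" "n \<le> m" for m n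
      by (rule power2_le_imp_le) (use sd[OF that(3)] N[rule_format, OF that(1,2)] \<open>0 < \<epsilon>\<close> in auto)
    have "l2_norm (\<lambda>t. s m t - s n t) \<le> \<epsilon>" if "m \<ge> N" "n \<ge> N" for m n
      using *[of m n] *[of n m] that l2_norm_minus_commute[of "s m" "s n"] by (cases "n \<le> m") auto
    then show ?thesis by blast
  qed
  from L2_complete[OF sL this] obtain g where g: "g \<in> L2" "(\<lambda>n. l2_norm (\<lambda>t. s n t - g t)) \<longlonglongrightarrow> 0" by blast
  have "l2_inner g (e i) = c i" for i
  proof -
    have "(\<lambda>n. l2_inner (s n) (e i) - l2_inner g (e i)) \<longlonglongrightarrow> 0"
    proof (rule Lim_null_comparison[OF always_eventually[OF allI]])
      show "norm (l2_inner (s n) (e i) - l2_inner g (e i)) \<le> l2_norm (\<lambda>t. s n t - g t) * l2_norm (e i)" for n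
        using l2_cauchy_schwarz[OF L2_diff[OF sL g(1)] eL(1)] by (simp add: l2_inner_diff_left sL g eL)
      show "(\<lambda>n. l2_norm (\<lambda>t. s n t - g t) * l2_norm (e i)) \<longlonglongrightarrow> 0"
        using tendsto_mult_right[OF g(2), of "l2_norm (e i)"] by simp
    qed
    moreover have "\<forall>\<^sub>F n in sequentially. l2_inner (s n) (e i) - l2_inner g (e i) = c i - l2_inner g (e i)"
      using eventually_gt_at_top[of i]
    proof eventually_elim
      case (elim n)
      then show ?case
        using orthonormal_combination(2)[OF _ onI, where I = "{..<n}" and j = i and c = c] by (simp add: s_def[abs_def])
    qed
    ultimately have "(\<lambda>n. c i - l2_inner g (e i)) \<longlonglongrightarrow> 0"
      by (rule Lim_transform_eventually)
    then show ?thesis by (simp add: LIMSEQ_const_iff)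
  qed
  then have "\<forall>i. l2_inner (\<lambda>t. f t - g t) (e i) = 0"
    by (simp add: l2_inner_diff_left f g eL c_def)
  then have ae: "AE t in half_line. f t - g t = 0"
    using e L2_diff[OF f g(1)] by (auto simp: orthonormal_basis_def)
  have "l2_norm (\<lambda>t. s n t - f t) = l2_norm (\<lambda>t. s n t - g t)" for n
    by (intro l2_norm_cong_AE L2_diff sL f g eventually_mono[OF ae]) auto
  then show ?thesis using g(2) by (simp add: s_def c_def)
qed

text \<open>The limit along initial segments is the form met in \<open>fin_op_det\<close>, where
  sums over n basis vectors are the entries of matrices whose size does not depend on n.\<close>

lemma parseval:
  assumes e: "orthonormal_basis e" and f: "f \<in> L2" and g: "g \<in> L2"
  shows "(\<lambda>n. \<Sum>i<n. l2_inner f (e i) * l2_inner (e i) g) \<longlonglongrightarrow> l2_inner f g"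
proof -
  have on: "orthonormal UNIV e" using e by (simp add: orthonormal_basis_def)
  note eL = orthonormalD(1)[OF on, simplified]
  have sL: "(\<lambda>t. \<Sum>i<n. l2_inner f (e i) * e i t) \<in> L2" for n
    by (intro L2_sum L2_mult eL)
  have "(\<lambda>n. (\<Sum>i<n. l2_inner f (e i) * l2_inner (e i) g) - l2_inner f g) \<longlonglongrightarrow> 0"
  proof (rule Lim_null_comparison[OF always_eventually[OF allI]])
    fix n
    have "(\<Sum>i<n. l2_inner f (e i) * l2_inner (e i) g) - l2_inner f g =
        l2_inner (\<lambda>t. (\<Sum>i<n. l2_inner f (e i) * e i t) - f t) g"
      by (simp add: l2_inner_diff_left sL f g l2_inner_sum_left L2_mult eL l2_inner_mult_left)
    then show "norm ((\<Sum>i<n. l2_inner f (e i) * l2_inner (e i) g) - l2_inner f g) \<le>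
        l2_norm (\<lambda>t. (\<Sum>i<n. l2_inner f (e i) * e i t) - f t) * l2_norm g"
      using l2_cauchy_schwarz[OF L2_diff[OF sL f] g] by simp
  next
    show "(\<lambda>n. l2_norm (\<lambda>t. (\<Sum>i<n. l2_inner f (e i) * e i t) - f t) * l2_norm g) \<longlonglongrightarrow> 0"
      using tendsto_mult_right[OF orthonormal_expansion[OF e f], of "l2_norm g"] by simp
  qed
  then show ?thesis by (rule LIM_zero_cancel)
qed

subsection \<open>Density of exponential sums\<close>

lemma l2_norm_cong: "(\<And>t. 0 < t \<Longrightarrow> f t = g t) \<Longrightarrow> l2_norm f = l2_norm g"
  unfolding l2_norm_def
  by (intro arg_cong[of _ _ sqrt] Bochner_Integration.integral_cong) (auto simp: space_restrict_space)

lemma l2_inner_cong: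
  "(\<And>t. 0 < t \<Longrightarrow> f t = f' t) \<Longrightarrow> (\<And>t. 0 < t \<Longrightarrow> g t = g' t) \<Longrightarrow> l2_inner f g = l2_inner f' g'"
  unfolding l2_inner_def
  by (intro Bochner_Integration.integral_cong) (auto simp: space_restrict_space)

lemma L2_cong: "(\<And>t. 0 < t \<Longrightarrow> f t = g t) \<Longrightarrow> f \<in> L2 \<longleftrightarrow> g \<in> L2"
  unfolding L2_def mem_Collect_eq
  by (intro conj_cong measurable_cong Bochner_Integration.integrable_cong) (auto simp: space_restrict_space)

lemma borel_measurable_half_line_continuous:
  "continuous_on UNIV f \<Longrightarrow> f \<in> borel_measurable half_line"
  by (intro measurable_restrict_space1) (simp add: borel_measurable_continuous_onI)

lemma borel_measurable_half_line_ident [measurable]: "(\<lambda>t. t) \<in> borel_measurable half_line"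
  by (intro borel_measurable_half_line_continuous continuous_intros)

lemma L2_bound:
  assumes "g \<in> L2" "f \<in> borel_measurable half_line" "\<And>t. 0 < t \<Longrightarrow> norm (f t) \<le> norm (g t)"
  shows "f \<in> L2"
proof -
  have "integrable half_line (\<lambda>t. (norm (f t))\<^sup>2)"
    using L2_integrable[OF assms(1)]
    by (rule Bochner_Integration.integrable_bound)
       (use assms(2,3) in \<open>auto simp: space_restrict_space intro!: AE_I2 power_mono\<close>)
  then show ?thesis using assms(2) by (simp add: L2_def)
qed

lemma L2_dominated_convergence:
  assumes "h \<in> L2" "\<And>n. f n \<in> borel_measurable half_line" "g \<in> borel_measurable half_line"
    and "\<And>n t. 0 < t \<Longrightarrow> norm (f n t) \<le> norm (h t)"
    and "AE t in half_line. (\<lambda>n. f n t) \<longlonglongrightarrow> g t"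
    and "\<And>t. 0 < t \<Longrightarrow> norm (g t) \<le> norm (h t)"
  shows "(\<lambda>n. l2_norm (\<lambda>t. g t - f n t)) \<longlonglongrightarrow> 0"
proof -
  note [measurable] = L2_measurable[OF assms(1)] assms(2,3)
  have "(\<lambda>n. LINT t|half_line. (norm (g t - f n t))\<^sup>2) \<longlonglongrightarrow> (LINT t|half_line. 0)"
  proof (rule integral_dominated_convergence)
    show "integrable half_line (\<lambda>t. 4 * (norm (h t))\<^sup>2)"
      by (intro integrable_mult_right L2_integrable assms)
    show "AE t in half_line. (\<lambda>n. (norm (g t - f n t))\<^sup>2) \<longlonglongrightarrow> 0"
      using assms(5)
    proof eventually_elim
      case (elim t)
      then have "(\<lambda>n. (norm (g t - f n t))\<^sup>2) \<longlonglongrightarrow> (norm (g t - g t))\<^sup>2"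
        by (intro tendsto_intros)
      then show ?case by simp
    qed
    fix n
    have "(norm (g t - f n t))\<^sup>2 \<le> 4 * (norm (h t))\<^sup>2" if "0 < t" for t
    proof -
      have "norm (g t - f n t) \<le> 2 * norm (h t)"
        using norm_triangle_ineq4[of "g t" "f n t"] assms(4)[OF that, of n] assms(6)[OF that] by linarith
      then have "(norm (g t - f n t))\<^sup>2 \<le> (2 * norm (h t))\<^sup>2" by (intro power_mono) auto
      then show ?thesis by (simp add: power_mult_distrib)
    qed
    then show "AE t in half_line. norm ((norm (g t - f n t))\<^sup>2) \<le> 4 * (norm (h t))\<^sup>2"
      by (intro AE_I2) (auto simp: space_restrict_space)
  qed measurable
  then show ?thesis
    unfolding l2_norm_def using tendsto_real_sqrt[of _ 0 sequentially] by simp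
qed

text \<open>In the variable exp (- t) these are polynomials with vector coefficients and no constant
  term; starting at j = 1 makes each term decay.\<close>

definition esum :: "nat \<Rightarrow> (nat \<Rightarrow> 'e::real_vector) \<Rightarrow> real \<Rightarrow> 'e"
  where "esum N y t = (\<Sum>j = 1..N. exp (- real j * t) *\<^sub>R y j)"

text \<open>The weight \<open>v\<close> covers two uses: v = 1 gives completeness of the
  exponentials in \<open>L2\<close>, v = sqrt gives density among the symbols.\<close>

definition exp_approx :: "(real \<Rightarrow> real) \<Rightarrow> (real \<Rightarrow> 'e::{complex_hilbert_space, second_countable_topology}) \<Rightarrow> bool"
  where "exp_approx v f \<longleftrightarrow> f \<in> L2 \<and> (\<forall>\<epsilon>>0. \<exists>N y. l2_norm (\<lambda>t. f t - v t *\<^sub>R esum N y t) \<le> \<epsilon>)"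

lemma esum_extend:
  assumes "N \<le> M" shows "esum N y t = esum M (\<lambda>j. if j \<le> N then y j else 0) t"
  unfolding esum_def by (rule sum.mono_neutral_cong_left) (use assms in auto)

lemma esum_add: "esum N (\<lambda>j. y j + z j) t = esum N y t + esum N z t"
  by (simp add: esum_def scaleR_add_right sum.distrib)

context
  fixes v :: "real \<Rightarrow> real"
  assumes v_pos: "\<And>t. 0 < t \<Longrightarrow> 0 < v t"
    and v_meas [measurable]: "v \<in> borel_measurable half_line"
    and v_L2: "(\<lambda>t. complex_of_real (v t * exp (- t))) \<in> L2"
begin

text \<open>Turns a uniform bound on \<open>g t * exp t\<close> into an L2 bound linear in it; this
  is how the sup norm of the Weierstrass theorem controls the weighted L2 norm.\<close>

lemma weighted_exp_L2:
  fixes y :: "'e::{complex_hilbert_space, second_countable_topology}"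
  assumes [measurable]: "g \<in> borel_measurable half_line" and "\<And>t. 0 < t \<Longrightarrow> \<bar>g t\<bar> \<le> c * exp (- t)" "0 \<le> c"
  shows "(\<lambda>t. (v t * g t) *\<^sub>R y) \<in> L2"
    and "l2_norm (\<lambda>t. (v t * g t) *\<^sub>R y) \<le> c * norm y * l2_norm (\<lambda>t. complex_of_real (v t * exp (- t)))"
proof -
  have "(\<integral>\<^sup>+t. ennreal ((norm ((v t * g t) *\<^sub>R y))\<^sup>2) \<partial>half_line) \<le>
      (\<integral>\<^sup>+t. ennreal ((c * norm y)\<^sup>2) * ennreal ((norm (complex_of_real (v t * exp (- t))))\<^sup>2) \<partial>half_line)"
  proof (intro nn_integral_mono)
    fix t assume "t \<in> space half_line"
    then have t: "0 < t" by (simp add: space_restrict_space)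
    have "(norm ((v t * g t) *\<^sub>R y))\<^sup>2 = (\<bar>g t\<bar> * norm y * v t)\<^sup>2"
      using v_pos[OF t] by (simp add: power_mult_distrib)
    also have "\<dots> \<le> (c * exp (- t) * norm y * v t)\<^sup>2"
      using v_pos[OF t] assms(2)[OF t] by (intro power_mono mult_right_mono) auto
    also have "\<dots> = (c * norm y)\<^sup>2 * (norm (complex_of_real (v t * exp (- t))))\<^sup>2"
      using v_pos[OF t] by (simp add: power_mult_distrib norm_mult mult_ac del: of_real_mult)
    finally show "ennreal ((norm ((v t * g t) *\<^sub>R y))\<^sup>2) \<le>
        ennreal ((c * norm y)\<^sup>2) * ennreal ((norm (complex_of_real (v t * exp (- t))))\<^sup>2)"
      by (simp add: ennreal_mult'[symmetric] ennreal_leI del: of_real_mult norm_of_real)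
  qed
  also have "\<dots> = ennreal ((c * norm y)\<^sup>2) * ennreal ((l2_norm (\<lambda>t. complex_of_real (v t * exp (- t))))\<^sup>2)"
    using L2_measurable[OF v_L2]
    by (subst nn_integral_cmult) (simp_all add: L2_nn_integral[OF v_L2] del: of_real_mult norm_of_real)
  also have "\<dots> = ennreal ((c * norm y * l2_norm (\<lambda>t. complex_of_real (v t * exp (- t))))\<^sup>2)"
    by (simp add: ennreal_mult'[symmetric] power_mult_distrib)
  finally show "(\<lambda>t. (v t * g t) *\<^sub>R y) \<in> L2"
    "l2_norm (\<lambda>t. (v t * g t) *\<^sub>R y) \<le> c * norm y * l2_norm (\<lambda>t. complex_of_real (v t * exp (- t)))"
    using assms(3) by (auto intro!: L2_I_nn_integral)
qed

lemma esum_L2: "(\<lambda>t. v t *\<^sub>R esum N y t) \<in> L2"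
  for y :: "nat \<Rightarrow> 'e::{complex_hilbert_space, second_countable_topology}"
proof -
  have "(\<lambda>t. (v t * exp (- real j * t)) *\<^sub>R y j) \<in> L2" if "1 \<le> j" for j
    by (rule weighted_exp_L2[where c = 1])
       (use that in \<open>auto intro!: borel_measurable_half_line_continuous continuous_intros\<close>)
  then have "(\<lambda>t. \<Sum>j = 1..N. (v t * exp (- real j * t)) *\<^sub>R y j) \<in> L2"
    by (intro L2_sum) auto
  then show ?thesis by (simp add: esum_def scaleR_sum_right)
qed

lemma exp_approx_limit:
  assumes "f \<in> L2" "\<And>\<epsilon>. 0 < \<epsilon> \<Longrightarrow> \<exists>g. exp_approx v g \<and> l2_norm (\<lambda>t. f t - g t) \<le> \<epsilon>"
  shows "exp_approx v f"
  unfolding exp_approx_def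
proof (intro conjI allI impI)
  fix \<epsilon> :: real assume "0 < \<epsilon>"
  then obtain g where g: "exp_approx v g" "l2_norm (\<lambda>t. f t - g t) \<le> \<epsilon> / 2"
    using assms(2)[of "\<epsilon> / 2"] by auto
  then obtain N y where y: "l2_norm (\<lambda>t. g t - v t *\<^sub>R esum N y t) \<le> \<epsilon> / 2"
    using \<open>0 < \<epsilon>\<close> unfolding exp_approx_def by (meson half_gt_zero)
  have "l2_norm (\<lambda>t. f t - v t *\<^sub>R esum N y t) \<le> \<epsilon>"
    using l2_norm_triangle_diff[of f g "\<lambda>t. v t *\<^sub>R esum N y t"] y g assms(1) esum_L2[of N y]
    by (auto simp: exp_approx_def)
  then show "\<exists>N y. l2_norm (\<lambda>t. f t - v t *\<^sub>R esum N y t) \<le> \<epsilon>" by blast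
qed (rule assms)

lemma exp_approx_seq:
  assumes "f \<in> L2" "\<And>n. exp_approx v (g n)" "(\<lambda>n. l2_norm (\<lambda>t. f t - g n t)) \<longlonglongrightarrow> 0"
  shows "exp_approx v f"
proof (rule exp_approx_limit[OF assms(1)])
  fix \<epsilon> :: real assume "0 < \<epsilon>"
  then have "\<forall>\<^sub>F n in sequentially. l2_norm (\<lambda>t. f t - g n t) < \<epsilon>"
    using assms(3) by (simp add: order_tendstoD)
  then obtain n where "l2_norm (\<lambda>t. f t - g n t) < \<epsilon>"
    by (auto simp: eventually_sequentially)
  then show "\<exists>g. exp_approx v g \<and> l2_norm (\<lambda>t. f t - g t) \<le> \<epsilon>"
    using assms(2) by (intro exI[of _ "g n"]) auto
qed

lemma exp_approx_add:
  fixes f :: "real \<Rightarrow> 'e::{complex_hilbert_space, second_countable_topology}"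
  assumes "exp_approx v f" "exp_approx v g"
  shows "exp_approx v (\<lambda>t. f t + g t)"
  unfolding exp_approx_def
proof (intro conjI allI impI)
  have L: "f \<in> L2" "g \<in> L2" using assms by (auto simp: exp_approx_def)
  then show "(\<lambda>t. f t + g t) \<in> L2" by (rule L2_add)
  fix \<epsilon> :: real assume e: "0 < \<epsilon>"
  obtain N y where y: "l2_norm (\<lambda>t. f t - v t *\<^sub>R esum N y t) \<le> \<epsilon> / 2"
    using assms(1) e unfolding exp_approx_def by (meson half_gt_zero)
  obtain M z where z: "l2_norm (\<lambda>t. g t - v t *\<^sub>R esum M z t) \<le> \<epsilon> / 2"
    using assms(2) e unfolding exp_approx_def by (meson half_gt_zero)
  define P where "P = max N M"
  define x where "x j = (if j \<le> N then y j else 0) + (if j \<le> M then z j else 0)" for j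
  have eq: "f t + g t - v t *\<^sub>R esum P x t = (f t - v t *\<^sub>R esum N y t) + (g t - v t *\<^sub>R esum M z t)" for t
    using esum_extend[of N P y t] esum_extend[of M P z t]
    by (simp add: P_def x_def[abs_def] esum_add algebra_simps)
  have "l2_norm (\<lambda>t. f t + g t - v t *\<^sub>R esum P x t) \<le> \<epsilon>"
    unfolding eq using l2_norm_triangle[OF L2_diff[OF L(1) esum_L2[of N y]] L2_diff[OF L(2) esum_L2[of M z]]] y z by linarith
  then show "\<exists>N y. l2_norm (\<lambda>t. f t + g t - v t *\<^sub>R esum N y t) \<le> \<epsilon>" by blast
qed

lemma exp_approx_zero: "exp_approx v (\<lambda>t. 0)"
  unfolding exp_approx_def by (auto intro!: exI[of _ 0] simp: esum_def)

lemma exp_approx_sum: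
  "(\<And>i. i \<in> I \<Longrightarrow> exp_approx v (f i)) \<Longrightarrow> exp_approx v (\<lambda>t. \<Sum>i\<in>I. f i t)"
  by (induction I rule: infinite_finite_induct) (auto intro: exp_approx_add exp_approx_zero)

text \<open>With x = exp (- t) the function \<open>g\<close> becomes x G(x), where G vanishes near 0
  because \<open>g\<close> vanishes for large t. A polynomial close to G on [0, 1], multiplied by x,
  has no constant term and is an \<open>esum\<close>.\<close>

lemma exp_approx_continuous:
  fixes y :: "'e::{complex_hilbert_space, second_countable_topology}"
  assumes g: "continuous_on UNIV g" and g0: "\<And>t. t > m \<Longrightarrow> g t = 0"
  shows "exp_approx v (\<lambda>t. (v t * g t) *\<^sub>R y)"
  unfolding exp_approx_def
proof (intro conjI allI impI)
  have [measurable]: "g \<in> borel_measurable half_line"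
    by (rule borel_measurable_half_line_continuous[OF g])
  define C where "C = l2_norm (\<lambda>t. complex_of_real (v t * exp (- t)))"
  \<comment> \<open>For x \<le> \<sigma> the argument of \<open>g\<close> is
    \<open>\<bar>m\<bar> + 1\<close>, which exceeds \<open>m\<close>, so G is 0 there; the maximum
    with \<sigma> keeps logarithm and quotient continuous down to x = 0.\<close>
  define \<sigma> where "\<sigma> = exp (- (\<bar>m\<bar> + 1))"
  define G where "G x = g (- ln (max x \<sigma>)) / max x \<sigma>" for x
  have mx: "0 < max x \<sigma>" for x by (simp add: \<sigma>_def less_max_iff_disj)
  have cG: "continuous_on {0..1} G"
    unfolding G_def using mx
    by (intro continuous_on_divide continuous_on_compose2[OF g] continuous_intros) (auto simp: less_imp_neq[symmetric])
  have Gexp: "g t = exp (- t) * G (exp (- t))" for t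
  proof (cases "t \<le> \<bar>m\<bar> + 1")
    case True
    then have "max (exp (- t)) \<sigma> = exp (- t)" by (simp add: \<sigma>_def max_def)
    then show ?thesis by (simp add: G_def)
  next
    case False
    then have "max (exp (- t)) \<sigma> = \<sigma>" by (simp add: \<sigma>_def max_def)
    then show ?thesis using False by (simp add: G_def \<sigma>_def g0)
  qed
  have "bounded (G ` {0..1})"
    by (intro compact_imp_bounded compact_continuous_image cG) auto
  then obtain B where B: "\<And>x. x \<in> {0..1} \<Longrightarrow> \<bar>G x\<bar> \<le> B" "0 < B"
    unfolding bounded_pos by (metis imageI real_norm_def)
  show "(\<lambda>t. (v t * g t) *\<^sub>R y) \<in> L2"
  proof (rule weighted_exp_L2[where c = B])
    show "\<bar>g t\<bar> \<le> B * exp (- t)" if "0 < t" for t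
      unfolding Gexp[of t] abs_mult using B(1)[of "exp (- t)"] that by simp
  qed (use B in auto)
  fix \<epsilon> :: real assume "0 < \<epsilon>"
  \<comment> \<open>The summand 1 prevents division by zero, for instance when y = 0.\<close>
  define \<delta> where "\<delta> = \<epsilon> / (norm y * C + 1)"
  have C: "0 \<le> norm y * C" by (simp add: C_def)
  then have \<delta>: "0 < \<delta>" "\<delta> * norm y * C \<le> \<epsilon>"
    using \<open>0 < \<epsilon>\<close> by (auto simp: \<delta>_def field_simps add_nonneg_pos)
  obtain p where p: "real_polynomial_function p" "\<And>x. x \<in> {0..1} \<Longrightarrow> \<bar>G x - p x\<bar> < \<delta>"
    using Stone_Weierstrass_real_polynomial_function[OF _ cG \<delta>(1)] by auto
  then obtain a n where pa: "p = (\<lambda>x. \<Sum>i\<le>n. a i * x ^ i)"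
    unfolding real_polynomial_function_iff_sum by blast
  \<comment> \<open>The shift of the index absorbs the extra factor exp (- t).\<close>
  define z where "z j = a (j - 1) *\<^sub>R y" for j
  have es: "esum (Suc n) z t = (exp (- t) * p (exp (- t))) *\<^sub>R y" for t
  proof -
    have "esum (Suc n) z t = (\<Sum>i\<le>n. exp (- real (Suc i) * t) *\<^sub>R z (Suc i))"
      unfolding esum_def One_nat_def sum.atLeast1_atMost_eq lessThan_Suc_atMost ..
    also have "\<dots> = (\<Sum>i\<le>n. (exp (- t) * (a i * exp (- t) ^ i)) *\<^sub>R y)"
      by (intro sum.cong refl)
         (auto simp: z_def exp_of_nat_mult[symmetric] mult_exp_exp algebra_simps simp flip: exp_add)
    also have "\<dots> = (exp (- t) * p (exp (- t))) *\<^sub>R y"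
      unfolding pa by (simp add: sum_distrib_left scaleR_sum_left)
    finally show ?thesis .
  qed
  have "l2_norm (\<lambda>t. (v t * (g t - exp (- t) * p (exp (- t)))) *\<^sub>R y) \<le> \<delta> * norm y * C"
    unfolding C_def
  proof (rule weighted_exp_L2)
    show "(\<lambda>t. g t - exp (- t) * p (exp (- t))) \<in> borel_measurable half_line"
      unfolding pa by (intro borel_measurable_half_line_continuous continuous_intros g)
    show "\<bar>g t - exp (- t) * p (exp (- t))\<bar> \<le> \<delta> * exp (- t)" if "0 < t" for t
    proof -
      have "g t - exp (- t) * p (exp (- t)) = exp (- t) * (G (exp (- t)) - p (exp (- t)))"
        by (simp add: Gexp[of t] algebra_simps)
      then show ?thesis using p(2)[of "exp (- t)"] that by (simp add: abs_mult)
    qed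
  qed (use \<delta> in simp)
  also have "(\<lambda>t. (v t * (g t - exp (- t) * p (exp (- t)))) *\<^sub>R y) =
      (\<lambda>t. (v t * g t) *\<^sub>R y - v t *\<^sub>R esum (Suc n) z t)"
    by (simp add: es algebra_simps)
  finally show "\<exists>N z. l2_norm (\<lambda>t. (v t * g t) *\<^sub>R y - v t *\<^sub>R esum N z t) \<le> \<epsilon>"
    using \<delta>(2) order_trans by blast
qed

text \<open>Lebesgue measurability supplies continuous functions that converge to the indicator
  almost everywhere, but without control of size or support. Clamping to [0, 1] and a ramp ending at
  m + 1 supply both and leave the limit unchanged.\<close>

lemma exp_approx_indicator:
  fixes y :: "'e::{complex_hilbert_space, second_countable_topology}"
  assumes A: "A \<in> sets borel" "A \<subseteq> {..m}"
  shows "exp_approx v (\<lambda>t. (v t * indicator A t) *\<^sub>R y)"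
proof -
  have "indicat_real A \<in> borel_measurable lebesgue"
    using A by (intro borel_measurable_indicator) (simp add: sets_completionI_sets)
  then have "indicat_real A measurable_on UNIV"
    by (simp add: lebesgue_measurable_imp_measurable_on_real)
  then obtain N g where N: "negligible N" and g: "\<And>n. continuous_on UNIV (g n)"
    and lim: "\<And>x. x \<notin> N \<Longrightarrow> (\<lambda>n. g n x) \<longlonglongrightarrow> indicat_real A x"
    unfolding measurable_on_def by auto
  have "AE t in lebesgue. t \<notin> N"
    using N by (intro AE_not_in) (simp add: negligible_iff_null_sets)
  then have N': "AE t in half_line. t \<notin> N"
    by (simp add: AE_completion_iff AE_restrict_space_iff) (auto elim: eventually_mono)
  define h where "h n t = min 1 (max 0 (m + 1 - t)) * min 1 (max 0 (g n t))" for n t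
  have h: "continuous_on UNIV (h n)" for n
    unfolding h_def by (intro continuous_intros g)
  have hb: "\<bar>h n t\<bar> \<le> exp (m + 1) * exp (- t)" "h n t = 0" if "m + 1 < t" for n t
    using that by (auto simp: h_def)
  \<comment> \<open>The dominating function is at least 1 exactly for t \<le> m + 1, and beyond that
    point \<open>h n\<close> vanishes.\<close>
  have hb': "\<bar>h n t\<bar> \<le> exp (m + 1) * exp (- t)" for n t
  proof (cases "t \<le> m + 1")
    case True
    have "\<bar>h n t\<bar> \<le> 1 * 1" unfolding h_def abs_mult by (intro mult_mono) auto
    also have "\<dots> \<le> exp (m + 1) * exp (- t)" using True by (simp flip: exp_add)
    finally show ?thesis .
  qed (use hb in auto)
  have ib: "\<bar>indicat_real A t\<bar> \<le> exp (m + 1) * exp (- t)" for t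
    using A(2) by (auto simp: indicator_def simp flip: exp_add)
  have D: "(\<lambda>t. (v t * (exp (m + 1) * exp (- t))) *\<^sub>R y) \<in> L2"
    by (rule weighted_exp_L2[where c = "exp (m + 1)"])
       (auto intro!: borel_measurable_half_line_continuous continuous_intros)
  have Am [measurable]: "indicat_real A \<in> borel_measurable half_line"
    using A by (intro measurable_restrict_space1 borel_measurable_indicator) simp
  have hm [measurable]: "h n \<in> borel_measurable half_line" for n
    by (rule borel_measurable_half_line_continuous[OF h])
  show ?thesis
  proof (rule exp_approx_seq)
    show "(\<lambda>t. (v t * indicat_real A t) *\<^sub>R y) \<in> L2"
      by (rule weighted_exp_L2[where c = "exp (m + 1)"]) (use ib in auto)
    show "exp_approx v (\<lambda>t. (v t * h n t) *\<^sub>R y)" for n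
      by (rule exp_approx_continuous[OF h hb(2)])
    show "(\<lambda>n. l2_norm (\<lambda>t. (v t * indicat_real A t) *\<^sub>R y - (v t * h n t) *\<^sub>R y)) \<longlonglongrightarrow> 0"
    proof (rule L2_dominated_convergence[OF D])
      show "AE t in half_line. (\<lambda>n. (v t * h n t) *\<^sub>R y) \<longlonglongrightarrow> (v t * indicat_real A t) *\<^sub>R y"
        using N'
      proof eventually_elim
        case (elim t)
        have "(\<lambda>n. h n t) \<longlonglongrightarrow> min 1 (max 0 (m + 1 - t)) * min 1 (max 0 (indicat_real A t))"
          unfolding h_def by (intro tendsto_intros lim elim)
        also have "min 1 (max 0 (m + 1 - t)) * min 1 (max 0 (indicat_real A t)) = indicat_real A t"
          using A(2) by (auto simp: indicator_def)
        finally show ?case by (intro tendsto_intros)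
      qed
      show "norm ((v t * h n t) *\<^sub>R y) \<le> norm ((v t * (exp (m + 1) * exp (- t))) *\<^sub>R y)" if "0 < t" for n t
        using hb'[of n t] v_pos[OF that] by (simp add: abs_mult mult_right_mono mult_left_mono)
      show "norm ((v t * indicat_real A t) *\<^sub>R y) \<le> norm ((v t * (exp (m + 1) * exp (- t))) *\<^sub>R y)" if "0 < t" for t
        using ib[of t] v_pos[OF that] by (simp only: norm_scaleR abs_mult) (intro mult_right_mono mult_left_mono, auto)
    qed measurable
  qed
qed

text \<open>The simple functions approximate f / v and not f, so that multiplication by
  \<open>v\<close> gives sums of the weighted indicators already treated.\<close>

lemma exp_approx_bounded_support:
  fixes f :: "real \<Rightarrow> 'e::{complex_hilbert_space, second_countable_topology}"
  assumes f: "f \<in> L2" and f0: "\<And>t. t > m \<Longrightarrow> f t = 0"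
  shows "exp_approx v f"
proof -
  note [measurable] = L2_measurable[OF f]
  define \<phi> where "\<phi> t = (1 / v t) *\<^sub>R f t" for t
  have [measurable]: "\<phi> \<in> borel_measurable half_line" unfolding \<phi>_def by measurable
  have f\<phi>: "f t = v t *\<^sub>R \<phi> t" if "0 < t" for t
    using v_pos[OF that] by (simp add: \<phi>_def)
  from borel_measurable_implies_sequence_metric[OF \<open>\<phi> \<in> _\<close>, of 0]
  obtain s where s': "\<forall>i. simple_function half_line (s i)" "\<forall>t\<in>space half_line. (\<lambda>i. s i t) \<longlonglongrightarrow> \<phi> t"
    "\<forall>i. \<forall>t\<in>space half_line. dist (s i t) 0 \<le> 2 * dist (\<phi> t) 0" by blast
  have s: "simple_function half_line (s i)" "0 < t \<Longrightarrow> (\<lambda>i. s i t) \<longlonglongrightarrow> \<phi> t"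
    "0 < t \<Longrightarrow> norm (s i t) \<le> 2 * norm (\<phi> t)" for i t
    using s' by (auto simp: space_restrict_space)
  have [measurable]: "s i \<in> borel_measurable half_line" for i
    by (rule borel_measurable_simple_function[OF s(1)])
  have ap: "exp_approx v (\<lambda>t. v t *\<^sub>R s i t)" for i
  proof -
    define A where "A z = s i -` {z} \<inter> {0<..}" for z
    have "exp_approx v (\<lambda>t. (v t * indicator (A z) t) *\<^sub>R z)" if "z \<in> s i ` {0<..}" for z
    proof (cases "z = 0")
      case True then show ?thesis using exp_approx_zero by simp
    next
      case False
      have "A z \<in> sets half_line"
        using simple_functionD(2)[OF s(1), of i "{z}"] by (simp add: A_def space_restrict_space)
      then have "A z \<in> sets borel" by (simp add: sets_restrict_space_iff)
      \<comment> \<open>The norms of the approximants are at most twice that of \<phi>, so they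
        vanish wherever f does; a level set of a nonzero value therefore stays below
        \<open>m\<close>.\<close>
      moreover have "A z \<subseteq> {..m}"
      proof
        fix t assume t: "t \<in> A z"
        then have "norm z \<le> 2 * norm (\<phi> t)" using s(3)[of t i] by (auto simp: A_def)
        then show "t \<in> {..m}" using False f0[of t] by (cases "t \<le> m") (auto simp: \<phi>_def)
      qed
      ultimately show ?thesis by (rule exp_approx_indicator)
    qed
    then have *: "exp_approx v (\<lambda>t. \<Sum>z\<in>s i ` {0<..}. (v t * indicator (A z) t) *\<^sub>R z)"
      by (rule exp_approx_sum)
    have eq: "v t *\<^sub>R s i t = (\<Sum>z\<in>s i ` {0<..}. (v t * indicator (A z) t) *\<^sub>R z)" if "0 < t" for t
    proof -
      have sp: "space half_line = {0<..}" by (simp add: space_restrict_space)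
      have "s i t = (\<Sum>z\<in>s i ` {0<..}. indicator (A z) t *\<^sub>R z)"
        using simple_function_indicator_representation_banach[OF s(1), of t i] that
        unfolding sp A_def by blast
      then have "v t *\<^sub>R s i t = v t *\<^sub>R (\<Sum>z\<in>s i ` {0<..}. indicator (A z) t *\<^sub>R z)"
        by (rule arg_cong)
      then show ?thesis by (simp only: scaleR_sum_right scaleR_scaleR)
    qed
    have "l2_norm (\<lambda>t. v t *\<^sub>R s i t - v t *\<^sub>R esum N y t) =
        l2_norm (\<lambda>t. (\<Sum>z\<in>s i ` {0<..}. (v t * indicator (A z) t) *\<^sub>R z) - v t *\<^sub>R esum N y t)" for N y
      by (rule l2_norm_cong) (simp add: eq)
    moreover have "(\<lambda>t. v t *\<^sub>R s i t) \<in> L2"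
      using * by (subst L2_cong[OF eq]) (auto simp: exp_approx_def)
    ultimately show ?thesis using * by (simp add: exp_approx_def)
  qed
  show ?thesis
  proof (rule exp_approx_seq[OF f ap])
    show "(\<lambda>n. l2_norm (\<lambda>t. f t - v t *\<^sub>R s n t)) \<longlonglongrightarrow> 0"
    proof (rule L2_dominated_convergence[OF L2_scaleC[OF f, of 2]])
      show "AE t in half_line. (\<lambda>n. v t *\<^sub>R s n t) \<longlonglongrightarrow> f t"
        using s(2) by (intro AE_I2) (auto simp: space_restrict_space f\<phi> intro!: tendsto_intros)
      show "norm (v t *\<^sub>R s n t) \<le> norm (2 *\<^sub>C f t)" if "0 < t" for n t
        using s(3)[OF that, of n] v_pos[OF that] by (simp add: f\<phi>[OF that] norm_scaleC mult_left_mono)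
      show "norm (f t) \<le> norm (2 *\<^sub>C f t)" for t by (simp add: norm_scaleC)
    qed measurable
  qed
qed

lemma exp_approx_L2:
  fixes f :: "real \<Rightarrow> 'e::{complex_hilbert_space, second_countable_topology}"
  assumes f: "f \<in> L2"
  shows "exp_approx v f"
proof (rule exp_approx_seq[OF f])
  note [measurable] = L2_measurable[OF f]
  define g where "g n t = (if t \<le> real n then f t else 0)" for n t
  have [measurable]: "g n \<in> borel_measurable half_line" for n unfolding g_def by measurable
  have "g n \<in> L2" for n
    by (rule L2_bound[OF f]) (auto simp: g_def)
  then show "exp_approx v (g n)" for n
    by (rule exp_approx_bounded_support[where m = "real n"]) (auto simp: g_def)
  show "(\<lambda>n. l2_norm (\<lambda>t. f t - g n t)) \<longlonglongrightarrow> 0"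
  proof (rule L2_dominated_convergence[OF f])
    have "(\<lambda>n. g n t) \<longlonglongrightarrow> f t" for t
    proof (rule tendsto_eventually)
      show "\<forall>\<^sub>F n in sequentially. g n t = f t"
        using eventually_ge_at_top[of "nat \<lceil>t\<rceil>"] by eventually_elim (auto simp: g_def nat_ceiling_le_eq)
    qed
    then show "AE t in half_line. (\<lambda>n. g n t) \<longlonglongrightarrow> f t" by simp
  qed (auto simp: g_def)
qed

end

subsection \<open>Existence of an orthonormal basis\<close>

function gram_schmidt :: "(nat \<Rightarrow> real \<Rightarrow> complex) \<Rightarrow> nat \<Rightarrow> real \<Rightarrow> complex"
  where "gram_schmidt b n =
    (let r = (\<lambda>t. b n t - (\<Sum>i<n. l2_inner (b n) (gram_schmidt b i) * gram_schmidt b i t))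
     in (\<lambda>t. of_real (1 / l2_norm r) * r t))"
  by auto
termination
  by (relation "Wellfounded.measure snd") auto

declare gram_schmidt.simps [simp del]

lemma gram_schmidt_orthonormal:
  assumes b: "\<And>n. b n \<in> L2"
    and indep: "\<And>n c. l2_norm (\<lambda>t. b n t - (\<Sum>i<n. c i * b i t)) \<noteq> 0"
  shows "orthonormal UNIV (gram_schmidt b)"
    and "\<exists>c. \<forall>t. b n t = (\<Sum>i\<le>n. c i * gram_schmidt b i t)"
proof -
  define q where "q = gram_schmidt b"
  define r where "r n t = b n t - (\<Sum>i<n. l2_inner (b n) (q i) * q i t)" for n t
  have q: "q n = (\<lambda>t. of_real (1 / l2_norm (r n)) * r n t)" for n
    unfolding q_def r_def by (subst gram_schmidt.simps) (simp add: Let_def)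
  \<comment> \<open>The induction carries along that each \<open>q i\<close> is a combination of the
    \<open>b j\<close>, because \<open>indep\<close> speaks of the \<open>b j\<close> only; this
    shows that the next remainder has nonzero norm and can be normalised.\<close>
  have main: "(\<forall>i<n. q i \<in> L2 \<and> l2_norm (r i) \<noteq> 0 \<and> (\<exists>c. \<forall>t. q i t = (\<Sum>j\<le>i. c j * b j t))) \<and>
     (\<forall>i<n. \<forall>j<n. l2_inner (q i) (q j) = (if i = j then 1 else 0))" for n
  proof (induction n)
    case (Suc n)
    have on: "orthonormal {..<n} q"
      using Suc by (auto simp: orthonormal_def)
    have "\<exists>c. \<forall>t. q i t = (\<Sum>j<n. c j * b j t)" if "i < n" for i
    proof -
      from Suc that obtain c where c: "\<And>t. q i t = (\<Sum>j\<le>i. c j * b j t)" by blast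
      have "q i t = (\<Sum>j<n. (if j \<le> i then c j else 0) * b j t)" for t
        unfolding c using that by (intro sum.mono_neutral_cong_left) auto
      then show ?thesis by (intro exI[of _ "\<lambda>j. if j \<le> i then c j else 0"] allI)
    qed
    then obtain c where c: "\<And>i t. i < n \<Longrightarrow> q i t = (\<Sum>j<n. c i j * b j t)"
      by metis
    define d where "d j = (\<Sum>i<n. l2_inner (b n) (q i) * c i j)" for j
    have "(\<Sum>i<n. l2_inner (b n) (q i) * q i t) = (\<Sum>j<n. d j * b j t)" for t
    proof -
      have "(\<Sum>i<n. l2_inner (b n) (q i) * q i t) = (\<Sum>i<n. \<Sum>j<n. l2_inner (b n) (q i) * c i j * b j t)"
        by (intro sum.cong refl) (simp add: c sum_distrib_left mult_ac)
      also have "\<dots> = (\<Sum>j<n. d j * b j t)"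
        unfolding d_def sum_distrib_right by (rule sum.swap)
      finally show ?thesis .
    qed
    then have rd: "r n = (\<lambda>t. b n t - (\<Sum>j<n. d j * b j t))"
      unfolding r_def by simp
    then have rn: "l2_norm (r n) \<noteq> 0" using indep by simp
    have rL: "r n \<in> L2"
      unfolding rd by (intro L2_diff L2_sum L2_mult b)
    have qL: "q n \<in> L2" unfolding q by (intro L2_mult rL)
    have "l2_inner (q n) (q n) = of_real (1 / l2_norm (r n)) * (cnj (of_real (1 / l2_norm (r n))) * l2_inner (r n) (r n))"
      unfolding q l2_inner_mult_left l2_inner_mult_right ..
    then have qq: "l2_inner (q n) (q n) = 1"
      unfolding l2_inner_self using rn by (simp add: power2_eq_square)
    have rq: "l2_inner (r n) (q j) = 0" if "j < n" for j
      unfolding r_def using that orthonormal_combination(1,2)[OF _ on, where c = "\<lambda>i. l2_inner (b n) (q i)"]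
        orthonormalD(1)[OF on, of j]
      by (subst l2_inner_diff_left) (auto simp: b)
    have o1: "l2_inner (q n) (q j) = 0" if "j < n" for j
      unfolding q[of n] l2_inner_mult_left rq[OF that] by simp
    have o2: "l2_inner (q j) (q n) = 0" if "j < n" for j
      using o1[OF that] l2_inner_commute[of "q j" "q n"] by simp
    have "\<alpha> * (b n t - (\<Sum>j<n. d j * b j t)) = (\<Sum>j<Suc n. (\<alpha> * (if j = n then 1 else - d j)) * b j t)" for \<alpha> t
      by (simp add: sum_distrib_left sum_negf right_diff_distrib mult_ac)
    then have "q n t = (\<Sum>j\<le>n. (of_real (1 / l2_norm (r n)) * (if j = n then 1 else - d j)) * b j t)" for t
      unfolding q fun_cong[OF rd] lessThan_Suc_atMost .
    then have "\<exists>c. \<forall>t. q n t = (\<Sum>j\<le>n. c j * b j t)"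
      by (intro exI[of _ "\<lambda>j. of_real (1 / l2_norm (r n)) * (if j = n then 1 else - d j)"] allI)
    then show ?case
      using Suc qL rn qq o1 o2 by (auto simp: less_Suc_eq)
  qed simp
  then show "orthonormal UNIV (gram_schmidt b)"
    unfolding q_def[symmetric] orthonormal_def by (meson lessI less_max_iff_disj UNIV_I)
  have "b n t = (\<Sum>i\<le>n. (if i = n then of_real (l2_norm (r n)) else l2_inner (b n) (q i)) * q i t)" for t
  proof -
    have "of_real (l2_norm (r n)) * q n t = r n t"
      using main[of "Suc n"] unfolding q by simp
    then show ?thesis
      unfolding lessThan_Suc_atMost[symmetric] by (simp add: r_def)
  qed
  then show "\<exists>c. \<forall>t. b n t = (\<Sum>i\<le>n. c i * gram_schmidt b i t)"
    unfolding q_def[symmetric]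
    by (intro exI[of _ "\<lambda>i. if i = n then of_real (l2_norm (r n)) else l2_inner (b n) (q i)"] allI)
qed

lemma half_line_not_null: "\<not> (AE t in half_line. False)"
proof
  assume "AE t in half_line. False"
  then have "AE t in lborel. \<not> (0::real) < t" by (simp add: AE_restrict_space_iff)
  then have "{0::real<..} \<in> null_sets lborel"
    by (subst (asm) AE_iff_null) (auto simp: greaterThan_def)
  then have "{0<..1::real} \<in> null_sets lborel"
    by (rule null_sets_subset) auto
  then have "emeasure lborel {0<..1::real} = 0" by (rule null_setsD1)
  then show False by simp
qed

text \<open>Gram-Schmidt on the exponentials of rates 1, 2, 3, ... Independence holds because a
  nonzero polynomial has finitely many zeros, completeness because of density with weight 1.\<close>

lemma orthonormal_basis_exists: "\<exists>e. orthonormal_basis e"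
proof -
  define b where "b n t = exp (- of_nat (Suc n) * complex_of_real t)" for n t
  have bL: "b n \<in> L2" for n
    unfolding b_def by (rule L2_exp) simp
  have bp: "b n t = (exp (- of_real t)) ^ Suc n" for n t
    unfolding b_def exp_of_nat_mult[symmetric] by (simp only: mult_minus_left mult_minus_right)
  have indep: "l2_norm (\<lambda>t. b n t - (\<Sum>i<n. c i * b i t)) \<noteq> 0" for n c
  proof
    assume "l2_norm (\<lambda>t. b n t - (\<Sum>i<n. c i * b i t)) = 0"
    then have ae: "AE t in half_line. b n t - (\<Sum>i<n. c i * b i t) = 0"
      by (intro l2_norm_eq_0 L2_diff L2_sum L2_mult bL)
    \<comment> \<open>The leading coefficient is 1, so \<open>p\<close> is nonzero; its value at exp
      (- t) is the combination assumed to vanish.\<close>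
    define p where "p = monom 1 (Suc n) - (\<Sum>i<n. monom (c i) (Suc i))"
    have "coeff p (Suc n) = 1"
      by (simp add: p_def coeff_sum)
    then have "p \<noteq> 0" by auto
    then have fin: "finite {x. poly p x = 0}" by (rule poly_roots_finite)
    have "finite {t. poly p (exp (- complex_of_real t)) = 0}"
    proof (rule finite_imageD[of "\<lambda>t. exp (- complex_of_real t)"])
      show "finite ((\<lambda>t. exp (- complex_of_real t)) ` {t. poly p (exp (- complex_of_real t)) = 0})"
        by (rule finite_subset[OF _ fin]) auto
      show "inj_on (\<lambda>t. exp (- complex_of_real t)) {t. poly p (exp (- complex_of_real t)) = 0}"
        by (rule inj_onI) (simp add: exp_of_real flip: of_real_minus)
    qed
    then have "AE t in lborel. t \<notin> {t. poly p (exp (- complex_of_real t)) = 0}"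
      by (intro AE_not_in finite_imp_null_set_lborel)
    then have "AE t in half_line. t \<notin> {t. poly p (exp (- complex_of_real t)) = 0}"
      by (simp add: AE_restrict_space_iff) (auto elim: eventually_mono)
    with ae have "AE t in half_line. False"
      by eventually_elim (simp add: p_def poly_sum poly_monom bp)
    then show False using half_line_not_null by simp
  qed
  define q where "q = gram_schmidt b"
  have on: "orthonormal UNIV q"
    unfolding q_def by (rule gram_schmidt_orthonormal[OF bL indep])
  note qL = orthonormalD(1)[OF on, simplified]
  have "AE t in half_line. f t = 0" if f: "f \<in> L2" and orth: "\<forall>i. l2_inner f (q i) = 0" for f
  proof -
    have fb: "l2_inner f (b n) = 0" for n
    proof -
      obtain c where c: "\<forall>t. b n t = (\<Sum>i\<le>n. c i * q i t)"
        using gram_schmidt_orthonormal(2)[OF bL indep] unfolding q_def by blast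
      have "l2_inner f (\<lambda>t. \<Sum>i\<le>n. c i * q i t) = 0"
        by (subst l2_inner_sum_right) (auto simp: f L2_mult qL l2_inner_mult_right orth)
      moreover have "b n = (\<lambda>t. \<Sum>i\<le>n. c i * q i t)" using c by auto
      ultimately show ?thesis by simp
    qed
    \<comment> \<open>As f is orthogonal to every exponential sum, its square norm equals its inner
      product with the error of approximation.\<close>
    have "l2_norm f \<le> \<epsilon>" if \<epsilon>: "0 < \<epsilon>" for \<epsilon>
    proof -
      have v: "(\<lambda>t. complex_of_real (1 * exp (- t))) \<in> L2"
        using L2_exp[of 1] by (simp add: exp_of_real[symmetric] flip: of_real_minus)
      have "exp_approx (\<lambda>t. 1) f"
        by (rule exp_approx_L2[OF _ _ v f]) auto
      then obtain N y where y: "l2_norm (\<lambda>t. f t - esum N y t) \<le> \<epsilon>"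
        using \<epsilon> by (auto simp: exp_approx_def)
      have e: "esum N y = (\<lambda>t. \<Sum>j = 1..N. y j * b (j - 1) t)"
      proof (rule ext)
        fix t
        have "b (j - 1) t = of_real (exp (- real j * t))" if "1 \<le> j" for j
          using that by (simp add: b_def exp_of_real[symmetric])
        then show "esum N y t = (\<Sum>j = 1..N. y j * b (j - 1) t)"
          unfolding esum_def by (intro sum.cong refl) (auto simp: scaleR_conv_of_real mult.commute)
      qed
      have eL: "esum N y \<in> L2" unfolding e by (intro L2_sum L2_mult bL)
      have "l2_inner f (esum N y) = 0"
        unfolding e by (subst l2_inner_sum_right) (auto simp: f L2_mult bL l2_inner_mult_right fb)
      then have "of_real ((l2_norm f)\<^sup>2) = l2_inner f (\<lambda>t. f t - esum N y t)"
        by (simp add: l2_inner_diff_right f eL l2_inner_self)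
      then have "(l2_norm f)\<^sup>2 = norm (l2_inner f (\<lambda>t. f t - esum N y t))"
        by (metis norm_of_real abs_of_nonneg zero_le_power2)
      also have "\<dots> \<le> l2_norm f * l2_norm (\<lambda>t. f t - esum N y t)"
        by (intro l2_cauchy_schwarz L2_diff f eL)
      also have "\<dots> \<le> l2_norm f * \<epsilon>" using y by (intro mult_left_mono) auto
      finally show ?thesis
        using \<epsilon> by (cases "l2_norm f = 0") (auto simp: power2_eq_square mult_le_cancel_left_pos less_le)
    qed
    then have "l2_norm f \<le> 0" by (rule field_le_epsilon[of _ 0, simplified]) 
    then show ?thesis by (intro l2_norm_eq_0 f) (simp add: order_antisym)
  qed
  then show ?thesis using on unfolding orthonormal_basis_def by blast
qed

subsection \<open>Hankel operators are Hilbert-Schmidt\<close>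

lemma space_half_line [simp]: "space half_line = {0<..}"
  by (simp add: space_restrict_space)

text \<open>Substitute t = x + y for fixed x and interchange the integrals: for each t the
  admissible x fill (0, t), an interval of length t. This is where the weight t of the symbol space
  comes from.\<close>

lemma nn_integral_half_line_add:
  assumes "g \<in> borel_measurable half_line"
  shows "(\<integral>\<^sup>+x. (\<integral>\<^sup>+y. g (x + y) \<partial>half_line) \<partial>half_line) = (\<integral>\<^sup>+t. ennreal t * g t \<partial>half_line)"
proof -
  define h where "h t = g t * indicator {0<..} t" for t
  have [measurable]: "h \<in> borel_measurable lborel"
    using assms unfolding h_def by (simp add: borel_measurable_restrict_space_iff_ennreal)
  have "(\<integral>\<^sup>+x. (\<integral>\<^sup>+y. g (x + y) \<partial>half_line) \<partial>half_line) =
      (\<integral>\<^sup>+x. (\<integral>\<^sup>+y. h (x + y) * indicator {0<..} y \<partial>lborel) \<partial>half_line)"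
    by (intro nn_integral_cong, subst nn_integral_restrict_space)
       (auto intro!: nn_integral_cong simp: h_def indicator_def)
  also have "\<dots> = (\<integral>\<^sup>+x. (\<integral>\<^sup>+t. h t * indicator {x<..} t \<partial>lborel) \<partial>half_line)"
  proof (rule nn_integral_cong)
    fix x
    show "(\<integral>\<^sup>+y. h (x + y) * indicator {0<..} y \<partial>lborel) = (\<integral>\<^sup>+t. h t * indicator {x<..} t \<partial>lborel)"
      by (subst nn_integral_real_affine[where c = 1 and t = x])
         (auto intro!: nn_integral_cong simp: indicator_def)
  qed
  also have "\<dots> = (\<integral>\<^sup>+x. (\<integral>\<^sup>+t. h t * indicator {x<..} t \<partial>lborel) * indicator {0<..} x \<partial>lborel)"
    by (subst nn_integral_restrict_space) auto
  also have "\<dots> = (\<integral>\<^sup>+x. (\<integral>\<^sup>+t. h t * indicator {0<..<t} x \<partial>lborel) \<partial>lborel)"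
    by (intro nn_integral_cong, subst nn_integral_multc[symmetric])
       (auto intro!: nn_integral_cong simp: indicator_def)
  also have "\<dots> = (\<integral>\<^sup>+t. (\<integral>\<^sup>+x. h t * indicator {0<..<t} x \<partial>lborel) \<partial>lborel)"
  proof (rule lborel_pair.Fubini')
    have "(\<lambda>(t, x). h t * indicator {p. 0 < snd p \<and> snd p < fst p} (t, x)) \<in> borel_measurable (lborel \<Otimes>\<^sub>M lborel)"
      by measurable
    also have "(\<lambda>(t, x). h t * indicator {p. 0 < snd p \<and> snd p < fst p} (t, x)) = (\<lambda>(t, x). h t * indicator {0<..<t} x)"
      by (auto simp: indicator_def)
    finally show "(\<lambda>(t, x). h t * indicator {0<..<t} x) \<in> borel_measurable (lborel \<Otimes>\<^sub>M lborel)" .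
  qed
  also have "\<dots> = (\<integral>\<^sup>+t. (ennreal t * g t) * indicator {0<..} t \<partial>lborel)"
    by (intro nn_integral_cong, subst nn_integral_cmult)
       (auto simp: h_def indicator_def mult.commute)
  also have "\<dots> = (\<integral>\<^sup>+t. ennreal t * g t \<partial>half_line)"
    by (subst nn_integral_restrict_space) auto
  finally show ?thesis .
qed

lemma sigma_finite_half_line: "sigma_finite_measure half_line"
  by (rule sigma_finite_measure_restrict_space) (auto intro: sigma_finite_lborel)

lemma norm_integral_scaleC_le:
  assumes f: "f \<in> L2" and g: "g \<in> L2"
  shows "norm (LINT t|half_line. f t *\<^sub>C g t) \<le> l2_norm f * l2_norm g"
proof -
  have c: "(\<lambda>t. complex_of_real (norm (h t))) \<in> L2" "l2_norm (\<lambda>t. complex_of_real (norm (h t))) = l2_norm h"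
    if "h \<in> L2" for h :: "real \<Rightarrow> 'x::{complex_hilbert_space, second_countable_topology}"
    using that by (auto simp: L2_def l2_norm_def)
  have "norm (LINT t|half_line. f t *\<^sub>C g t) \<le> (LINT t|half_line. norm (f t *\<^sub>C g t))"
    by (rule integral_norm_bound)
  also have "\<dots> = norm (complex_of_real (LINT t|half_line. norm (f t) * norm (g t)))"
    by (simp add: norm_scaleC integral_nonneg_AE)
  also have "complex_of_real (LINT t|half_line. norm (f t) * norm (g t)) =
      l2_inner (\<lambda>t. complex_of_real (norm (f t))) (\<lambda>t. complex_of_real (norm (g t)))"
    unfolding l2_inner_def by (simp flip: of_real_mult)
  also have "norm \<dots> \<le> l2_norm f * l2_norm g"
    using l2_cauchy_schwarz[OF c(1)[OF f] c(1)[OF g]] c(2)[OF f] c(2)[OF g] by simp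
  finally show ?thesis .
qed

text \<open>The coefficients \<open>c i\<close> are vectors, so the scalar inequality does not
  apply. The functions \<open>cnj (e i t) *\<^sub>C c i\<close> are orthogonal in t, and both their
  square norms and their inner products with \<psi> are the square norms of the \<open>c i\<close>.
  With S the sum of these, Cauchy-Schwarz for \<psi> against the sum of the functions reads S \<le>
  |\<psi>| sqrt S.\<close>

lemma bessel_vector:
  fixes \<psi> :: "real \<Rightarrow> 'e::{complex_hilbert_space, second_countable_topology}"
  assumes I: "finite I" and e: "orthonormal I e" and \<psi>: "\<psi> \<in> L2"
  shows "(\<Sum>i\<in>I. (norm (LINT t|half_line. e i t *\<^sub>C \<psi> t))\<^sup>2) \<le> (l2_norm \<psi>)\<^sup>2"
proof -
  define c where "c i = (LINT t|half_line. e i t *\<^sub>C \<psi> t)" for i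
  define S where "S = (\<Sum>i\<in>I. (norm (c i))\<^sup>2)"
  define h where "h i t = cnj (e i t) *\<^sub>C c i" for i t
  note eL = orthonormalD(1)[OF e]
  have hL: "h i \<in> L2" if "i \<in> I" for i
  proof -
    note [measurable] = L2_measurable[OF eL[OF that]]
    have [measurable]: "cnj \<in> borel_measurable borel"
      by (intro borel_measurable_continuous_onI continuous_intros)
    have "h i \<in> borel_measurable half_line" unfolding h_def by measurable
    then show ?thesis
      using eL[OF that] by (simp add: L2_def h_def norm_scaleC power_mult_distrib)
  qed
  have gL: "(\<lambda>t. \<Sum>i\<in>I. h i t) \<in> L2" by (intro L2_sum hL)
  have ph: "l2_inner \<psi> (h i) = of_real ((norm (c i))\<^sup>2)" if "i \<in> I" for i
  proof -
    have "l2_inner \<psi> (h i) = (LINT t|half_line. cinner (e i t *\<^sub>C \<psi> t) (c i))"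
      unfolding l2_inner_def h_def by (simp add: cinner_scaleC_right cinner_scaleC_left)
    also have "\<dots> = cinner (c i) (c i)"
      unfolding c_def by (rule integral_cinner_left[OF integrable_scaleC[OF eL[OF that] \<psi>]])
    finally show ?thesis by (simp add: cinner_self)
  qed
  have hh: "l2_inner (h i) (h j) = (if i = j then of_real ((norm (c i))\<^sup>2) else 0)" if "i \<in> I" "j \<in> I" for i j
  proof -
    have "l2_inner (h i) (h j) = (LINT t|half_line. cinner (e j t) (e i t) * cinner (c i) (c j))"
      unfolding l2_inner_def h_def by (simp add: cinner_scaleC_right cinner_scaleC_left mult_ac)
    also have "\<dots> = l2_inner (e j) (e i) * cinner (c i) (c j)"
      unfolding l2_inner_def using integrable_cinner[OF eL[OF that(2)] eL[OF that(1)]] by simp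
    finally show ?thesis using orthonormalD(2)[OF e that(2,1)] by (simp add: cinner_self)
  qed
  have "l2_inner \<psi> (\<lambda>t. \<Sum>i\<in>I. h i t) = of_real S"
    by (subst l2_inner_sum_right) (auto simp: hL \<psi> ph S_def)
  moreover have "l2_inner (\<lambda>t. \<Sum>i\<in>I. h i t) (\<lambda>t. \<Sum>i\<in>I. h i t) = of_real S"
  proof -
    have "l2_inner (\<lambda>t. \<Sum>i\<in>I. h i t) (\<lambda>t. \<Sum>i\<in>I. h i t) = (\<Sum>i\<in>I. \<Sum>j\<in>I. l2_inner (h i) (h j))"
      by (subst l2_inner_sum_left) (auto simp: hL gL l2_inner_sum_right intro!: sum.cong)
    also have "\<dots> = (\<Sum>i\<in>I. \<Sum>j\<in>I. if i = j then of_real ((norm (c i))\<^sup>2) else 0)"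
      by (intro sum.cong refl hh)
    also have "\<dots> = of_real S" using I by (simp add: S_def)
    finally show ?thesis .
  qed
  then have "(l2_norm (\<lambda>t. \<Sum>i\<in>I. h i t))\<^sup>2 = S"
    unfolding l2_inner_self of_real_eq_iff .
  ultimately have "\<bar>S\<bar> \<le> l2_norm \<psi> * sqrt S"
    using l2_cauchy_schwarz[OF \<psi> gL] real_sqrt_unique[of "l2_norm (\<lambda>t. \<Sum>i\<in>I. h i t)" S] by simp
  moreover have "0 \<le> S" unfolding S_def by (intro sum_nonneg) auto
  moreover have "S = sqrt S * sqrt S" using \<open>0 \<le> S\<close> by simp
  ultimately have "sqrt S * sqrt S \<le> l2_norm \<psi> * sqrt S" by simp
  then have "sqrt S \<le> l2_norm \<psi>"
    using \<open>0 \<le> S\<close> mult_right_le_imp_le[of "sqrt S" "sqrt S" "l2_norm \<psi>"]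
    by (cases "S = 0") auto
  then have "(sqrt S)\<^sup>2 \<le> (l2_norm \<psi>)\<^sup>2" using \<open>0 \<le> S\<close> by (intro power_mono) auto
  then show ?thesis using \<open>0 \<le> S\<close> by (simp add: S_def c_def)
qed

lemma proj_from_L2: "f \<in> L2 \<Longrightarrow> proj_from x f \<in> L2"
proof -
  assume f: "f \<in> L2"
  note [measurable] = L2_measurable[OF f]
  have "proj_from x f \<in> borel_measurable half_line"
    unfolding proj_from_def by measurable
  then show ?thesis
    by (rule L2_bound[OF f]) (auto simp: proj_from_def)
qed

text \<open>\<open>\<phi> \<in> L\<^sup>2((0,\<infinity>); t dt; E)\<close> becomes \<open>hankel_weight \<phi> \<in> L2\<close>.\<close>

definition hankel_weight :: "(real \<Rightarrow> 'e::real_vector) \<Rightarrow> real \<Rightarrow> 'e"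
  where "hankel_weight \<phi> t = sqrt t *\<^sub>R \<phi> t"

context
  fixes \<phi> :: "real \<Rightarrow> 'e::{complex_hilbert_space, second_countable_topology}"
  assumes \<phi>_meas: "\<phi> \<in> borel_measurable half_line"
    and \<phi>_weight: "hankel_weight \<phi> \<in> L2"
begin

lemma nn_integral_translates:
  "(\<integral>\<^sup>+x. (\<integral>\<^sup>+y. ennreal ((norm (\<phi> (x + y)))\<^sup>2) \<partial>half_line) \<partial>half_line) = ennreal ((l2_norm (hankel_weight \<phi>))\<^sup>2)"
proof -
  note [measurable] = \<phi>_meas
  have "(\<integral>\<^sup>+x. (\<integral>\<^sup>+y. ennreal ((norm (\<phi> (x + y)))\<^sup>2) \<partial>half_line) \<partial>half_line) =
      (\<integral>\<^sup>+t. ennreal t * ennreal ((norm (\<phi> t))\<^sup>2) \<partial>half_line)"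
    by (rule nn_integral_half_line_add) measurable
  also have "\<dots> = (\<integral>\<^sup>+t. ennreal ((norm (hankel_weight \<phi> t))\<^sup>2) \<partial>half_line)"
    by (intro nn_integral_cong) (simp add: hankel_weight_def power_mult_distrib ennreal_mult')
  finally show ?thesis by (simp add: L2_nn_integral[OF \<phi>_weight])
qed

text \<open>\<phi> is measurable on the half line only, whereas composition with addition and
  integrals depending on a parameter call for a Borel function on the whole line.\<close>

definition zero_extension :: "real \<Rightarrow> 'e"
  where "zero_extension t = indicator {0<..} t *\<^sub>R \<phi> t"

lemma zero_extension_measurable [measurable]: "zero_extension \<in> borel_measurable borel"
  using \<phi>_meas unfolding zero_extension_def by (simp add: borel_measurable_restrict_space_iff)

lemma measurable_translate: "0 < x \<Longrightarrow> (\<lambda>y. \<phi> (x + y)) \<in> borel_measurable half_line"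
proof -
  assume x: "0 < x"
  have "(\<lambda>y. zero_extension (x + y)) \<in> borel_measurable half_line"
    by measurable
  then show ?thesis
    by (rule measurable_cong[THEN iffD1, rotated]) (use x in \<open>simp add: zero_extension_def\<close>)
qed

lemma translates_measurable:
  "(\<lambda>x. \<integral>\<^sup>+y. ennreal ((norm (\<phi> (x + y)))\<^sup>2) \<partial>half_line) \<in> borel_measurable half_line"
proof -
  interpret sigma_finite_measure half_line by (rule sigma_finite_half_line)
  have "(\<lambda>x. \<integral>\<^sup>+y. ennreal ((norm (zero_extension (x + y)))\<^sup>2) \<partial>half_line) \<in> borel_measurable half_line"
    by (rule borel_measurable_nn_integral) measurable
  also have "?this \<longleftrightarrow> ?thesis"
    by (intro measurable_cong nn_integral_cong) (simp add: zero_extension_def)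
  finally show ?thesis .
qed

lemma AE_translate_L2: "AE x in half_line. (\<lambda>y. \<phi> (x + y)) \<in> L2"
proof -
  have "AE x in half_line. (\<integral>\<^sup>+y. ennreal ((norm (\<phi> (x + y)))\<^sup>2) \<partial>half_line) \<noteq> \<infinity>"
    by (intro nn_integral_PInf_AE translates_measurable) (simp add: nn_integral_translates)
  with AE_space show ?thesis
  proof eventually_elim
    case (elim x)
    then have "(\<lambda>y. \<phi> (x + y)) \<in> borel_measurable half_line" by (intro measurable_translate) simp
    moreover from this elim have "integrable half_line (\<lambda>y. (norm (\<phi> (x + y)))\<^sup>2)"
      by (intro integrableI_bounded) (auto simp: less_top)
    ultimately show ?case by (simp add: L2_def)
  qed
qed

lemma hankel_measurable:
  assumes "f \<in> L2" shows "hankel \<phi> f \<in> borel_measurable half_line"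
proof -
  interpret sigma_finite_measure half_line by (rule sigma_finite_half_line)
  note [measurable] = L2_measurable[OF assms]
  have "(\<lambda>x. LINT y|half_line. f y *\<^sub>C zero_extension (x + y)) \<in> borel_measurable half_line"
    by (rule borel_measurable_lebesgue_integral) measurable
  then show ?thesis
    by (rule measurable_cong[THEN iffD1, rotated])
       (auto simp: hankel_def zero_extension_def intro!: Bochner_Integration.integral_cong)
qed

lemma hankel_L2:
  assumes f: "f \<in> L2"
  shows "hankel \<phi> f \<in> L2" "l2_norm (hankel \<phi> f) \<le> l2_norm (hankel_weight \<phi>) * l2_norm f"
proof -
  note [measurable] = \<phi>_meas
  have "(\<integral>\<^sup>+x. ennreal ((norm (hankel \<phi> f x))\<^sup>2) \<partial>half_line) \<le>
      (\<integral>\<^sup>+x. ennreal ((l2_norm f)\<^sup>2) * (\<integral>\<^sup>+y. ennreal ((norm (\<phi> (x + y)))\<^sup>2) \<partial>half_line) \<partial>half_line)"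
  proof (rule nn_integral_mono_AE, use AE_translate_L2 in eventually_elim)
    case (elim x)
    have "(norm (hankel \<phi> f x))\<^sup>2 \<le> (l2_norm f * l2_norm (\<lambda>y. \<phi> (x + y)))\<^sup>2"
      unfolding hankel_def by (intro power_mono norm_integral_scaleC_le f elim) simp
    then show ?case
      unfolding L2_nn_integral[OF elim] by (simp add: power_mult_distrib ennreal_mult'[symmetric] ennreal_leI)
  qed
  also have "\<dots> = ennreal ((l2_norm f)\<^sup>2) * (\<integral>\<^sup>+x. (\<integral>\<^sup>+y. ennreal ((norm (\<phi> (x + y)))\<^sup>2) \<partial>half_line) \<partial>half_line)"
    by (rule nn_integral_cmult[OF translates_measurable])
  also have "\<dots> = ennreal ((l2_norm (hankel_weight \<phi>) * l2_norm f)\<^sup>2)"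
    unfolding nn_integral_translates by (simp add: power_mult_distrib ennreal_mult'[symmetric] mult.commute)
  finally show "hankel \<phi> f \<in> L2" "l2_norm (hankel \<phi> f) \<le> l2_norm (hankel_weight \<phi>) * l2_norm f"
    by (auto intro!: L2_I_nn_integral hankel_measurable f)
qed

text \<open>At fixed x the values are the coefficients, in the system \<open>e\<close>, of the
  translate of \<phi> by x cut off below \<open>a\<close>. The vector form of Bessel's inequality
  bounds them by the norm of the translate, and integration over x gives the weighted norm. The cut
  only decreases norms, so the bound does not depend on \<open>a\<close>.\<close>

lemma hankel_hilbert_schmidt:
  assumes I: "finite I" and e: "orthonormal I e"
  shows "(\<Sum>i\<in>I. (l2_norm (hankel \<phi> (proj_from a (e i))))\<^sup>2) \<le> (l2_norm (hankel_weight \<phi>))\<^sup>2"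
proof -
  note eL = orthonormalD(1)[OF e]
  have meas: "hankel \<phi> (proj_from a (e i)) \<in> borel_measurable half_line" if "i \<in> I" for i
    by (intro hankel_measurable proj_from_L2 eL that)
  have "ennreal (\<Sum>i\<in>I. (l2_norm (hankel \<phi> (proj_from a (e i))))\<^sup>2) =
      (\<Sum>i\<in>I. \<integral>\<^sup>+x. ennreal ((norm (hankel \<phi> (proj_from a (e i)) x))\<^sup>2) \<partial>half_line)"
    by (subst sum_ennreal[symmetric]) (auto intro!: sum.cong simp: L2_nn_integral hankel_L2 proj_from_L2 eL)
  also have "\<dots> = (\<integral>\<^sup>+x. (\<Sum>i\<in>I. ennreal ((norm (hankel \<phi> (proj_from a (e i)) x))\<^sup>2)) \<partial>half_line)"
  proof (rule nn_integral_sum[symmetric])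
    fix i assume "i \<in> I"
    note [measurable] = meas[OF this]
    show "(\<lambda>x. ennreal ((norm (hankel \<phi> (proj_from a (e i)) x))\<^sup>2)) \<in> borel_measurable half_line"
      by measurable
  qed
  also have "\<dots> \<le> (\<integral>\<^sup>+x. (\<integral>\<^sup>+y. ennreal ((norm (\<phi> (x + y)))\<^sup>2) \<partial>half_line) \<partial>half_line)"
  proof (rule nn_integral_mono_AE, use AE_translate_L2 in eventually_elim)
    case (elim x)
    note [measurable] = L2_measurable[OF elim]
    define \<psi> where "\<psi> y = (if a \<le> y then \<phi> (x + y) else 0)" for y
    have \<psi>m: "\<psi> \<in> borel_measurable half_line" unfolding \<psi>_def by measurable
    have \<psi>: "\<psi> \<in> L2" by (rule L2_bound[OF elim \<psi>m]) (simp add: \<psi>_def)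
    have h: "hankel \<phi> (proj_from a (e i)) x = (LINT y|half_line. e i y *\<^sub>C \<psi> y)" for i
      unfolding hankel_def \<psi>_def proj_from_def
      by (intro Bochner_Integration.integral_cong) auto
    have "(\<Sum>i\<in>I. ennreal ((norm (hankel \<phi> (proj_from a (e i)) x))\<^sup>2)) =
        ennreal (\<Sum>i\<in>I. (norm (LINT y|half_line. e i y *\<^sub>C \<psi> y))\<^sup>2)"
      unfolding h by (intro sum_ennreal) simp
    also have "\<dots> \<le> ennreal ((l2_norm \<psi>)\<^sup>2)"
      by (intro ennreal_leI bessel_vector I e \<psi>)
    also have "\<dots> = (\<integral>\<^sup>+y. ennreal ((norm (\<psi> y))\<^sup>2) \<partial>half_line)"
      by (rule L2_nn_integral[OF \<psi>, symmetric])
    also have "\<dots> \<le> (\<integral>\<^sup>+y. ennreal ((norm (\<phi> (x + y)))\<^sup>2) \<partial>half_line)"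
      by (intro nn_integral_mono ennreal_leI) (simp add: \<psi>_def)
    finally show ?case .
  qed
  also have "\<dots> = ennreal ((l2_norm (hankel_weight \<phi>))\<^sup>2)" by (rule nn_integral_translates)
  finally show ?thesis by (simp add: ennreal_le_iff)
qed

end

lemma proj_from_0: "0 < t \<Longrightarrow> proj_from 0 f t = f t"
  by (simp add: proj_from_def)

lemma hankel_proj_from_0: "hankel \<phi> (proj_from 0 f) = hankel \<phi> f"
  unfolding hankel_def by (intro ext Bochner_Integration.integral_cong) (auto simp: proj_from_0)

text \<open>Only almost everywhere, since for exceptional x a translate by x may fail to lie in
  \<open>L2\<close>, and the defining integrals need not be additive.\<close>

lemma hankel_diff:
  assumes "\<phi> \<in> borel_measurable half_line" "hankel_weight \<phi> \<in> L2"
    "\<psi> \<in> borel_measurable half_line" "hankel_weight \<psi> \<in> L2" "f \<in> L2"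
  shows "AE x in half_line. hankel (\<lambda>t. \<phi> t - \<psi> t) f x = hankel \<phi> f x - hankel \<psi> f x"
  using AE_translate_L2[OF assms(1,2)] AE_translate_L2[OF assms(3,4)]
proof eventually_elim
  case (elim x)
  then show ?case
    unfolding hankel_def scaleC_diff_right
    by (intro Bochner_Integration.integral_diff integrable_scaleC assms)
qed

text \<open>The adjoint is eliminated here: the later estimates for \<open>K\<close> start from this
  form.\<close>

lemma hankel_square_inner:
  assumes "is_hankel_square K \<phi>" "bounded_op K" "f \<in> L2" "g \<in> L2"
  shows "l2_inner (K f) g = l2_inner (hankel \<phi> f) (hankel \<phi> g)"
proof -
  obtain B where B: "is_adjoint (hankel \<phi>) B" "op_eq K (\<lambda>h. B (hankel \<phi> h))"
    using assms(1) by (auto simp: is_hankel_square_def)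
  have L: "hankel \<phi> f \<in> L2" "B (hankel \<phi> f) \<in> L2" "K f \<in> L2"
    using B(1) assms unfolding is_adjoint_def bounded_op_def by blast+
  have "l2_inner (K f) g = l2_inner (B (hankel \<phi> f)) g"
    using B(2) assms L by (intro l2_inner_cong_AE) (auto simp: op_eq_def)
  also have "\<dots> = cnj (l2_inner (hankel \<phi> g) (hankel \<phi> f))"
    using B(1) assms L l2_inner_commute[of "B (hankel \<phi> f)" g] by (simp add: is_adjoint_def)
  also have "\<dots> = l2_inner (hankel \<phi> f) (hankel \<phi> g)"
    by (rule l2_inner_commute[symmetric])
  finally show ?thesis .
qed

subsection \<open>Series of principal minors\<close>

lemma list_det_scale:
  assumes "length is = length js"
  shows "list_det (\<lambda>i j. a i * X i j * b j) is js =
    (\<Prod>k<length is. a (is ! k)) * (\<Prod>k<length is. b (js ! k)) * list_det X is js"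
proof -
  define n where "n = length is"
  have "(\<Prod>k = 0..<n. a (is ! k) * X (is ! k) (js ! p k) * b (js ! p k)) =
      (\<Prod>k<n. a (is ! k)) * (\<Prod>k<n. b (js ! k)) * (\<Prod>k = 0..<n. X (is ! k) (js ! p k))"
    if "p permutes {0..<n}" for p
    unfolding prod.distrib using prod.permute[OF that, of "\<lambda>k. b (js ! k)"]
    by (simp add: atLeast0LessThan o_def mult_ac)
  then show ?thesis
    unfolding list_det_leibniz[OF assms] n_def[symmetric] sum_distrib_left
    by (intro sum.cong refl) (auto simp: mult_ac)
qed

lemma prod_nth_distinct:
  assumes "distinct l" shows "(\<Prod>k<length l. f (l ! k)) = (\<Prod>i\<in>set l. f i)"
proof -
  have "bij_betw ((!) l) {..<length l} (set l)"
    using assms by (intro bij_betw_nth) auto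
  then show ?thesis by (rule prod.reindex_bij_betw)
qed

lemma list_det_tendsto:
  assumes "length is = length js"
    and "\<And>i j. i \<in> set is \<Longrightarrow> j \<in> set js \<Longrightarrow> ((\<lambda>n. A n i j) \<longlongrightarrow> L i j) F"
  shows "((\<lambda>n. list_det (A n) is js) \<longlongrightarrow> list_det L is js) F"
  unfolding list_det_leibniz[OF assms(1)]
proof (intro tendsto_intros assms(2))
  fix p k assume "p \<in> {p. p permutes {0..<length is}}" "k \<in> {0..<length is}"
  then show "is ! k \<in> set is" "js ! p k \<in> set js"
    using permutes_in_image[of p "{0..<length is}" k] assms(1) by auto
qed

lemma list_det_cong:
  assumes "length is = length js"
    and "\<And>i j. i \<in> set is \<Longrightarrow> j \<in> set js \<Longrightarrow> A i j = B i j"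
  shows "list_det A is js = list_det B is js"
  unfolding list_det_def
  by (rule arg_cong[of _ _ Determinant.det], rule eq_matI) (use assms in auto)

lemma norm_list_det_gram_le:
  assumes "\<And>i. i \<in> set l \<Longrightarrow> u i \<in> L2" "\<And>i. i \<in> set l \<Longrightarrow> v i \<in> L2"
  shows "norm (list_det (\<lambda>i j. l2_inner (u j) (v i)) l l) \<le> (\<Prod>k<length l. l2_norm (u (l ! k)) * l2_norm (v (l ! k)))"
proof -
  define n where "n = length l"
  define z where "z a = (if a < n then v (l ! a) else u (l ! (a - n)))" for a
  have zL: "z a \<in> L2" if "a < 2 * n" for a
    using assms that by (auto simp: z_def n_def)
  have "psd (2 * n) (\<lambda>a b. l2_inner (z a) (z b))"
    by (rule psd_gram) (rule zL)
  then have "norm (Determinant.det (Matrix.mat n n (\<lambda>(i, j). l2_inner (z (n + j)) (z i)))) \<le>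
      (\<Prod>i<n. sqrt (Re (l2_inner (z i) (z i))) * sqrt (Re (l2_inner (z (n + i)) (z (n + i)))))"
    by (rule hadamard_mixed)
  also have "Matrix.mat n n (\<lambda>(i, j). l2_inner (z (n + j)) (z i)) =
      Matrix.mat n n (\<lambda>(i, j). l2_inner (u (l ! j)) (v (l ! i)))"
    by (rule eq_matI) (auto simp: z_def)
  also have "(\<Prod>i<n. sqrt (Re (l2_inner (z i) (z i))) * sqrt (Re (l2_inner (z (n + i)) (z (n + i))))) =
      (\<Prod>k<n. l2_norm (u (l ! k)) * l2_norm (v (l ! k)))"
    by (intro prod.cong refl) (auto simp: z_def l2_inner_self real_sqrt_abs simp del: of_real_power)
  finally show ?thesis by (simp add: list_det_def n_def)
qed

definition minor :: "(nat \<Rightarrow> real \<Rightarrow> 'e::{complex_hilbert_space, second_countable_topology}) \<Rightarrow>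
    (nat \<Rightarrow> real \<Rightarrow> 'e) \<Rightarrow> nat set \<Rightarrow> complex"
  where "minor u v S = list_det (\<lambda>i j. l2_inner (u j) (v i)) (sorted_list_of_set S) (sorted_list_of_set S)"

lemma norm_minor_le:
  assumes "finite S" "\<And>i. u i \<in> L2" "\<And>i. v i \<in> L2"
  shows "norm (minor u v S) \<le> (\<Prod>i\<in>S. l2_norm (u i) * l2_norm (v i))"
  using norm_list_det_gram_le[of "sorted_list_of_set S" u v] assms
    prod_nth_distinct[of "sorted_list_of_set S" "\<lambda>i. l2_norm (u i) * l2_norm (v i)"]
  by (simp add: minor_def)

text \<open>The transpose is expanded, so that the permutation moves the indices of \<open>v\<close>
  and each \<open>u j\<close> sits in one factor of every product; linearity in a single
  \<open>u j\<close> becomes visible.\<close>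

lemma minor_leibniz:
  "minor u v S = (\<Sum>p | p permutes {0..<length (sorted_list_of_set S)}. signof p *
    (\<Prod>a = 0..<length (sorted_list_of_set S). l2_inner (u (sorted_list_of_set S ! a)) (v (sorted_list_of_set S ! p a))))"
  unfolding minor_def by (subst list_det_transpose) (simp_all add: list_det_leibniz)

lemma minor_update_diff:
  assumes "finite S" "j \<in> S" "a \<in> L2" "b \<in> L2" "\<And>i. v i \<in> L2"
  shows "minor (u(j := a)) v S - minor (u(j := b)) v S = minor (u(j := (\<lambda>t. a t - b t))) v S"
proof -
  define l where "l = sorted_list_of_set S"
  define n where "n = length l"
  have l: "distinct l" "set l = S" using assms(1) by (auto simp: l_def)
  then obtain k where k: "k < n" "l ! k = j"
    using assms(2) unfolding n_def by (metis in_set_conv_nth)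
  have P: "(\<Prod>i = 0..<n. l2_inner ((u(j := x)) (l ! i)) (v (l ! p i))) =
      l2_inner x (v (l ! p k)) * (\<Prod>i\<in>{0..<n} - {k}. l2_inner (u (l ! i)) (v (l ! p i)))" for x p
  proof -
    have "l ! i \<noteq> j" if "i \<in> {0..<n} - {k}" for i
      using that k l(1) nth_eq_iff_index_eq[of l i k] by (auto simp: n_def)
    then have "(\<Prod>i\<in>{0..<n} - {k}. l2_inner ((u(j := x)) (l ! i)) (v (l ! p i))) =
        (\<Prod>i\<in>{0..<n} - {k}. l2_inner (u (l ! i)) (v (l ! p i)))"
      by (intro prod.cong refl) auto
    then show ?thesis
      using k by (subst prod.remove[of "{0..<n}" k]) auto
  qed
  show ?thesis
    unfolding minor_leibniz l_def[symmetric] n_def[symmetric] P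
    by (simp add: l2_inner_diff_left assms sum_subtractf[symmetric] algebra_simps)
qed

text \<open>The vectors are exchanged one at a time. Each exchange alters the minor by a minor with
  the difference in one place, which Hadamard's inequality bounds; the other places hold
  \<open>u i\<close> or \<open>u' i\<close>, whose norms are both at most the sum of the
  two.\<close>

lemma minor_diff_left:
  assumes S: "finite S" and L: "\<And>i. u i \<in> L2" "\<And>i. u' i \<in> L2" "\<And>i. v i \<in> L2"
  shows "norm (minor u v S - minor u' v S) \<le>
    (\<Sum>j\<in>S. l2_norm (\<lambda>t. u j t - u' j t) * l2_norm (v j) *
      (\<Prod>i\<in>S - {j}. (l2_norm (u i) + l2_norm (u' i)) * l2_norm (v i)))"
proof -
  define b where "b j = l2_norm (\<lambda>t. u j t - u' j t) * l2_norm (v j) *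
      (\<Prod>i\<in>S - {j}. (l2_norm (u i) + l2_norm (u' i)) * l2_norm (v i))" for j
  define w where "w Q j = (if j \<in> Q then u' j else u j)" for Q j
  have "norm (minor u v S - minor (w Q) v S) \<le> (\<Sum>j\<in>Q. b j)" if "finite Q" "Q \<subseteq> S" for Q
    using that
  proof (induction Q)
    case empty
    have "w {} = u" by (auto simp: w_def)
    then show ?case by simp
  next
    case (insert q Q)
    have 1: "(w Q)(q := u q) = w Q" "(w Q)(q := u' q) = w (insert q Q)"
      using insert.hyps by (auto simp: w_def)
    define x where "x = (w Q)(q := (\<lambda>t. u q t - u' q t))"
    have "minor (w Q) v S - minor (w (insert q Q)) v S = minor x v S"
      using minor_update_diff[OF S, of q "u q" "u' q" v "w Q"] insert.prems L unfolding 1 x_def by simp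
    moreover have "norm (minor x v S) \<le> b q"
    proof -
      have "norm (minor x v S) \<le> (\<Prod>i\<in>S. l2_norm (x i) * l2_norm (v i))"
        by (rule norm_minor_le[OF S _ L(3)]) (auto simp: x_def w_def L L2_diff)
      also have "\<dots> = l2_norm (x q) * l2_norm (v q) * (\<Prod>i\<in>S - {q}. l2_norm (x i) * l2_norm (v i))"
        using S insert.prems by (intro prod.remove) auto
      also have "\<dots> \<le> l2_norm (x q) * l2_norm (v q) *
          (\<Prod>i\<in>S - {q}. (l2_norm (u i) + l2_norm (u' i)) * l2_norm (v i))"
        by (intro mult_left_mono prod_mono conjI mult_nonneg_nonneg mult_right_mono) (auto simp: x_def w_def)
      also have "\<dots> = b q" by (simp add: b_def x_def)
      finally show ?thesis .
    qed
    moreover have "norm (minor u v S - minor (w (insert q Q)) v S) \<le>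
        norm (minor u v S - minor (w Q) v S) + norm (minor (w Q) v S - minor (w (insert q Q)) v S)"
      using norm_triangle_ineq[of "minor u v S - minor (w Q) v S" "minor (w Q) v S - minor (w (insert q Q)) v S"]
      by simp
    ultimately show ?case using insert by simp
  qed
  from this[OF S order_refl] have "norm (minor u v S - minor (w S) v S) \<le> (\<Sum>j\<in>S. b j)" .
  moreover have "minor (w S) v S = minor u' v S"
    unfolding minor_def using S by (intro list_det_cong) (auto simp: w_def)
  ultimately show ?thesis by (simp add: b_def)
qed

text \<open>Transfers estimates for changes in the first family to the second.\<close>

lemma minor_commute: "minor u v S = cnj (minor v u S)"
proof -
  have "cnj (minor v u S) = list_det (\<lambda>i j. cnj (l2_inner (v j) (u i))) (sorted_list_of_set S) (sorted_list_of_set S)"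
    unfolding minor_def by (simp add: list_det_leibniz)
  also have "\<dots> = list_det (\<lambda>i j. l2_inner (u i) (v j)) (sorted_list_of_set S) (sorted_list_of_set S)"
    by (rule list_det_cong) (auto intro: l2_inner_commute[symmetric])
  also have "\<dots> = minor u v S"
    unfolding minor_def by (rule list_det_transpose) simp
  finally show ?thesis ..
qed

section \<open>Summation of minors over all finite index sets\<close>

lemma sum_Pow_prod: "finite F \<Longrightarrow> (\<Sum>S\<in>Pow F. \<Prod>i\<in>S. b i) = (\<Prod>i\<in>F. b i + 1)"
  for b :: "'i \<Rightarrow> real"
  by (simp add: prod_add)

lemma prod_add_one_le_exp:
  fixes b :: "'i \<Rightarrow> real"
  assumes "\<And>i. i \<in> F \<Longrightarrow> 0 \<le> b i" "(\<Sum>i\<in>F. b i) \<le> B"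
  shows "(\<Prod>i\<in>F. b i + 1) \<le> exp B"
proof (cases "finite F")
  case True
  have "(\<Prod>i\<in>F. b i + 1) \<le> (\<Prod>i\<in>F. exp (b i))"
    using assms(1) by (intro prod_mono) (auto simp: add.commute intro: add_nonneg_nonneg exp_ge_add_one_self)
  also have "\<dots> = exp (\<Sum>i\<in>F. b i)" using True by (simp add: exp_sum)
  finally show ?thesis using assms(2) by (meson exp_le_cancel_iff order_trans)
qed (use assms in auto)

text \<open>After exchanging the sums, the sets S containing j become the subsets of F - {j}, whose
  products add up to the product of the factors 1 + b i. This is the product rule for that product,
  with the remaining factors bounded by \<open>exp B\<close>.\<close>

lemma sum_Pow_sum_prod:
  fixes a b :: "'i \<Rightarrow> real"
  assumes F: "finite F" and ab: "\<And>i. 0 \<le> a i" "\<And>i. 0 \<le> b i" and B: "(\<Sum>i\<in>F. b i) \<le> B"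
  shows "(\<Sum>S\<in>Pow F. \<Sum>j\<in>S. a j * (\<Prod>i\<in>S - {j}. b i)) \<le> (\<Sum>j\<in>F. a j) * exp B"
proof -
  have "(\<Sum>S\<in>Pow F. \<Sum>j\<in>S. a j * (\<Prod>i\<in>S - {j}. b i)) = (\<Sum>S\<in>Pow F. \<Sum>j | j \<in> F \<and> j \<in> S. a j * (\<Prod>i\<in>S - {j}. b i))"
    by (intro sum.cong refl) auto
  also have "\<dots> = (\<Sum>j\<in>F. \<Sum>S | S \<in> Pow F \<and> j \<in> S. a j * (\<Prod>i\<in>S - {j}. b i))"
    using F by (intro sum.swap_restrict) auto
  also have "\<dots> \<le> (\<Sum>j\<in>F. a j * exp B)"
  proof (rule sum_mono)
    fix j assume j: "j \<in> F"
    have "(\<Sum>S | S \<in> Pow F \<and> j \<in> S. a j * (\<Prod>i\<in>S - {j}. b i)) = (\<Sum>R\<in>Pow (F - {j}). a j * (\<Prod>i\<in>R. b i))"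
      by (rule sum.reindex_bij_witness[where i = "insert j" and j = "\<lambda>S. S - {j}"]) (use j in auto)
    also have "\<dots> = a j * (\<Prod>i\<in>F - {j}. b i + 1)"
      using F by (simp add: sum_distrib_left[symmetric] sum_Pow_prod)
    also have "\<dots> \<le> a j * exp B"
    proof (intro mult_left_mono prod_add_one_le_exp)
      show "(\<Sum>i\<in>F - {j}. b i) \<le> B"
        using B F ab(2) sum_mono2[of F "F - {j}" b] by auto
    qed (use ab in auto)
    finally show "(\<Sum>S | S \<in> Pow F \<and> j \<in> S. a j * (\<Prod>i\<in>S - {j}. b i)) \<le> a j * exp B" .
  qed
  finally show ?thesis by (simp add: sum_distrib_right)
qed

lemma sum_mult_le:
  fixes a b :: "'i \<Rightarrow> real"
  assumes "(\<Sum>i\<in>F. (a i)\<^sup>2) \<le> A\<^sup>2" "(\<Sum>i\<in>F. (b i)\<^sup>2) \<le> B\<^sup>2" "0 \<le> A" "0 \<le> B"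
  shows "(\<Sum>i\<in>F. a i * b i) \<le> A * B"
proof (rule power2_le_imp_le)
  have "(\<Sum>i\<in>F. a i * b i)\<^sup>2 \<le> (\<Sum>i\<in>F. (a i)\<^sup>2) * (\<Sum>i\<in>F. (b i)\<^sup>2)"
    by (rule Cauchy_Schwarz_ineq_sum)
  also have "\<dots> \<le> A\<^sup>2 * B\<^sup>2" using assms by (intro mult_mono sum_nonneg) auto
  finally show "(\<Sum>i\<in>F. a i * b i)\<^sup>2 \<le> (A * B)\<^sup>2" by (simp add: power_mult_distrib)
qed (use assms in simp)

text \<open>The families \<open>Pow {..<n}\<close> are cofinal among the finite families of finite
  sets, so the unconditional sum may be read along them. On such a block the Cauchy-Binet formula
  can be summed over all S.\<close>

lemma has_sum_Pow_lessThan: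
  assumes "(f has_sum s) {S::nat set. finite S}"
  shows "(\<lambda>n. \<Sum>S\<in>Pow {..<n}. f S) \<longlonglongrightarrow> s"
proof -
  have "filterlim (\<lambda>n. Pow {..<n}) (finite_subsets_at_top {S::nat set. finite S}) sequentially"
    unfolding filterlim_finite_subsets_at_top
  proof (intro allI impI)
    fix X assume X: "finite X \<and> X \<subseteq> {S::nat set. finite S}"
    then have "finite (\<Union>X)" by auto
    then obtain m where "\<Union>X \<subseteq> {..<m}" using finite_nat_iff_bounded by auto
    show "\<forall>\<^sub>F n in sequentially. finite (Pow {..<n}) \<and> X \<subseteq> Pow {..<n} \<and> Pow {..<n} \<subseteq> {S. finite S}"
    proof (rule eventually_mono[OF eventually_ge_at_top[of m]])
      fix n assume "m \<le> n"
      with \<open>\<Union>X \<subseteq> {..<m}\<close> have "X \<subseteq> Pow {..<n}" by fastforce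
      then show "finite (Pow {..<n}) \<and> X \<subseteq> Pow {..<n} \<and> Pow {..<n} \<subseteq> {S. finite S}"
        by (auto intro: finite_subset)
    qed
  qed
  with assms show ?thesis unfolding has_sum_def by (rule filterlim_compose)
qed

text \<open>When the \<open>u i\<close> are the images of an orthonormal basis, this says that the
  operator has Hilbert-Schmidt norm at most A.\<close>

definition hs_bounded :: "real \<Rightarrow> (nat \<Rightarrow> real \<Rightarrow> 'e::{complex_hilbert_space, second_countable_topology}) \<Rightarrow> bool"
  where "hs_bounded A u \<longleftrightarrow> 0 \<le> A \<and> (\<forall>i. u i \<in> L2) \<and> (\<forall>F. finite F \<longrightarrow> (\<Sum>i\<in>F. (l2_norm (u i))\<^sup>2) \<le> A\<^sup>2)"

text \<open>The series of the absolute values is dominated by \<open>\<Prod>(1 + \<parallel>u\<^sub>i\<parallel> \<parallel>v\<^sub>i\<parallel>)\<close>.\<close>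

lemma minors_summable:
  assumes u: "hs_bounded A u" and v: "hs_bounded A v"
  shows "(\<lambda>S. (- 1) ^ card S * minor u v S) summable_on {S. finite S}"
proof (rule abs_summable_summable, rule nonneg_bdd_above_summable_on)
  have "(\<Sum>S\<in>X. norm ((- 1) ^ card S * minor u v S)) \<le> exp (A * A)"
    if X: "finite X" "X \<subseteq> {S. finite S}" for X
  proof -
    define F where "F = \<Union>X"
    have F: "finite F" "X \<subseteq> Pow F" using X by (auto simp: F_def)
    have "(\<Sum>S\<in>X. norm ((- 1) ^ card S * minor u v S)) \<le> (\<Sum>S\<in>X. \<Prod>i\<in>S. l2_norm (u i) * l2_norm (v i))"
      using X u v by (intro sum_mono) (auto simp: norm_mult norm_power hs_bounded_def intro!: norm_minor_le)
    also have "\<dots> \<le> (\<Sum>S\<in>Pow F. \<Prod>i\<in>S. l2_norm (u i) * l2_norm (v i))"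
      using F by (intro sum_mono2) (auto intro!: prod_nonneg)
    also have "\<dots> \<le> exp (A * A)"
      unfolding sum_Pow_prod[OF F(1)] using u v F
      by (intro prod_add_one_le_exp sum_mult_le) (auto simp: hs_bounded_def)
    finally show ?thesis .
  qed
  then show "bdd_above (sum (\<lambda>S. norm ((- 1) ^ card S * minor u v S)) ` {F. F \<subseteq> {S. finite S} \<and> finite F})"
    by (intro bdd_aboveI[of _ "exp (A * A)"]) auto
qed auto

text \<open>The exponent comes from the sum of the products (|u i| + |u' i|) |v i|, which is at most
  2 A^2 by Cauchy-Schwarz; the factor \<delta> A bounds in the same way the sum of the terms with
  the difference.\<close>

lemma minors_diff_left:
  assumes F: "finite F" and u: "hs_bounded A u" and u': "hs_bounded A u'" and v: "hs_bounded A v"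
    and d: "hs_bounded \<delta> (\<lambda>i t. u i t - u' i t)"
  shows "(\<Sum>S\<in>Pow F. norm (minor u v S - minor u' v S)) \<le> \<delta> * A * exp (2 * A * A)"
proof -
  have L: "u i \<in> L2" "u' i \<in> L2" "v i \<in> L2" for i using u u' v by (auto simp: hs_bounded_def)
  have A: "0 \<le> A" "0 \<le> \<delta>" using u d by (auto simp: hs_bounded_def)
  have "(\<Sum>S\<in>Pow F. norm (minor u v S - minor u' v S)) \<le>
      (\<Sum>S\<in>Pow F. \<Sum>j\<in>S. l2_norm (\<lambda>t. u j t - u' j t) * l2_norm (v j) *
      (\<Prod>i\<in>S - {j}. (l2_norm (u i) + l2_norm (u' i)) * l2_norm (v i)))"
    using F by (intro sum_mono minor_diff_left L) (auto intro: finite_subset)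
  also have "\<dots> \<le> (\<Sum>j\<in>F. l2_norm (\<lambda>t. u j t - u' j t) * l2_norm (v j)) * exp (A * A + A * A)"
  proof (rule sum_Pow_sum_prod[OF F])
    show "(\<Sum>i\<in>F. (l2_norm (u i) + l2_norm (u' i)) * l2_norm (v i)) \<le> A * A + A * A"
      unfolding distrib_right sum.distrib using F u u' v
      by (intro add_mono sum_mult_le) (auto simp: hs_bounded_def)
  qed auto
  also have "\<dots> \<le> (\<delta> * A) * exp (A * A + A * A)"
    using F u v d by (intro mult_right_mono sum_mult_le) (auto simp: hs_bounded_def)
  finally show ?thesis by (simp add: mult_2 algebra_simps)
qed

text \<open>The two families are exchanged one after the other, which gives the factor 2; for
  \<open>v\<close> the exchange is moved to the first argument by \<open>minor_commute\<close>. The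
  bounds on finite blocks do not depend on n and pass to the limit.\<close>

lemma minors_series_diff:
  assumes u: "hs_bounded A u" and u': "hs_bounded A u'" and v: "hs_bounded A v" and v': "hs_bounded A v'"
    and du: "hs_bounded \<delta> (\<lambda>i t. u i t - u' i t)" and dv: "hs_bounded \<delta> (\<lambda>i t. v i t - v' i t)"
    and s: "((\<lambda>S. (- 1) ^ card S * minor u v S) has_sum s) {S. finite S}"
    and s': "((\<lambda>S. (- 1) ^ card S * minor u' v' S) has_sum s') {S. finite S}"
  shows "norm (s - s') \<le> 2 * \<delta> * A * exp (2 * A * A)"
proof (rule LIMSEQ_le_const2)
  show "(\<lambda>n. norm ((\<Sum>S\<in>Pow {..<n}. (- 1) ^ card S * minor u v S) -
      (\<Sum>S\<in>Pow {..<n}. (- 1) ^ card S * minor u' v' S))) \<longlonglongrightarrow> norm (s - s')"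
    by (intro tendsto_intros has_sum_Pow_lessThan s s')
  have "norm ((\<Sum>S\<in>Pow {..<n}. (- 1) ^ card S * minor u v S) -
      (\<Sum>S\<in>Pow {..<n}. (- 1) ^ card S * minor u' v' S)) \<le> 2 * \<delta> * A * exp (2 * A * A)" for n
  proof -
    have "norm ((\<Sum>S\<in>Pow {..<n}. (- 1) ^ card S * minor u v S) - (\<Sum>S\<in>Pow {..<n}. (- 1) ^ card S * minor u' v' S)) \<le>
       (\<Sum>S\<in>Pow {..<n}. norm ((- 1) ^ card S * (minor u v S - minor u' v' S)))"
      unfolding sum_subtractf[symmetric] right_diff_distrib[symmetric] by (rule norm_sum)
    also have "\<dots> \<le> (\<Sum>S\<in>Pow {..<n}. norm (minor u v S - minor u' v S) + norm (minor v u' S - minor v' u' S))"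
    proof (rule sum_mono)
      fix S :: "nat set"
      have "minor u' v S - minor u' v' S = cnj (minor v u' S - minor v' u' S)"
        using minor_commute[of u' v S] minor_commute[of u' v' S] by simp
      then have "norm (minor u' v S - minor u' v' S) = norm (minor v u' S - minor v' u' S)"
        by (metis complex_mod_cnj)
      then show "norm ((- 1) ^ card S * (minor u v S - minor u' v' S)) \<le>
          norm (minor u v S - minor u' v S) + norm (minor v u' S - minor v' u' S)"
        using norm_triangle_ineq[of "minor u v S - minor u' v S" "minor u' v S - minor u' v' S"]
        by (simp add: norm_mult norm_power)
    qed
    also have "\<dots> \<le> \<delta> * A * exp (2 * A * A) + \<delta> * A * exp (2 * A * A)"
      unfolding sum.distrib by (intro add_mono minors_diff_left assms) auto
    finally show ?thesis by (simp add: mult_ac)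
  qed
  then show "\<exists>N. \<forall>n\<ge>N. norm ((\<Sum>S\<in>Pow {..<n}. (- 1) ^ card S * minor u v S) -
      (\<Sum>S\<in>Pow {..<n}. (- 1) ^ card S * minor u' v' S)) \<le> 2 * \<delta> * A * exp (2 * A * A)" by blast
qed

subsection \<open>Operators of finite rank\<close>

text \<open>Uniqueness rests on the existence of a basis: without one the condition under
  \<open>THE\<close> would hold for every number.\<close>

lemma det_id_minus_eqI:
  assumes "\<And>e. orthonormal_basis e \<Longrightarrow>
    ((\<lambda>S. (- 1) ^ card S * list_det (\<lambda>i j. l2_inner (T (e j)) (e i))
        (sorted_list_of_set S) (sorted_list_of_set S)) has_sum d) {S. finite S}"
  shows "det_id_minus T = d"
  unfolding det_id_minus_def
proof (rule the_equality)
  fix d' assume d': "\<forall>e. orthonormal_basis e \<longrightarrow>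
    ((\<lambda>S. (- 1) ^ card S * list_det (\<lambda>i j. l2_inner (T (e j)) (e i))
        (sorted_list_of_set S) (sorted_list_of_set S)) has_sum d') {S. finite S}"
  obtain e where "orthonormal_basis e" using orthonormal_basis_exists by blast
  then show "d' = d" using d' assms has_sum_unique by blast
qed (use assms in blast)

definition fin_op :: "nat \<Rightarrow> (nat \<Rightarrow> real \<Rightarrow> complex) \<Rightarrow> (nat \<Rightarrow> real \<Rightarrow> complex) \<Rightarrow> l2_op"
  where "fin_op N g h f t = (\<Sum>j = 1..N. l2_inner f (g j) * h j t)"

lemma matrix_inverse_exists:
  fixes M :: "nat \<Rightarrow> nat \<Rightarrow> complex"
  assumes inj: "\<forall>c. (\<forall>i\<in>{1..N}. (\<Sum>j = 1..N. M i j * c j) = 0) \<longrightarrow> (\<forall>i\<in>{1..N}. c i = 0)"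
  shows "\<exists>V. (\<forall>i\<in>{1..N}. \<forall>k\<in>{1..N}. (\<Sum>j = 1..N. M i j * V j k) = (if i = k then 1 else 0)) \<and>
    (\<forall>i\<in>{1..N}. \<forall>k\<in>{1..N}. (\<Sum>j = 1..N. V i j * M j k) = (if i = k then 1 else 0))"
proof -
  define A where "A = Matrix.mat N N (\<lambda>(i, j). M (Suc i) (Suc j))"
  have A: "A \<in> carrier_mat N N" by (simp add: A_def)
  have sh: "(\<Sum>j = 1..N. f j) = (\<Sum>j<N. f (Suc j))" for f :: "nat \<Rightarrow> complex"
    unfolding One_nat_def by (rule sum.atLeast1_atMost_eq)
  have "Determinant.det A \<noteq> 0"
  proof
    assume "Determinant.det A = 0"
    then obtain v where v: "v \<in> carrier_vec N" "v \<noteq> 0\<^sub>v N" "A *\<^sub>v v = 0\<^sub>v N"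
      using det_0_iff_vec_prod_zero_field[OF A] by auto
    have "\<forall>i\<in>{1..N}. (\<Sum>j = 1..N. M i j * Matrix.vec_index v (j - 1)) = 0"
    proof
      fix i assume "i \<in> {1..N}"
      then obtain i' where i': "i = Suc i'" "i' < N" by (cases i) auto
      have "Matrix.vec_index (A *\<^sub>v v) i' = 0" using v(3) i' by simp
      moreover have "Matrix.vec_index (A *\<^sub>v v) i' = (\<Sum>j<N. M i (Suc j) * Matrix.vec_index v j)"
        using i' v(1) A by (subst index_mult_mat_vec) (auto simp: A_def scalar_prod_def atLeast0LessThan)
      ultimately show "(\<Sum>j = 1..N. M i j * Matrix.vec_index v (j - 1)) = 0" unfolding sh by simp
    qed
    then have "\<forall>i\<in>{1..N}. Matrix.vec_index v (i - 1) = 0"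
      by (rule inj[THEN spec[where x = "\<lambda>j. Matrix.vec_index v (j - 1)"], THEN mp])
    then have "Matrix.vec_index v i = 0" if "i < N" for i using that by force
    then have "v = 0\<^sub>v N" using v(1) by (intro eq_vecI) auto
    with v(2) show False ..
  qed
  from det_non_zero_imp_unit[OF A this, of "()"] obtain B where
    B: "B \<in> carrier_mat N N" "B * A = 1\<^sub>m N" "A * B = 1\<^sub>m N"
    by (auto simp: Units_def ring_mat_def)
  define V where "V i j = B $$ (i - 1, j - 1)" for i j
  show ?thesis
  proof (intro exI[of _ V] conjI ballI)
    fix i k assume "i \<in> {1..N}" "k \<in> {1..N}"
    then obtain i' k' where ik: "i = Suc i'" "i' < N" "k = Suc k'" "k' < N" by (cases i; cases k) auto
    have "(A * B) $$ (i - 1, k - 1) = (\<Sum>j = 1..N. M i j * V j k)"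
      using ik A B(1) unfolding sh
      by (subst index_mult_mat(1)) (auto simp: A_def V_def scalar_prod_def atLeast0LessThan)
    then show "(\<Sum>j = 1..N. M i j * V j k) = (if i = k then 1 else 0)"
      using ik by (auto simp: B)
    have "(B * A) $$ (i - 1, k - 1) = (\<Sum>j = 1..N. V i j * M j k)"
      using ik A B(1) unfolding sh
      by (subst index_mult_mat(1)) (auto simp: A_def V_def scalar_prod_def atLeast0LessThan)
    then show "(\<Sum>j = 1..N. V i j * M j k) = (if i = k then 1 else 0)"
      using ik by (auto simp: B)
  qed
qed

lemma l2_inner_proj_from: "l2_inner (proj_from x f) g = l2_inner f (proj_from x g)"
  unfolding l2_inner_def proj_from_def by (intro Bochner_Integration.integral_cong) auto

context
  fixes N :: nat and g h :: "nat \<Rightarrow> real \<Rightarrow> complex"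
  assumes gL: "\<And>j. j \<in> {1..N} \<Longrightarrow> g j \<in> L2" and hL: "\<And>j. j \<in> {1..N} \<Longrightarrow> h j \<in> L2"
begin

lemma fin_op_L2: "fin_op N g h f \<in> L2"
  unfolding fin_op_def[abs_def] by (intro L2_sum L2_mult hL)

lemma fin_op_linear:
  assumes "f \<in> L2" "f' \<in> L2"
  shows "fin_op N g h (\<lambda>s. a * f s + b * f' s) t = a * fin_op N g h f t + b * fin_op N g h f' t"
  unfolding fin_op_def sum_distrib_left sum.distrib[symmetric]
  by (intro sum.cong refl)
     (simp add: l2_inner_add_left L2_mult assms gL l2_inner_mult_left algebra_simps)

lemma fin_op_bound:
  assumes "f \<in> L2"
  shows "l2_norm (fin_op N g h f) \<le> (\<Sum>j = 1..N. l2_norm (g j) * l2_norm (h j)) * l2_norm f"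
proof -
  have "l2_norm (fin_op N g h f) \<le> (\<Sum>j = 1..N. l2_norm (\<lambda>t. l2_inner f (g j) * h j t))"
    unfolding fin_op_def[abs_def] by (intro l2_norm_sum L2_mult hL)
  also have "\<dots> \<le> (\<Sum>j = 1..N. (l2_norm f * l2_norm (g j)) * l2_norm (h j))"
    unfolding l2_norm_mult by (intro sum_mono mult_right_mono l2_cauchy_schwarz assms gL) auto
  also have "\<dots> = (\<Sum>j = 1..N. l2_norm (g j) * l2_norm (h j)) * l2_norm f"
    by (simp add: sum_distrib_left sum_distrib_right mult_ac)
  finally show ?thesis .
qed

lemma fin_op_bounded: "bounded_op (fin_op N g h)"
  unfolding bounded_op_def using fin_op_L2 fin_op_linear fin_op_bound by blast

lemma fin_op_finite_rank: "finite_rank (fin_op N g h)"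
  unfolding finite_rank_def
proof (intro exI[of _ N] exI[of _ "\<lambda>i. h (Suc i)"] conjI allI impI ballI)
  fix f :: "real \<Rightarrow> complex" assume "f \<in> L2"
  show "\<exists>c. AE t in half_line. fin_op N g h f t = (\<Sum>i<N. c i * h (Suc i) t)"
    unfolding fin_op_def One_nat_def sum.atLeast1_atMost_eq
    by (intro exI[of _ "\<lambda>i. l2_inner f (g (Suc i))"] AE_I2 refl)
qed (auto intro: hL)

lemma fin_op_integral_operator: "integral_operator (fin_op N g h)"
  unfolding integral_operator_def
proof (intro conjI fin_op_bounded exI[of _ "\<lambda>x y. \<Sum>j = 1..N. h j x * cnj (g j y)"] ballI)
  have cnj [measurable]: "cnj \<in> borel_measurable borel"
    by (intro borel_measurable_continuous_onI continuous_intros)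
  show "(\<lambda>(x, y). \<Sum>j = 1..N. h j x * cnj (g j y)) \<in> borel_measurable (half_line \<Otimes>\<^sub>M half_line)"
    unfolding case_prod_beta
  proof (rule borel_measurable_sum)
    fix j assume j: "j \<in> {1..N}"
    note [measurable] = L2_measurable[OF gL[OF j]] L2_measurable[OF hL[OF j]]
    show "(\<lambda>p. h j (fst p) * cnj (g j (snd p))) \<in> borel_measurable (half_line \<Otimes>\<^sub>M half_line)"
      by measurable
  qed
  fix f :: "real \<Rightarrow> complex" assume f: "f \<in> L2"
  have i: "integrable half_line (\<lambda>y. h j x * (f y * cnj (g j y)))" if "j \<in> {1..N}" for j x
    using integrable_cinner[OF f gL[OF that]] by simp
  have eq: "(\<Sum>j = 1..N. h j x * cnj (g j y)) * f y = (\<Sum>j = 1..N. h j x * (f y * cnj (g j y)))" for x y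
    by (simp add: sum_distrib_left sum_distrib_right mult_ac)
  show "AE x in half_line. integrable half_line (\<lambda>y. (\<Sum>j = 1..N. h j x * cnj (g j y)) * f y) \<and>
      fin_op N g h f x = (LINT y|half_line. (\<Sum>j = 1..N. h j x * cnj (g j y)) * f y)"
  proof (intro AE_I2 conjI)
    fix x
    show "integrable half_line (\<lambda>y. (\<Sum>j = 1..N. h j x * cnj (g j y)) * f y)"
      unfolding eq by (intro Bochner_Integration.integrable_sum i)
    show "fin_op N g h f x = (LINT y|half_line. (\<Sum>j = 1..N. h j x * cnj (g j y)) * f y)"
      unfolding eq using i by (simp add: Bochner_Integration.integral_sum fin_op_def l2_inner_def mult.commute)
  qed
qed

lemma fin_op_inner: "k \<in> {1..N} \<Longrightarrow> l2_inner (fin_op N g h f) (g k) = (\<Sum>j = 1..N. l2_inner f (g j) * l2_inner (h j) (g k))"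
  unfolding fin_op_def[abs_def]
  by (subst l2_inner_sum_left) (auto simp: L2_mult hL gL l2_inner_mult_left)

text \<open>For an operator of finite rank the inverse of \<open>I - T\<close> is written down with the inverse of the matrix
  \<open>\<delta>\<^sub>i\<^sub>j - \<langle>h\<^sub>j, g\<^sub>i\<rangle>\<close>.\<close>

lemma fin_op_invertible:
  assumes c: "0 < c" and coercive: "\<And>f. f \<in> L2 \<Longrightarrow> c * (l2_norm f)\<^sup>2 \<le> Re (l2_inner (\<lambda>t. f t - fin_op N g h f t) f)"
  shows "invertible_op (\<lambda>f t. f t - fin_op N g h f t)"
proof -
  define M where "M i j = (if i = j then 1 else 0) - l2_inner (h j) (g i)" for i j
  have Msum: "(\<Sum>j = 1..N. M i j * d j) = d i - (\<Sum>j = 1..N. d j * l2_inner (h j) (g i))" if "i \<in> {1..N}" for i d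
  proof -
    have "M i j * d j = (if i = j then d j else 0) - d j * l2_inner (h j) (g i)" for j
      by (simp add: M_def algebra_simps)
    then show ?thesis using that by (simp add: sum_subtractf)
  qed
  \<comment> \<open>A kernel vector \<open>d\<close> gives a fixed vector f of the operator, the
    combination of the \<open>h j\<close> with coefficients \<open>d j\<close>, and \<open>d\<close>
    is recovered from its inner products with the \<open>g k\<close>. Coercivity forces f to have
    norm 0.\<close>
  have inj: "d i = 0" if d: "\<forall>i\<in>{1..N}. (\<Sum>j = 1..N. M i j * d j) = 0" and i: "i \<in> {1..N}" for d i
  proof -
    define f where "f t = (\<Sum>j = 1..N. d j * h j t)" for t
    have fL: "f \<in> L2" unfolding f_def[abs_def] by (intro L2_sum L2_mult hL)
    have fg: "l2_inner f (g k) = d k" if k: "k \<in> {1..N}" for k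
    proof -
      have "l2_inner f (g k) = (\<Sum>j = 1..N. d j * l2_inner (h j) (g k))"
        unfolding f_def[abs_def] by (subst l2_inner_sum_left) (auto simp: L2_mult hL gL[OF k] l2_inner_mult_left)
      then show ?thesis using Msum[OF k, of d] bspec[OF d k] by simp
    qed
    then have "fin_op N g h f = f" unfolding fin_op_def[abs_def] f_def[abs_def] by auto
    then have "c * (l2_norm f)\<^sup>2 \<le> 0" using coercive[OF fL] by simp
    then have "l2_norm f = 0" using c by (simp add: mult_le_0_iff)
    then show ?thesis using fg[OF i] l2_cauchy_schwarz[OF fL gL[OF i]] by simp
  qed
  then have "\<forall>d. (\<forall>i\<in>{1..N}. (\<Sum>j = 1..N. M i j * d j) = 0) \<longrightarrow> (\<forall>i\<in>{1..N}. d i = 0)"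
    by blast
  from matrix_inverse_exists[OF this] obtain V where
    V: "\<forall>i\<in>{1..N}. \<forall>k\<in>{1..N}. (\<Sum>j = 1..N. M i j * V j k) = (if i = k then 1 else 0)"
      "\<forall>i\<in>{1..N}. \<forall>k\<in>{1..N}. (\<Sum>j = 1..N. V i j * M j k) = (if i = k then 1 else 0)"
    by blast
  note MV = V(1)[rule_format] and VM = V(2)[rule_format]
  \<comment> \<open>Pairing the equation f - T f = w with the \<open>g i\<close> leaves a linear
    system with matrix \<open>M\<close> for the numbers <f, g k>; \<open>D w\<close> is its solution
    and \<open>R w\<close> the resulting f.\<close>
  define D where "D w k = (\<Sum>i = 1..N. V k i * l2_inner w (g i))" for w k
  define R where "R w t = w t + (\<Sum>k = 1..N. D w k * h k t)" for w t
  have MD: "(\<Sum>k = 1..N. M i k * D w k) = l2_inner w (g i)" if "i \<in> {1..N}" for i w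
  proof -
    have "(\<Sum>k = 1..N. M i k * D w k) = (\<Sum>k = 1..N. \<Sum>j = 1..N. M i k * V k j * l2_inner w (g j))"
      by (simp add: D_def sum_distrib_left mult.assoc)
    also have "\<dots> = (\<Sum>j = 1..N. \<Sum>k = 1..N. M i k * V k j * l2_inner w (g j))"
      by (rule sum.swap)
    also have "\<dots> = (\<Sum>j = 1..N. (if i = j then 1 else 0) * l2_inner w (g j))"
      unfolding sum_distrib_right[symmetric] by (intro sum.cong refl arg_cong2[of _ _ _ _ times] MV that)
    finally show ?thesis using that by (simp add: if_distrib[of "\<lambda>x. x * _"] cong: if_cong)
  qed
  \<comment> \<open>\<open>q k\<close> represents the functional sending w to \<open>D w k\<close>,
    so that Cauchy-Schwarz bounds \<open>R\<close>.\<close>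
  define q where "q k t = (\<Sum>i = 1..N. cnj (V k i) * g i t)" for k t
  have qL: "q k \<in> L2" for k unfolding q_def[abs_def] by (intro L2_sum L2_mult gL)
  have Dq: "D w k = l2_inner w (q k)" if "w \<in> L2" for w k
    unfolding D_def q_def[abs_def]
    by (subst l2_inner_sum_right) (auto simp: that L2_mult gL l2_inner_mult_right)
  have RL: "R w \<in> L2" if "w \<in> L2" for w
    unfolding R_def[abs_def] by (intro L2_add that L2_sum L2_mult hL)
  have "bounded_op R"
    unfolding bounded_op_def
  proof (intro conjI ballI allI exI[of _ "1 + (\<Sum>k = 1..N. l2_norm (q k) * l2_norm (h k))"])
    fix f f' :: "real \<Rightarrow> complex" and a b assume f: "f \<in> L2" "f' \<in> L2"
    then have "D (\<lambda>s. a * f s + b * f' s) k = a * D f k + b * D f' k" for k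
      by (simp add: Dq L2_add L2_mult l2_inner_add_left qL l2_inner_mult_left)
    then show "AE t in half_line. R (\<lambda>s. a * f s + b * f' s) t = a * R f t + b * R f' t"
      by (intro AE_I2) (simp add: R_def sum_distrib_left sum.distrib algebra_simps)
  next
    fix f :: "real \<Rightarrow> complex" assume f: "f \<in> L2"
    have "l2_norm (R f) \<le> l2_norm f + l2_norm (\<lambda>t. \<Sum>k = 1..N. D f k * h k t)"
      unfolding R_def[abs_def] by (intro l2_norm_triangle f L2_sum L2_mult hL)
    also have "l2_norm (\<lambda>t. \<Sum>k = 1..N. D f k * h k t) \<le> (\<Sum>k = 1..N. l2_norm (\<lambda>t. D f k * h k t))"
      by (intro l2_norm_sum L2_mult hL)
    also have "\<dots> \<le> (\<Sum>k = 1..N. (l2_norm f * l2_norm (q k)) * l2_norm (h k))"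
      unfolding l2_norm_mult Dq[OF f] by (intro sum_mono mult_right_mono l2_cauchy_schwarz f qL) auto
    finally show "l2_norm (R f) \<le> (1 + (\<Sum>k = 1..N. l2_norm (q k) * l2_norm (h k))) * l2_norm f"
      by (simp add: sum_distrib_left sum_distrib_right algebra_simps)
  qed (rule RL)
  moreover have "R (\<lambda>s. f s - fin_op N g h f s) t = f t" if f: "f \<in> L2" for f t
  proof -
    have "l2_inner (\<lambda>s. f s - fin_op N g h f s) (g i) = (\<Sum>j = 1..N. M i j * l2_inner f (g j))" if "i \<in> {1..N}" for i
      unfolding Msum[OF that] by (simp only: l2_inner_diff_left f fin_op_L2 gL that fin_op_inner)
    then have "D (\<lambda>s. f s - fin_op N g h f s) k = (\<Sum>i = 1..N. \<Sum>j = 1..N. V k i * M i j * l2_inner f (g j))" for k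
      unfolding D_def by (intro sum.cong refl) (simp add: sum_distrib_left mult.assoc)
    also have "\<dots> k = (\<Sum>j = 1..N. (\<Sum>i = 1..N. V k i * M i j) * l2_inner f (g j))" for k
      unfolding sum_distrib_right by (rule sum.swap)
    finally have Dk: "D (\<lambda>s. f s - fin_op N g h f s) k = (\<Sum>j = 1..N. (\<Sum>i = 1..N. V k i * M i j) * l2_inner f (g j))" for k .
    have "D (\<lambda>s. f s - fin_op N g h f s) k = l2_inner f (g k)" if k: "k \<in> {1..N}" for k
    proof -
      have "D (\<lambda>s. f s - fin_op N g h f s) k = (\<Sum>j = 1..N. (if k = j then 1 else 0) * l2_inner f (g j))"
        unfolding Dk by (intro sum.cong refl arg_cong2[of _ _ _ _ times] VM k)
      also have "\<dots> = l2_inner f (g k)"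
        using k by (simp add: if_distrib[of "\<lambda>x. x * _"] cong: if_cong)
      finally show ?thesis .
    qed
    then show ?thesis by (simp add: R_def fin_op_def)
  qed
  moreover have "R w t - fin_op N g h (R w) t = w t" if w: "w \<in> L2" for w t
  proof -
    have "l2_inner (R w) (g j) = D w j" if j: "j \<in> {1..N}" for j
    proof -
      have "l2_inner (R w) (g j) = l2_inner w (g j) + (\<Sum>k = 1..N. D w k * l2_inner (h k) (g j))"
      proof -
        have "(\<lambda>t. \<Sum>k = 1..N. D w k * h k t) \<in> L2" by (intro L2_sum L2_mult hL)
        moreover have "l2_inner (\<lambda>t. \<Sum>k = 1..N. D w k * h k t) (g j) = (\<Sum>k = 1..N. D w k * l2_inner (h k) (g j))"
          by (subst l2_inner_sum_left) (auto simp: L2_mult hL gL[OF j] l2_inner_mult_left)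
        ultimately show ?thesis
          unfolding R_def[abs_def] by (simp only: l2_inner_add_left w gL[OF j])
      qed
      then show ?thesis using Msum[OF j, of "D w"] MD[OF j, of w]
        by (simp add: diff_eq_eq)
    qed
    then show ?thesis by (simp add: R_def fin_op_def)
  qed
  ultimately show ?thesis
    unfolding invertible_op_def op_eq_def by (intro exI[of _ R]) simp
qed

text \<open>This is det (I - A B) = det (I - B A), minor by minor. On a block of n basis vectors
  Cauchy-Binet splits the minors of the operator over the subsets R of {1..N}; summing over S and
  applying the formula in reverse leaves finitely many determinants whose entries are partial
  Parseval sums, and n may tend to infinity.\<close>

lemma fin_op_det:
  assumes e: "orthonormal_basis e"
    and s: "((\<lambda>S. (- 1) ^ card S * list_det (\<lambda>i j. l2_inner (fin_op N g h (proj_from x (e j))) (e i))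
        (sorted_list_of_set S) (sorted_list_of_set S)) has_sum s) {S. finite S}"
    and en: "\<And>R. R \<subseteq> {1..N} \<Longrightarrow> distinct (en R) \<and> set (en R) = R"
  shows "s = (\<Sum>R\<in>Pow {1..N}. (- 1) ^ card R * list_det (\<lambda>k l. l2_inner (h l) (proj_from x (g k))) (en R) (en R))"
proof -
  have on: "orthonormal UNIV e" using e by (simp add: orthonormal_basis_def)
  note eL = orthonormalD(1)[OF on, simplified]
  define p where "p k = proj_from x (g k)" for k
  have pL: "p k \<in> L2" if "k \<in> {1..N}" for k unfolding p_def by (intro proj_from_L2 gL that)
  have len: "length (en R) = card R" if "R \<subseteq> {1..N}" for R
    using en[OF that] by (metis distinct_card)
  have sl: "distinct (sorted_list_of_set S) \<and> set (sorted_list_of_set S) = S" if "S \<subseteq> {..<n}" for S :: "nat set" and n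
    using that finite_subset[OF that] by auto
  have ent: "l2_inner (fin_op N g h (proj_from x (e j))) (e i) =
      (\<Sum>k = 1..N. l2_inner (h k) (e i) * l2_inner (e j) (p k))" for i j
  proof -
    have "l2_inner (fin_op N g h (proj_from x (e j))) (e i) =
        (\<Sum>k = 1..N. l2_inner (e j) (p k) * l2_inner (h k) (e i))"
      unfolding fin_op_def[abs_def]
      by (subst l2_inner_sum_left)
         (auto simp: L2_mult hL eL l2_inner_mult_left l2_inner_proj_from p_def)
    then show ?thesis by (simp only: mult.commute)
  qed
  define A where "A S R = list_det (\<lambda>i k. l2_inner (h k) (e i)) (sorted_list_of_set S) (en R)" for S R
  define B where "B S R = list_det (\<lambda>k j. l2_inner (e j) (p k)) (en R) (sorted_list_of_set S)" for S R
  have "(\<Sum>S\<in>Pow {..<n}. (- 1) ^ card S * list_det (\<lambda>i j. l2_inner (fin_op N g h (proj_from x (e j))) (e i))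
        (sorted_list_of_set S) (sorted_list_of_set S)) =
      (\<Sum>R\<in>Pow {1..N}. (- 1) ^ card R * list_det (\<lambda>k l. \<Sum>j<n. l2_inner (h l) (e j) * l2_inner (e j) (p k)) (en R) (en R))" for n
  proof -
    have "(\<Sum>S\<in>Pow {..<n}. (- 1) ^ card S * list_det (\<lambda>i j. l2_inner (fin_op N g h (proj_from x (e j))) (e i))
        (sorted_list_of_set S) (sorted_list_of_set S)) =
      (\<Sum>S\<in>Pow {..<n}. \<Sum>R | R \<in> Pow {1..N} \<and> card R = card S. (- 1) ^ card S * (A S R * B S R))"
    proof (intro sum.cong refl)
      fix S assume "S \<in> Pow {..<n}"
      then have "finite S" by (auto intro: finite_subset)
      then show "(- 1) ^ card S * list_det (\<lambda>i j. l2_inner (fin_op N g h (proj_from x (e j))) (e i))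
          (sorted_list_of_set S) (sorted_list_of_set S) =
          (\<Sum>R | R \<in> Pow {1..N} \<and> card R = card S. (- 1) ^ card S * (A S R * B S R))"
        unfolding ent A_def B_def by (subst cauchy_binet[where en = en]) (simp_all add: en sum_distrib_left)
    qed
    also have "\<dots> = (\<Sum>R\<in>Pow {1..N}. \<Sum>S | S \<in> Pow {..<n} \<and> card R = card S. (- 1) ^ card S * (A S R * B S R))"
      by (intro sum.swap_restrict) auto
    also have "\<dots> = (\<Sum>R\<in>Pow {1..N}. (- 1) ^ card R * list_det (\<lambda>k l. \<Sum>j<n. l2_inner (h l) (e j) * l2_inner (e j) (p k)) (en R) (en R))"
    proof (intro sum.cong refl)
      fix R assume "R \<in> Pow {1..N}"
      then have R: "R \<subseteq> {1..N}" by simp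
      have "list_det (\<lambda>k l. \<Sum>j\<in>{..<n}. l2_inner (e j) (p k) * l2_inner (h l) (e j)) (en R) (en R) =
          (\<Sum>S | S \<subseteq> {..<n} \<and> card S = length (en R).
            B S R * list_det (\<lambda>j l. l2_inner (h l) (e j)) (sorted_list_of_set S) (en R))"
        unfolding B_def by (rule cauchy_binet) (auto dest: sl)
      also have "\<dots> = (\<Sum>S | S \<in> Pow {..<n} \<and> card R = card S. A S R * B S R)"
        using len[OF R] by (intro sum.cong) (auto simp: A_def)
      finally show "(\<Sum>S | S \<in> Pow {..<n} \<and> card R = card S. (- 1) ^ card S * (A S R * B S R)) =
          (- 1) ^ card R * list_det (\<lambda>k l. \<Sum>j<n. l2_inner (h l) (e j) * l2_inner (e j) (p k)) (en R) (en R)"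
        by (simp add: sum_distrib_left mult.commute)
    qed
    finally show ?thesis .
  qed
  with has_sum_Pow_lessThan[OF s] have
    "(\<lambda>n. \<Sum>R\<in>Pow {1..N}. (- 1) ^ card R * list_det (\<lambda>k l. \<Sum>j<n. l2_inner (h l) (e j) * l2_inner (e j) (p k)) (en R) (en R)) \<longlonglongrightarrow> s"
    by simp
  moreover have "(\<lambda>n. \<Sum>R\<in>Pow {1..N}. (- 1) ^ card R * list_det (\<lambda>k l. \<Sum>j<n. l2_inner (h l) (e j) * l2_inner (e j) (p k)) (en R) (en R)) \<longlonglongrightarrow>
      (\<Sum>R\<in>Pow {1..N}. (- 1) ^ card R * list_det (\<lambda>k l. l2_inner (h l) (p k)) (en R) (en R))"
  proof (intro tendsto_intros list_det_tendsto parseval[OF e])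
    fix R k assume "R \<in> Pow {1..N}" "k \<in> set (en R)"
    then have "k \<in> {1..N}" using en[of R] by auto
    then show "h k \<in> L2" "p k \<in> L2" by (auto intro: hL pL)
  qed auto
  ultimately show ?thesis unfolding p_def by (rule LIMSEQ_unique)
qed

end

subsection \<open>Exponential symbols\<close>

lemma l2_inner_exp_proj:
  assumes "0 < Re a" "0 < Re b" "0 \<le> x"
  shows "l2_inner (\<lambda>t. exp (- a * of_real t)) (proj_from x (\<lambda>t. exp (- b * of_real t))) =
    exp (- (a + cnj b) * of_real x) / (a + cnj b)"
proof -
  have "l2_inner (\<lambda>t. exp (- a * of_real t)) (proj_from x (\<lambda>t. exp (- b * of_real t))) =
      (LINT t|half_line. (if x \<le> t then exp (- (a + cnj b) * of_real t) else 0))"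
    unfolding l2_inner_def proj_from_def
    by (intro Bochner_Integration.integral_cong)
       (auto simp: exp_cnj mult_exp_exp algebra_simps)
  also have "\<dots> = exp (- (a + cnj b) * of_real x) / (a + cnj b)"
    by (rule integral_exp_half_line) (use assms in auto)
  finally show ?thesis .
qed

lemma l2_inner_exp:
  assumes "0 < Re a" "0 < Re b"
  shows "l2_inner (\<lambda>t. exp (- a * of_real t)) (\<lambda>t. exp (- b * of_real t)) = 1 / (a + cnj b)"
proof -
  have "l2_inner (\<lambda>t. exp (- a * of_real t)) (\<lambda>t. exp (- b * of_real t)) =
      l2_inner (\<lambda>t. exp (- a * of_real t)) (proj_from 0 (\<lambda>t. exp (- b * of_real t)))"
    by (rule l2_inner_cong) (auto simp: proj_from_0)
  then show ?thesis using l2_inner_exp_proj[OF assms, of 0] by simp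
qed

lemma L2_scaleC_vector:
  assumes "a \<in> L2" shows "(\<lambda>t. a t *\<^sub>C y) \<in> L2"
  using assms by (auto simp: L2_def norm_scaleC power_mult_distrib)

locale exp_symbol_data =
  fixes N \<nu> :: nat and e :: "nat \<Rightarrow> 'e::{complex_hilbert_space, second_countable_topology}"
    and lam :: "nat \<Rightarrow> complex" and \<xi> :: "nat \<Rightarrow> nat \<Rightarrow> complex"
  assumes lam: "\<And>j. j \<in> {1..N} \<Longrightarrow> 0 < Re (lam j)"
    and e_orthonormal: "\<And>r s. r \<in> {1..\<nu>} \<Longrightarrow> s \<in> {1..\<nu>} \<Longrightarrow> cinner (e r) (e s) = (if r = s then 1 else 0)"
begin

text \<open>The Hankel operator \<open>\<Gamma>\<close> of this symbol is \<open>f \<mapsto> \<Sum>\<langle>f, eps j\<rangle> w j\<close>; hence \<open>T = \<Gamma>\<^sup>\<dagger> \<Gamma>\<close>, and \<open>gram\<close> is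
  the Gram matrix of the functions \<open>w j\<close>.\<close>

definition \<rho> where "\<rho> j = row_adjoint \<nu> e (\<xi> j)"

definition eps where "eps j t = exp (- lam j * complex_of_real t)"

definition w where "w j t = exp (- cnj (lam j) * complex_of_real t) *\<^sub>C \<rho> j"

definition gram where "gram i j = (\<Sum>r = 1..\<nu>. cnj (\<xi> i r) * \<xi> j r) / (cnj (lam i) + lam j)"

text \<open>\<open>g j\<close> is the adjoint of the Hankel operator applied to
  \<open>w j\<close>.\<close>

definition g where "g j t = (\<Sum>i = 1..N. cnj (gram i j) * eps i t)"

definition T where "T = fin_op N g eps"

lemma eps_L2: "j \<in> {1..N} \<Longrightarrow> eps j \<in> L2"
  unfolding eps_def[abs_def] by (rule L2_exp) (rule lam)

lemma w_L2: "j \<in> {1..N} \<Longrightarrow> w j \<in> L2"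
  unfolding w_def[abs_def] by (intro L2_scaleC_vector L2_exp) (simp add: lam)

lemma g_L2: "g j \<in> L2"
  unfolding g_def[abs_def] by (intro L2_sum L2_mult eps_L2)

lemma exp_symbol_eq: "exp_symbol N \<nu> e lam \<xi> t = (\<Sum>j = 1..N. w j t)"
  by (simp add: exp_symbol_def w_def \<rho>_def)

lemma cinner_\<rho>: "cinner (\<rho> i) (\<rho> j) = (\<Sum>r = 1..\<nu>. cnj (\<xi> i r) * \<xi> j r)"
proof -
  have "cinner (\<rho> i) (\<rho> j) = (\<Sum>r = 1..\<nu>. \<Sum>s = 1..\<nu>. cnj (\<xi> i r) * \<xi> j s * cinner (e r) (e s))"
    unfolding \<rho>_def row_adjoint_def cinner_sum_left cinner_sum_right
    by (simp add: cinner_scaleC_left cinner_scaleC_right mult_ac) (rule sum.swap)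
  also have "\<dots> = (\<Sum>r = 1..\<nu>. \<Sum>s = 1..\<nu>. if r = s then cnj (\<xi> i r) * \<xi> j s else 0)"
    by (intro sum.cong refl) (auto simp: e_orthonormal)
  also have "\<dots> = (\<Sum>r = 1..\<nu>. cnj (\<xi> i r) * \<xi> j r)"
    by (intro sum.cong refl) simp
  finally show ?thesis .
qed

lemma w_inner:
  assumes i: "i \<in> {1..N}" and j: "j \<in> {1..N}"
  shows "l2_inner (w i) (w j) = gram i j"
proof -
  have "l2_inner (w i) (w j) = (LINT t|half_line. cinner (exp (- cnj (lam i) * complex_of_real t))
      (exp (- cnj (lam j) * complex_of_real t)) * cinner (\<rho> i) (\<rho> j))"
    unfolding l2_inner_def w_def by (simp add: cinner_scaleC_left cinner_scaleC_right mult_ac)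
  also have "\<dots> = l2_inner (\<lambda>t. exp (- cnj (lam i) * complex_of_real t)) (\<lambda>t. exp (- cnj (lam j) * complex_of_real t)) *
      cinner (\<rho> i) (\<rho> j)"
  proof -
    have "(\<lambda>t. exp (- cnj (lam k) * complex_of_real t)) \<in> L2" if "k \<in> {1..N}" for k
      using that by (intro L2_exp) (simp add: lam)
    note L = this
    show ?thesis
      unfolding l2_inner_def by (rule Bochner_Integration.integral_mult_left, rule integrable_cinner[OF L[OF i] L[OF j]])
  qed
  also have "\<dots> = gram i j"
    by (subst l2_inner_exp) (use lam[OF i] lam[OF j] in \<open>auto simp: cinner_\<rho> gram_def\<close>)
  finally show ?thesis .
qed

text \<open>An exponential of x + y factorises, and the factor in y is the conjugate of
  \<open>eps j\<close>, so the integral over y is an inner product.\<close>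

lemma hankel_exp_symbol:
  assumes "f \<in> L2"
  shows "hankel (exp_symbol N \<nu> e lam \<xi>) f = (\<lambda>x. \<Sum>j = 1..N. l2_inner f (eps j) *\<^sub>C w j x)"
proof
  fix x
  have i: "integrable half_line (\<lambda>y. cinner (f y) (eps j y))" if "j \<in> {1..N}" for j
    by (intro integrable_cinner assms eps_L2 that)
  have i': "integrable half_line (\<lambda>y. cinner (f y) (eps j y) *\<^sub>C w j x)" if "j \<in> {1..N}" for j
    using integrable_bounded_linear[OF bounded_bilinear.bounded_linear_left[OF bounded_bilinear_scaleC] i[OF that]] .
  have "f y *\<^sub>C exp_symbol N \<nu> e lam \<xi> (x + y) = (\<Sum>j = 1..N. cinner (f y) (eps j y) *\<^sub>C w j x)" for y
    unfolding exp_symbol_eq scaleC_sum_right w_def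
    by (intro sum.cong refl)
       (simp add: scaleC_scaleC eps_def exp_cnj mult_exp_exp algebra_simps)
  then have "hankel (exp_symbol N \<nu> e lam \<xi>) f x = (LINT y|half_line. (\<Sum>j = 1..N. cinner (f y) (eps j y) *\<^sub>C w j x))"
    unfolding hankel_def by simp
  also have "\<dots> = (\<Sum>j = 1..N. (LINT y|half_line. cinner (f y) (eps j y) *\<^sub>C w j x))"
    by (intro Bochner_Integration.integral_sum i')
  also have "\<dots> = (\<Sum>j = 1..N. l2_inner f (eps j) *\<^sub>C w j x)"
    unfolding l2_inner_def by (intro sum.cong refl integral_scaleC_left i)
  finally show "hankel (exp_symbol N \<nu> e lam \<xi>) f x = (\<Sum>j = 1..N. l2_inner f (eps j) *\<^sub>C w j x)" .
qed

lemma T_hankel_square: "is_hankel_square T (exp_symbol N \<nu> e lam \<xi>)"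
proof -
  define B where "B u t = (\<Sum>j = 1..N. l2_inner u (w j) * eps j t)" for u t
  have HL: "hankel (exp_symbol N \<nu> e lam \<xi>) h \<in> L2" if "h \<in> L2" for h
    unfolding hankel_exp_symbol[OF that] by (intro L2_sum L2_scaleC w_L2)
  have BL: "B u \<in> L2" for u
    unfolding B_def[abs_def] by (intro L2_sum L2_mult eps_L2)
  have "l2_inner (hankel (exp_symbol N \<nu> e lam \<xi>) h) u = l2_inner h (B u)" if h: "h \<in> L2" and u: "u \<in> L2" for h u
  proof -
    have "l2_inner (hankel (exp_symbol N \<nu> e lam \<xi>) h) u = (\<Sum>j = 1..N. l2_inner h (eps j) * l2_inner (w j) u)"
      unfolding hankel_exp_symbol[OF h]
      by (subst l2_inner_sum_left) (auto simp: L2_scaleC w_L2 u l2_inner_scaleC_left)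
    also have "\<dots> = (\<Sum>j = 1..N. cnj (l2_inner u (w j)) * l2_inner h (eps j))"
      by (intro sum.cong refl) (simp add: l2_inner_commute[symmetric] mult.commute)
    also have "\<dots> = l2_inner h (B u)"
      unfolding B_def[abs_def]
      by (subst l2_inner_sum_right) (auto simp: L2_mult eps_L2 h l2_inner_mult_right)
    finally show ?thesis .
  qed
  then have "is_adjoint (hankel (exp_symbol N \<nu> e lam \<xi>)) B"
    unfolding is_adjoint_def using HL BL by blast
  moreover have "T f t = B (hankel (exp_symbol N \<nu> e lam \<xi>) f) t" if f: "f \<in> L2" for f t
  proof -
    have "l2_inner (hankel (exp_symbol N \<nu> e lam \<xi>) f) (w j) = l2_inner f (g j)" if j: "j \<in> {1..N}" for j
    proof -
      have "l2_inner (hankel (exp_symbol N \<nu> e lam \<xi>) f) (w j) = (\<Sum>i = 1..N. l2_inner f (eps i) * gram i j)"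
        unfolding hankel_exp_symbol[OF f]
        by (subst l2_inner_sum_left) (use j in \<open>auto simp: L2_scaleC w_L2 l2_inner_scaleC_left w_inner\<close>)
      also have "\<dots> = (\<Sum>i = 1..N. gram i j * l2_inner f (eps i))" by (simp only: mult.commute)
      also have "\<dots> = l2_inner f (g j)"
        unfolding g_def[abs_def]
        by (subst l2_inner_sum_right) (auto simp: L2_mult eps_L2 f l2_inner_mult_right)
      finally show ?thesis .
    qed
    then show ?thesis by (simp add: T_def fin_op_def B_def)
  qed
  ultimately show ?thesis
    unfolding is_hankel_square_def op_eq_def by (intro exI[of _ B]) simp
qed

section \<open>The determinant expansion for an exponential symbol\<close>

definition row_enum where "row_enum S = filter (\<lambda>j. j \<in> S) [1..<Suc N]"

definition col_enum where "col_enum Q = filter (\<lambda>p. p \<in> Q) (List.product [1..<Suc N] [1..<Suc \<nu>])"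

definition entryA where "entryA x j = (\<lambda>(k, r). \<xi> j r * exp (- lam j * complex_of_real x) / (lam j + cnj (lam k)))"

definition entryB where "entryB x m = (\<lambda>(k, r). cnj (\<xi> k r) * exp (- cnj (lam k) * complex_of_real x) / (lam m + cnj (lam k)))"

lemma row_enum: "S \<subseteq> {1..N} \<Longrightarrow> distinct (row_enum S) \<and> set (row_enum S) = S"
  by (auto simp: row_enum_def)

lemma col_enum: "Q \<subseteq> {1..N} \<times> {1..\<nu>} \<Longrightarrow> distinct (col_enum Q) \<and> set (col_enum Q) = Q"
  by (auto simp: col_enum_def distinct_product simp del: upt_Suc)

lemma length_row_enum: "S \<subseteq> {1..N} \<Longrightarrow> length (row_enum S) = card S"
  using row_enum by (metis distinct_card)

lemma length_col_enum: "Q \<subseteq> {1..N} \<times> {1..\<nu>} \<Longrightarrow> length (col_enum Q) = card Q"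
  using col_enum by (metis distinct_card)

lemma det_term_eq: "det_term N \<nu> lam \<xi> (S, Q) x =
  (- 1) ^ card S * list_det (entryA x) (row_enum S) (col_enum Q) * list_det (entryB x) (row_enum S) (col_enum Q)"
  unfolding det_term_def row_enum_def col_enum_def entryA_def entryB_def by (simp add: Let_def)

text \<open>The outer exponential factors, needed to recover the entries of \<open>det_term\<close>, cancel in
  principal minors.\<close>

lemma minor_entry:
  assumes k: "k \<in> {1..N}" and l: "l \<in> {1..N}" and x: "0 \<le> x"
  shows "l2_inner (eps l) (proj_from x (g k)) =
    exp (lam k * of_real x) * (\<Sum>p\<in>{1..N} \<times> {1..\<nu>}. entryA x k p * entryB x l p) * exp (- lam l * of_real x)"
proof -
  have "l2_inner (eps l) (proj_from x (g k)) = l2_inner (eps l) (\<lambda>t. \<Sum>i = 1..N. cnj (gram i k) * proj_from x (eps i) t)"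
    by (rule l2_inner_cong) (auto simp: proj_from_def g_def)
  also have "\<dots> = (\<Sum>i = 1..N. gram i k * l2_inner (eps l) (proj_from x (eps i)))"
    by (subst l2_inner_sum_right) (auto simp: L2_mult proj_from_L2 eps_L2 eps_L2[OF l] l2_inner_mult_right)
  also have "\<dots> = (\<Sum>i = 1..N. gram i k * (exp (- (lam l + cnj (lam i)) * of_real x) / (lam l + cnj (lam i))))"
    unfolding eps_def[abs_def] using lam l x by (intro sum.cong refl, subst l2_inner_exp_proj) auto
  also have "\<dots> = (\<Sum>i = 1..N. \<Sum>r = 1..\<nu>. (\<xi> k r / (lam k + cnj (lam i))) *
      (cnj (\<xi> i r) * exp (- cnj (lam i) * of_real x) / (lam l + cnj (lam i))) * exp (- lam l * of_real x))"
  proof (intro sum.cong refl)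
    fix i
    have E: "exp (- (lam l + cnj (lam i)) * of_real x) = exp (- cnj (lam i) * of_real x) * exp (- lam l * of_real x)"
      by (simp add: mult_exp_exp algebra_simps)
    show "gram i k * (exp (- (lam l + cnj (lam i)) * of_real x) / (lam l + cnj (lam i))) =
        (\<Sum>r = 1..\<nu>. (\<xi> k r / (lam k + cnj (lam i))) *
          (cnj (\<xi> i r) * exp (- cnj (lam i) * of_real x) / (lam l + cnj (lam i))) * exp (- lam l * of_real x))"
      unfolding gram_def sum_divide_distrib sum_distrib_right E
      by (intro sum.cong refl) (simp only: divide_inverse add.commute[of "cnj (lam i)" "lam k"] mult_ac)
  qed
  also have "\<dots> = (\<Sum>i = 1..N. \<Sum>r = 1..\<nu>. exp (lam k * of_real x) * (entryA x k (i, r) * entryB x l (i, r)) * exp (- lam l * of_real x))"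
  proof (intro sum.cong refl)
    fix i r
    have "entryA x k (i, r) = exp (- (lam k * of_real x)) * (\<xi> k r / (lam k + cnj (lam i)))"
      by (simp add: entryA_def)
    then have "exp (lam k * of_real x) * entryA x k (i, r) = \<xi> k r / (lam k + cnj (lam i))"
      by (simp add: mult_exp_exp flip: mult.assoc)
    then show "\<xi> k r / (lam k + cnj (lam i)) *
      (cnj (\<xi> i r) * exp (- cnj (lam i) * of_real x) / (lam l + cnj (lam i))) * exp (- lam l * of_real x) =
      exp (lam k * of_real x) * (entryA x k (i, r) * entryB x l (i, r)) * exp (- lam l * of_real x)"
      by (simp add: entryB_def flip: mult.assoc)
  qed
  also have "\<dots> = (\<Sum>p\<in>{1..N} \<times> {1..\<nu>}. exp (lam k * of_real x) * (entryA x k p * entryB x l p) * exp (- lam l * of_real x))"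
    by (simp add: sum.cartesian_product case_prod_beta)
  also have "\<dots> = exp (lam k * of_real x) * (\<Sum>p\<in>{1..N} \<times> {1..\<nu>}. entryA x k p * entryB x l p) * exp (- lam l * of_real x)"
    by (simp only: sum_distrib_left sum_distrib_right)
  finally show ?thesis .
qed

text \<open>By \<open>minor_entry\<close> the matrix is, up to row and column factors, a product
  through the pairs (k, r). Cauchy-Binet therefore splits the minor on R over the sets Q of pairs
  with as many elements as R, and these (R, Q) make up \<open>det_pairs\<close>.\<close>

lemma sum_det_term:
  assumes x: "0 \<le> x"
  shows "(\<Sum>R\<in>Pow {1..N}. (- 1) ^ card R * list_det (\<lambda>k l. l2_inner (eps l) (proj_from x (g k))) (row_enum R) (row_enum R)) =
    (\<Sum>p\<in>det_pairs N \<nu>. det_term N \<nu> lam \<xi> p x)"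
proof -
  define P where "P = {1..N} \<times> {1..\<nu>}"
  have "(\<Sum>R\<in>Pow {1..N}. (- 1) ^ card R * list_det (\<lambda>k l. l2_inner (eps l) (proj_from x (g k))) (row_enum R) (row_enum R)) =
      (\<Sum>R\<in>Pow {1..N}. \<Sum>Q | Q \<subseteq> P \<and> card Q = card R. det_term N \<nu> lam \<xi> (R, Q) x)"
  proof (intro sum.cong refl)
    fix R assume "R \<in> Pow {1..N}"
    then have R: "R \<subseteq> {1..N}" by simp
    note r = row_enum[OF R] length_row_enum[OF R]
    have "list_det (\<lambda>k l. l2_inner (eps l) (proj_from x (g k))) (row_enum R) (row_enum R) =
        list_det (\<lambda>k l. exp (lam k * of_real x) * (\<Sum>p\<in>P. entryA x k p * entryB x l p) * exp (- lam l * of_real x)) (row_enum R) (row_enum R)"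
      unfolding P_def by (intro list_det_cong minor_entry x) (use r R in auto)
    also have "\<dots> = (\<Prod>k<length (row_enum R). exp (lam (row_enum R ! k) * of_real x)) * (\<Prod>k<length (row_enum R). exp (- lam (row_enum R ! k) * of_real x)) *
        list_det (\<lambda>k l. \<Sum>p\<in>P. entryA x k p * entryB x l p) (row_enum R) (row_enum R)"
      by (rule list_det_scale) simp
    also have "(\<Prod>k<length (row_enum R). exp (lam (row_enum R ! k) * of_real x)) * (\<Prod>k<length (row_enum R). exp (- lam (row_enum R ! k) * of_real x)) = 1"
      unfolding prod.distrib[symmetric] by (simp add: mult_exp_exp)
    also have "1 * list_det (\<lambda>k l. \<Sum>p\<in>P. entryA x k p * entryB x l p) (row_enum R) (row_enum R) =
        (\<Sum>Q | Q \<subseteq> P \<and> card Q = length (row_enum R).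
          list_det (entryA x) (row_enum R) (col_enum Q) * list_det (\<lambda>p l. entryB x l p) (col_enum Q) (row_enum R))"
      unfolding mult_1 by (rule cauchy_binet) (simp_all add: P_def col_enum)
    also have "\<dots> = (\<Sum>Q | Q \<subseteq> P \<and> card Q = card R.
          list_det (entryA x) (row_enum R) (col_enum Q) * list_det (entryB x) (row_enum R) (col_enum Q))"
    proof (intro sum.cong arg_cong2[of _ _ _ _ times] refl)
      fix Q assume "Q \<in> {Q. Q \<subseteq> P \<and> card Q = card R}"
      then have "length (col_enum Q) = length (row_enum R)" using length_col_enum[of Q] r(2) by (simp add: P_def)
      then show "list_det (\<lambda>p l. entryB x l p) (col_enum Q) (row_enum R) = list_det (entryB x) (row_enum R) (col_enum Q)"
        by (subst list_det_transpose) auto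
    qed (simp_all add: r(2))
    finally show "(- 1) ^ card R * list_det (\<lambda>k l. l2_inner (eps l) (proj_from x (g k))) (row_enum R) (row_enum R) =
        (\<Sum>Q | Q \<subseteq> P \<and> card Q = card R. det_term N \<nu> lam \<xi> (R, Q) x)"
      by (simp add: det_term_eq sum_distrib_left mult.assoc)
  qed
  also have "\<dots> = (\<Sum>p\<in>(SIGMA R:Pow {1..N}. {Q. Q \<subseteq> P \<and> card Q = card R}). det_term N \<nu> lam \<xi> p x)"
    by (subst sum.Sigma) (auto simp: P_def)
  also have "(SIGMA R:Pow {1..N}. {Q. Q \<subseteq> P \<and> card Q = card R}) = det_pairs N \<nu>"
    by (auto simp: det_pairs_def P_def)
  finally show ?thesis .
qed

text \<open>In the first determinant the dependence on x is a row factor, in the second a column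
  factor; both can be pulled out.\<close>

lemma det_term_exponential:
  assumes "S \<subseteq> {1..N}" "Q \<subseteq> {1..N} \<times> {1..\<nu>}" "card S = card Q"
  shows "det_term N \<nu> lam \<xi> (S, Q) x = det_term N \<nu> lam \<xi> (S, Q) 0 *
    exp (- ((\<Sum>j\<in>S. lam j) + (\<Sum>(k, r)\<in>Q. cnj (lam k))) * of_real x)"
proof -
  note r = row_enum[OF assms(1)] length_row_enum[OF assms(1)] col_enum[OF assms(2)] length_col_enum[OF assms(2)]
  have fin: "finite S" "finite Q" using assms finite_subset by blast+
  have len: "length (row_enum S) = length (col_enum Q)" using r assms(3) by simp
  have "list_det (entryA x) (row_enum S) (col_enum Q) = list_det (\<lambda>j p. exp (- lam j * of_real x) * entryA 0 j p * 1) (row_enum S) (col_enum Q)"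
    by (intro list_det_cong len) (auto simp: entryA_def)
  also have "\<dots> = (\<Prod>j\<in>S. exp (- lam j * of_real x)) * list_det (entryA 0) (row_enum S) (col_enum Q)"
    by (subst list_det_scale[OF len]) (use r prod_nth_distinct[of "row_enum S" "\<lambda>j. exp (- lam j * of_real x)"] in simp)
  finally have A: "list_det (entryA x) (row_enum S) (col_enum Q) = \<dots>" .
  have "list_det (entryB x) (row_enum S) (col_enum Q) =
      list_det (\<lambda>j p. 1 * entryB 0 j p * (case p of (k, r) \<Rightarrow> exp (- cnj (lam k) * of_real x))) (row_enum S) (col_enum Q)"
    by (intro list_det_cong len) (auto simp: entryB_def)
  also have "\<dots> = (\<Prod>(k, r)\<in>Q. exp (- cnj (lam k) * of_real x)) * list_det (entryB 0) (row_enum S) (col_enum Q)"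
    by (subst list_det_scale[OF len])
       (use len r prod_nth_distinct[of "col_enum Q" "\<lambda>(k, r). exp (- cnj (lam k) * of_real x)"] in simp)
  finally have B: "list_det (entryB x) (row_enum S) (col_enum Q) = \<dots>" .
  have "(\<Prod>j\<in>S. exp (- lam j * of_real x)) * (\<Prod>(k, r)\<in>Q. exp (- cnj (lam k) * of_real x)) =
      exp (- ((\<Sum>j\<in>S. lam j) + (\<Sum>(k, r)\<in>Q. cnj (lam k))) * of_real x)"
    using fin by (simp add: exp_sum[symmetric] case_prod_beta mult_exp_exp sum_negf sum_distrib_right distrib_right left_diff_distrib)
  then show ?thesis unfolding det_term_eq A B by (simp add: mult_ac)
qed

text \<open>The pair of empty sets contributes the constant 1. In any other pair the equal
  cardinalities force S to be nonempty, so the exponent has positive real part: S contributes a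
  positive amount and Q a nonnegative one. The coefficients are the terms at x = 0.\<close>

lemma det_pairs_expansion:
  "\<exists>M p a \<mu>. bij_betw p {1..M::nat} (det_pairs N \<nu> - {({}, {})}) \<and>
    (\<forall>j\<in>{1..M}. 0 < Re (\<mu> j) \<and> (\<forall>x. det_term N \<nu> lam \<xi> (p j) x = a j * exp (- \<mu> j * of_real x))) \<and>
    (\<forall>x. (\<Sum>p\<in>det_pairs N \<nu>. det_term N \<nu> lam \<xi> p x) = 1 + (\<Sum>j = 1..M. a j * exp (- \<mu> j * of_real x)))"
proof -
  define D where "D = det_pairs N \<nu> - {({}, {})}"
  have finD: "finite (det_pairs N \<nu>)"
    by (rule finite_subset[of _ "Pow {1..N} \<times> Pow ({1..N} \<times> {1..\<nu>})"]) (auto simp: det_pairs_def)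
  then have "finite D" by (simp add: D_def)
  from ex_bij_betw_nat_finite_1[OF this] obtain p where p: "bij_betw p {1..card D} D" by blast
  define \<mu> where "\<mu> j = (case p j of (S, Q) \<Rightarrow> (\<Sum>j\<in>S. lam j) + (\<Sum>(k, r)\<in>Q. cnj (lam k)))" for j
  define a where "a j = det_term N \<nu> lam \<xi> (p j) 0" for j
  have *: "0 < Re (\<mu> j) \<and> (\<forall>x. det_term N \<nu> lam \<xi> (p j) x = a j * exp (- \<mu> j * of_real x))" if "j \<in> {1..card D}" for j
  proof -
    obtain S Q where SQ: "p j = (S, Q)" by fastforce
    have "(S, Q) \<in> D" using bij_betwE[OF p] that SQ by force
    then have S: "S \<subseteq> {1..N}" "Q \<subseteq> {1..N} \<times> {1..\<nu>}" "card S = card Q" "S \<noteq> {} \<or> Q \<noteq> {}"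
      by (auto simp: D_def det_pairs_def)
    have fin: "finite S" "finite Q" using S finite_subset by blast+
    then have "S \<noteq> {}" using S(3,4) by auto
    then have "0 < (\<Sum>j\<in>S. Re (lam j))"
      using fin S lam by (intro sum_pos) auto
    moreover have "0 \<le> (\<Sum>(k, r)\<in>Q. Re (lam k))"
    proof (rule sum_nonneg)
      fix p assume "p \<in> Q"
      then have "fst p \<in> {1..N}" using S(2) by auto
      then show "0 \<le> (case p of (k, r) \<Rightarrow> Re (lam k))" using lam by (auto simp: case_prod_beta intro: less_imp_le)
    qed
    ultimately have "0 < Re (\<mu> j)" by (simp add: \<mu>_def SQ case_prod_beta)
    moreover have "det_term N \<nu> lam \<xi> (p j) x = a j * exp (- \<mu> j * of_real x)" for x
      unfolding \<mu>_def a_def SQ prod.case by (rule det_term_exponential[OF S(1-3)])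
    ultimately show ?thesis by blast
  qed
  have "(\<Sum>p\<in>det_pairs N \<nu>. det_term N \<nu> lam \<xi> p x) = 1 + (\<Sum>j = 1..card D. a j * exp (- \<mu> j * of_real x))" for x
  proof -
    have "({}, {}) \<in> det_pairs N \<nu>" by (simp add: det_pairs_def)
    then have "(\<Sum>p\<in>det_pairs N \<nu>. det_term N \<nu> lam \<xi> p x) = det_term N \<nu> lam \<xi> ({}, {}) x + (\<Sum>p\<in>D. det_term N \<nu> lam \<xi> p x)"
      unfolding D_def using finD by (intro sum.remove)
    also have "det_term N \<nu> lam \<xi> ({}, {}) x = 1"
      by (simp add: det_term_eq row_enum_def col_enum_def list_det_def)
    also have "(\<Sum>p\<in>D. det_term N \<nu> lam \<xi> p x) = (\<Sum>j = 1..card D. det_term N \<nu> lam \<xi> (p j) x)"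
      by (rule sum.reindex_bij_betw[OF p, symmetric])
    also have "\<dots> = (\<Sum>j = 1..card D. a j * exp (- \<mu> j * of_real x))"
      using * by (intro sum.cong refl) auto
    finally show ?thesis .
  qed
  then show ?thesis using p * unfolding D_def[symmetric] by blast
qed

end

subsection \<open>Squares of Hankel operators\<close>

definition hankel_symbol :: "(real \<Rightarrow> 'e::{complex_hilbert_space, second_countable_topology}) \<Rightarrow> bool"
  where "hankel_symbol \<phi> \<longleftrightarrow> \<phi> \<in> borel_measurable half_line \<and> hankel_weight \<phi> \<in> L2"

lemma hankel_symbol_diff:
  assumes "hankel_symbol \<phi>" "hankel_symbol \<psi>"
  shows "hankel_symbol (\<lambda>t. \<phi> t - \<psi> t)"
    and "hankel_weight (\<lambda>t. \<phi> t - \<psi> t) = (\<lambda>t. hankel_weight \<phi> t - hankel_weight \<psi> t)"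
proof -
  show eq: "hankel_weight (\<lambda>t. \<phi> t - \<psi> t) = (\<lambda>t. hankel_weight \<phi> t - hankel_weight \<psi> t)"
    by (simp add: hankel_weight_def[abs_def] scaleR_diff_right)
  show "hankel_symbol (\<lambda>t. \<phi> t - \<psi> t)"
    using assms unfolding hankel_symbol_def eq by (auto intro: L2_diff)
qed

lemma hankel_symbol_L2:
  assumes "hankel_symbol \<phi>" "f \<in> L2"
  shows "hankel \<phi> f \<in> L2" "l2_norm (hankel \<phi> f) \<le> l2_norm (hankel_weight \<phi>) * l2_norm f"
  using assms hankel_L2[of \<phi> f] by (auto simp: hankel_symbol_def)

lemma hankel_diff_norm:
  assumes "hankel_symbol \<phi>" "hankel_symbol \<psi>" "f \<in> L2"
  shows "l2_norm (\<lambda>t. hankel \<phi> f t - hankel \<psi> f t) = l2_norm (hankel (\<lambda>t. \<phi> t - \<psi> t) f)"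
proof (rule l2_norm_cong_AE)
  show "AE t in half_line. hankel \<phi> f t - hankel \<psi> f t = hankel (\<lambda>t. \<phi> t - \<psi> t) f t"
    using hankel_diff[of \<phi> \<psi> f] assms by (auto simp: hankel_symbol_def)
qed (use assms hankel_symbol_diff in \<open>auto intro: L2_diff hankel_symbol_L2\<close>)

lemma orthonormal_basis_finite: "orthonormal_basis e \<Longrightarrow> orthonormal F e"
  unfolding orthonormal_basis_def using orthonormal_mono by blast

lemma orthonormal_basis_L2: "orthonormal_basis e \<Longrightarrow> e i \<in> L2"
  unfolding orthonormal_basis_def orthonormal_def by blast

lemma hs_bounded_hankel:
  assumes "hankel_symbol \<phi>" "orthonormal_basis e" "l2_norm (hankel_weight \<phi>) \<le> A"
  shows "hs_bounded A (\<lambda>i. hankel \<phi> (proj_from a (e i)))"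
proof -
  have "(\<Sum>i\<in>F. (l2_norm (hankel \<phi> (proj_from a (e i))))\<^sup>2) \<le> A\<^sup>2" if "finite F" for F
  proof -
    have "(\<Sum>i\<in>F. (l2_norm (hankel \<phi> (proj_from a (e i))))\<^sup>2) \<le> (l2_norm (hankel_weight \<phi>))\<^sup>2"
      using assms that by (intro hankel_hilbert_schmidt orthonormal_basis_finite) (auto simp: hankel_symbol_def)
    also have "\<dots> \<le> A\<^sup>2" using assms(3) by (intro power_mono) auto
    finally show ?thesis .
  qed
  moreover have "0 \<le> A" using assms(3) l2_norm_nonneg order_trans by blast
  moreover have "hankel \<phi> (proj_from a (e i)) \<in> L2" for i
    by (rule hankel_symbol_L2(1)[OF assms(1) proj_from_L2[OF orthonormal_basis_L2[OF assms(2)]]])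
  ultimately show ?thesis
    by (simp add: hs_bounded_def)
qed

lemma hs_bounded_hankel_diff:
  assumes "hankel_symbol \<phi>" "hankel_symbol \<psi>" "orthonormal_basis e"
    and "l2_norm (\<lambda>t. hankel_weight \<phi> t - hankel_weight \<psi> t) \<le> \<delta>"
  shows "hs_bounded \<delta> (\<lambda>i t. hankel \<phi> (proj_from a (e i)) t - hankel \<psi> (proj_from a (e i)) t)"
proof -
  have "hs_bounded \<delta> (\<lambda>i. hankel (\<lambda>t. \<phi> t - \<psi> t) (proj_from a (e i)))"
    using assms by (intro hs_bounded_hankel) (auto simp: hankel_symbol_diff)
  then show ?thesis
    using assms
    by (auto simp: hs_bounded_def hankel_diff_norm proj_from_L2 orthonormal_basis_L2
        intro!: L2_diff hankel_symbol_L2)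
qed

lemma trace_norm_le:
  assumes "\<And>(m::nat) e f. orthonormal {..<m} e \<Longrightarrow> orthonormal {..<m} f \<Longrightarrow>
    (\<Sum>i<m. norm (l2_inner (T (e i)) (f i))) \<le> C"
  shows "trace_norm T \<le> ennreal C"
  unfolding trace_norm_def by (intro SUP_least) (auto intro!: ennreal_leI assms)

text \<open>The quantitative form of the fact that a product of two Hilbert-Schmidt operators is of
  trace class.\<close>

lemma hankel_trace_sum:
  assumes "hankel_symbol \<phi>" "hankel_symbol \<psi>" "orthonormal {..<m::nat} e" "orthonormal {..<m} f"
  shows "(\<Sum>i<m. l2_norm (hankel \<phi> (e i)) * l2_norm (hankel \<psi> (f i))) \<le>
    l2_norm (hankel_weight \<phi>) * l2_norm (hankel_weight \<psi>)"
  using hankel_hilbert_schmidt[of \<phi> "{..<m}" e 0] hankel_hilbert_schmidt[of \<psi> "{..<m}" f 0] assms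
  by (intro sum_mult_le) (auto simp: hankel_proj_from_0 hankel_symbol_def)

context
  fixes K :: l2_op and \<phi> :: "real \<Rightarrow> 'e::{complex_hilbert_space, second_countable_topology}"
  assumes K: "bounded_op K" and \<phi>: "hankel_symbol \<phi>" and square: "is_hankel_square K \<phi>"
begin

lemma square_L2: "f \<in> L2 \<Longrightarrow> K f \<in> L2"
  using K by (simp add: bounded_op_def)

lemma square_self_adjoint: "self_adjoint K"
  unfolding self_adjoint_def
proof (intro ballI)
  fix f g :: "real \<Rightarrow> complex" assume fg: "f \<in> L2" "g \<in> L2"
  have "l2_inner f (K g) = cnj (l2_inner (K g) f)" by (rule l2_inner_commute)
  also have "\<dots> = cnj (l2_inner (hankel \<phi> g) (hankel \<phi> f))"
    using hankel_square_inner[OF square K fg(2,1)] by simp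
  also have "\<dots> = l2_inner (hankel \<phi> f) (hankel \<phi> g)" by (rule l2_inner_commute[symmetric])
  finally show "l2_inner (K f) g = l2_inner f (K g)"
    using hankel_square_inner[OF square K fg] by simp
qed

lemma square_trace_class: "trace_class K"
proof -
  have "trace_norm K \<le> ennreal (l2_norm (hankel_weight \<phi>) * l2_norm (hankel_weight \<phi>))"
  proof (rule trace_norm_le)
    fix m :: nat and e f assume on: "orthonormal {..<m} e" "orthonormal {..<m} f"
    have "(\<Sum>i<m. norm (l2_inner (K (e i)) (f i))) \<le> (\<Sum>i<m. l2_norm (hankel \<phi> (e i)) * l2_norm (hankel \<phi> (f i)))"
    proof (rule sum_mono)
      fix i assume "i \<in> {..<m}"
      then have L: "e i \<in> L2" "f i \<in> L2" using on[THEN orthonormalD(1)] by auto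
      show "norm (l2_inner (K (e i)) (f i)) \<le> l2_norm (hankel \<phi> (e i)) * l2_norm (hankel \<phi> (f i))"
        unfolding hankel_square_inner[OF square K L] by (intro l2_cauchy_schwarz hankel_symbol_L2 \<phi> L)
    qed
    also have "\<dots> \<le> l2_norm (hankel_weight \<phi>) * l2_norm (hankel_weight \<phi>)"
      by (rule hankel_trace_sum[OF \<phi> \<phi> on])
    finally show "(\<Sum>i<m. norm (l2_inner (K (e i)) (f i))) \<le> \<dots>" .
  qed
  then show ?thesis using K by (auto simp: trace_class_def intro: le_less_trans)
qed

lemma square_form:
  assumes f: "f \<in> L2"
  shows "l2_inner (\<lambda>t. f t - K f t) f = of_real ((l2_norm f)\<^sup>2 - (l2_norm (hankel \<phi> f))\<^sup>2)"
  by (simp add: l2_inner_diff_left f square_L2 l2_inner_self hankel_square_inner[OF square K f f])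

text \<open>\<open>proj_from 0\<close> acts as the identity on the half line; written with it, both
  families are instances of \<open>hs_bounded_hankel\<close>.\<close>

lemma square_minors:
  assumes e: "orthonormal_basis e"
  shows "list_det (\<lambda>i j. l2_inner (K (proj_from x (e j))) (e i)) (sorted_list_of_set S) (sorted_list_of_set S) =
    minor (\<lambda>j. hankel \<phi> (proj_from x (e j))) (\<lambda>i. hankel \<phi> (proj_from 0 (e i))) S"
  unfolding minor_def hankel_proj_from_0
  by (intro list_det_cong refl hankel_square_inner[OF square K] proj_from_L2 orthonormal_basis_L2[OF e])

lemma square_minors_summable:
  assumes e: "orthonormal_basis e"
  shows "(\<lambda>S. (- 1) ^ card S * list_det (\<lambda>i j. l2_inner (K (proj_from x (e j))) (e i))
    (sorted_list_of_set S) (sorted_list_of_set S)) summable_on {S. finite S}"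
  unfolding square_minors[OF e]
  by (rule minors_summable) (rule hs_bounded_hankel[OF \<phi> e order_refl])+

text \<open>A positive operator \<open>D = I - K \<le> I\<close> with bounded inverse is bounded below: Cauchy-Schwarz for the form of
  \<open>D\<close> gives \<open>\<parallel>D f\<parallel>\<^sup>2 \<le> \<langle>D f, f\<rangle>\<close>.\<close>

lemma square_coercive:
  assumes le: "op_le K (\<lambda>f. f)" and inv: "invertible_op (\<lambda>f t. f t - K f t)"
  obtains c where "0 < c" "\<And>f. f \<in> L2 \<Longrightarrow> c * (l2_norm f)\<^sup>2 \<le> (l2_norm f)\<^sup>2 - (l2_norm (hankel \<phi> f))\<^sup>2"
proof -
  define D where "D f t = f t - K f t" for f t
  have DL: "D f \<in> L2" if "f \<in> L2" for f
    unfolding D_def[abs_def] by (intro L2_diff that square_L2)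
  define q where "q f = (l2_norm f)\<^sup>2 - (l2_norm (hankel \<phi> f))\<^sup>2" for f
  have Dq: "l2_inner (D f) f = of_real (q f)" if "f \<in> L2" for f
    using square_form[OF that] by (simp add: D_def[abs_def] q_def)
  have q: "0 \<le> q f" if "f \<in> L2" for f
  proof -
    have "0 \<le> Re (l2_inner (D f) f)"
      using le that by (simp add: op_le_def D_def[abs_def])
    then show ?thesis by (simp add: Dq[OF that])
  qed
  have Dsa: "l2_inner (D g) f = l2_inner g (D f)" if "f \<in> L2" "g \<in> L2" for f g
    using square_self_adjoint that
    by (simp add: D_def[abs_def] l2_inner_diff_left l2_inner_diff_right square_L2 self_adjoint_def)
  have cs: "(norm (l2_inner (D f) g))\<^sup>2 \<le> q f * q g" if f: "f \<in> L2" and g: "g \<in> L2" for f g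
  proof (rule quadratic_cauchy_schwarz[OF q[OF g]])
    fix z :: complex
    \<comment> \<open>The combination is written as in the linearity clause of
      \<open>bounded_op\<close>, which holds only almost everywhere; hence the passage through
      \<open>l2_inner_cong_AE\<close>.\<close>
    define s where "s t = 1 * f t + cnj z * g t" for t
    have sL: "s \<in> L2" unfolding s_def[abs_def] by (intro L2_add L2_mult f g)
    have "AE t in half_line. K s t = 1 * K f t + cnj z * K g t"
      using K f g unfolding bounded_op_def s_def[abs_def] by blast
    then have "AE t in half_line. D s t = D f t + cnj z * D g t"
      by eventually_elim (simp add: D_def s_def algebra_simps)
    then have "l2_inner (D s) s = l2_inner (\<lambda>t. D f t + cnj z * D g t) s"
      by (intro l2_inner_cong_AE DL sL L2_add L2_mult f g) auto
    also have "\<dots> = l2_inner (D f) s + cnj z * l2_inner (D g) s"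
      by (simp add: l2_inner_add_left DL f g L2_mult sL l2_inner_mult_left)
    finally have Ds: "l2_inner (D s) s = l2_inner (D f) s + cnj z * l2_inner (D g) s" .
    have e: "l2_inner h s = l2_inner h f + z * l2_inner h g" if "h \<in> L2" for h
      unfolding s_def[abs_def] using l2_inner_mult_right[of h "cnj z" g]
      by (simp add: l2_inner_add_right f g L2_mult that)
    have gf: "l2_inner (D g) f = cnj (l2_inner (D f) g)"
      using Dsa[OF f g] l2_inner_commute[of g "D f"] by simp
    have "of_real (q s) = l2_inner (D f) f + (z * l2_inner (D f) g + cnj (z * l2_inner (D f) g)) + (z * cnj z) * l2_inner (D g) g"
      unfolding Dq[OF sL, symmetric] Ds e[OF DL[OF f]] e[OF DL[OF g]] gf by (simp add: algebra_simps)
    also have "\<dots> = of_real (q f + 2 * Re (z * l2_inner (D f) g) + (norm z)\<^sup>2 * q g)"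
      unfolding Dq[OF f] Dq[OF g] complex_norm_square[symmetric] complex_add_cnj by simp
    finally have "q s = q f + 2 * Re (z * l2_inner (D f) g) + (norm z)\<^sup>2 * q g"
      by (simp only: of_real_eq_iff)
    then show "0 \<le> q f + 2 * Re (z * l2_inner (D f) g) + (norm z)\<^sup>2 * q g"
      using q[OF sL] by simp
  qed
  have Dle: "(l2_norm (D f))\<^sup>2 \<le> q f" if f: "f \<in> L2" for f
  proof -
    define n where "n = (l2_norm (D f))\<^sup>2"
    have "n\<^sup>2 \<le> q f * q (D f)"
      using cs[OF f DL[OF f]] unfolding l2_inner_self norm_of_real n_def by simp
    also have "\<dots> \<le> q f * n"
      using q[OF f] by (intro mult_left_mono) (auto simp: q_def n_def)
    finally have "n * n \<le> q f * n" by (simp add: power2_eq_square)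
    moreover have "0 \<le> n" by (simp add: n_def)
    ultimately have "n \<le> q f" using q[OF f] by (cases "n = 0") (auto simp: mult_le_cancel_right)
    then show ?thesis by (simp add: n_def)
  qed
  from inv obtain R C where R: "bounded_op R" "op_eq (\<lambda>f. R (D f)) (\<lambda>f. f)"
    and C: "\<And>f. f \<in> L2 \<Longrightarrow> l2_norm (R f) \<le> C * l2_norm f"
    unfolding invertible_op_def D_def[abs_def] bounded_op_def by blast
  \<comment> \<open>The maximum guarantees that the coercivity constant is positive, whatever the
    bound \<open>C\<close> is.\<close>
  define M where "M = max C 1"
  show ?thesis
  proof (rule that)
    show "0 < 1 / M\<^sup>2" by (simp add: M_def)
    fix f :: "real \<Rightarrow> complex" assume f: "f \<in> L2"
    have RL: "R (D f) \<in> L2" using R(1) DL[OF f] by (simp add: bounded_op_def)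
    have "l2_norm f = l2_norm (R (D f))"
      using R(2) f RL by (intro l2_norm_cong_AE) (auto simp: op_eq_def elim: eventually_mono)
    also have "\<dots> \<le> C * l2_norm (D f)" by (rule C[OF DL[OF f]])
    also have "\<dots> \<le> M * l2_norm (D f)" by (intro mult_right_mono) (auto simp: M_def)
    finally have "(l2_norm f)\<^sup>2 \<le> (M * l2_norm (D f))\<^sup>2" by (intro power_mono) auto
    also have "\<dots> \<le> M\<^sup>2 * q f" unfolding power_mult_distrib by (intro mult_left_mono Dle f) auto
    finally have "(l2_norm f)\<^sup>2 / M\<^sup>2 \<le> q f"
      by (simp add: divide_le_eq M_def mult.commute)
    then show "1 / M\<^sup>2 * (l2_norm f)\<^sup>2 \<le> (l2_norm f)\<^sup>2 - (l2_norm (hankel \<phi> f))\<^sup>2"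
      by (simp add: q_def)
  qed
qed

end

text \<open>With \<omega> = \<psi> - \<phi> the difference of the two forms is <\<Gamma>_\<omega> e,
  \<Gamma>_\<psi> f> + <\<Gamma>_\<phi> e, \<Gamma>_\<omega> f>, and each term has one
  Hilbert-Schmidt factor of size \<delta>.\<close>

lemma square_diff_trace_norm:
  assumes K: "bounded_op K" "hankel_symbol \<phi>" "is_hankel_square K \<phi>"
    and L: "bounded_op L" "hankel_symbol \<psi>" "is_hankel_square L \<psi>"
    and d: "l2_norm (\<lambda>t. hankel_weight \<psi> t - hankel_weight \<phi> t) \<le> \<delta>"
  shows "trace_norm (\<lambda>f t. L f t - K f t) \<le> ennreal (\<delta> * (l2_norm (hankel_weight \<psi>) + l2_norm (hankel_weight \<phi>)))"
proof (rule trace_norm_le)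
  fix m :: nat and e f assume on: "orthonormal {..<m} e" "orthonormal {..<m} f"
  define \<omega> where "\<omega> t = \<psi> t - \<phi> t" for t
  have \<omega>: "hankel_symbol \<omega>" "l2_norm (hankel_weight \<omega>) \<le> \<delta>"
    unfolding \<omega>_def[abs_def] using hankel_symbol_diff[OF L(2) K(2)] d by auto
  have "(\<Sum>i<m. norm (l2_inner (\<lambda>t. L (e i) t - K (e i) t) (f i))) \<le>
      (\<Sum>i<m. l2_norm (hankel \<omega> (e i)) * l2_norm (hankel \<psi> (f i)) + l2_norm (hankel \<phi> (e i)) * l2_norm (hankel \<omega> (f i)))"
  proof (rule sum_mono)
    fix i assume "i \<in> {..<m}"
    then have ef: "e i \<in> L2" "f i \<in> L2" using on[THEN orthonormalD(1)] by auto
    note HL = hankel_symbol_L2(1)[OF K(2) ef(1)] hankel_symbol_L2(1)[OF K(2) ef(2)]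
      hankel_symbol_L2(1)[OF L(2) ef(1)] hankel_symbol_L2(1)[OF L(2) ef(2)]
    have "l2_inner (\<lambda>t. L (e i) t - K (e i) t) (f i) =
        l2_inner (hankel \<psi> (e i)) (hankel \<psi> (f i)) - l2_inner (hankel \<phi> (e i)) (hankel \<phi> (f i))"
      using square_L2[OF K ef(1)] square_L2[OF L ef(1)] ef
      by (simp add: l2_inner_diff_left hankel_square_inner[OF K(3,1)] hankel_square_inner[OF L(3,1)])
    also have "\<dots> = l2_inner (\<lambda>t. hankel \<psi> (e i) t - hankel \<phi> (e i) t) (hankel \<psi> (f i)) +
        l2_inner (hankel \<phi> (e i)) (\<lambda>t. hankel \<psi> (f i) t - hankel \<phi> (f i) t)"
      by (simp add: l2_inner_diff_left l2_inner_diff_right HL)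
    finally have "norm (l2_inner (\<lambda>t. L (e i) t - K (e i) t) (f i)) \<le>
        norm (l2_inner (\<lambda>t. hankel \<psi> (e i) t - hankel \<phi> (e i) t) (hankel \<psi> (f i))) +
        norm (l2_inner (hankel \<phi> (e i)) (\<lambda>t. hankel \<psi> (f i) t - hankel \<phi> (f i) t))"
      by (simp add: norm_triangle_ineq)
    also have "\<dots> \<le> l2_norm (\<lambda>t. hankel \<psi> (e i) t - hankel \<phi> (e i) t) * l2_norm (hankel \<psi> (f i)) +
        l2_norm (hankel \<phi> (e i)) * l2_norm (\<lambda>t. hankel \<psi> (f i) t - hankel \<phi> (f i) t)"
      by (intro add_mono l2_cauchy_schwarz L2_diff HL)
    finally show "norm (l2_inner (\<lambda>t. L (e i) t - K (e i) t) (f i)) \<le>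
        l2_norm (hankel \<omega> (e i)) * l2_norm (hankel \<psi> (f i)) + l2_norm (hankel \<phi> (e i)) * l2_norm (hankel \<omega> (f i))"
      unfolding hankel_diff_norm[OF L(2) K(2) ef(1)] hankel_diff_norm[OF L(2) K(2) ef(2)] \<omega>_def[abs_def] .
  qed
  also have "\<dots> \<le> l2_norm (hankel_weight \<omega>) * l2_norm (hankel_weight \<psi>) + l2_norm (hankel_weight \<phi>) * l2_norm (hankel_weight \<omega>)"
    unfolding sum.distrib by (intro add_mono hankel_trace_sum \<omega> K L on)
  also have "\<dots> \<le> \<delta> * l2_norm (hankel_weight \<psi>) + l2_norm (hankel_weight \<phi>) * \<delta>"
    using \<omega>(2) by (intro add_mono mult_right_mono mult_left_mono) auto
  finally show "(\<Sum>i<m. norm (l2_inner (\<lambda>t. L (e i) t - K (e i) t) (f i))) \<le>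
      \<delta> * (l2_norm (hankel_weight \<psi>) + l2_norm (hankel_weight \<phi>))"
    by (simp add: algebra_simps)
qed

subsection \<open>Approximation by exponential symbols\<close>

text \<open>\<open>exp_symbol\<close> expects coordinates in an orthonormal system, whereas the
  density theorem delivers arbitrary coefficient vectors. Gram-Schmidt skips dependent vectors, so
  \<nu> may be smaller than \<open>N\<close>.\<close>

lemma orthonormalize:
  fixes y :: "nat \<Rightarrow> 'e::{complex_hilbert_space, second_countable_topology}"
  shows "\<exists>(\<nu>::nat) e. (\<forall>r\<in>{1..\<nu>}. \<forall>s\<in>{1..\<nu>}. cinner (e r) (e s) = (if r = s then 1 else 0)) \<and>
    (\<forall>j\<in>{1..N}. \<exists>c. y j = (\<Sum>r = 1..\<nu>. c r *\<^sub>C e r))"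
proof (induction N)
  case 0
  show ?case by (rule exI[of _ "0 :: nat"]) simp
next
  case (Suc N)
  then obtain \<nu> :: nat and e where *: "\<forall>r\<in>{1..\<nu>}. \<forall>s\<in>{1..\<nu>}. cinner (e r) (e s) = (if r = s then 1 else 0)"
    "\<forall>j\<in>{1..N}. \<exists>c. y j = (\<Sum>r = 1..\<nu>. c r *\<^sub>C e r)"
    by blast
  note on = *(1)[rule_format] and span = *(2)[rule_format]
  define u where "u = y (Suc N) - (\<Sum>r = 1..\<nu>. cinner (y (Suc N)) (e r) *\<^sub>C e r)"
  show ?case
  proof (cases "u = 0")
    case True
    then have "y (Suc N) = (\<Sum>r = 1..\<nu>. cinner (y (Suc N)) (e r) *\<^sub>C e r)" by (simp add: u_def)
    then have "\<exists>c. y (Suc N) = (\<Sum>r = 1..\<nu>. c r *\<^sub>C e r)"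
      by (intro exI[of _ "\<lambda>r. cinner (y (Suc N)) (e r)"])
    then have "\<exists>c. y j = (\<Sum>r = 1..\<nu>. c r *\<^sub>C e r)" if "j \<in> {1..Suc N}" for j
      using span that by (cases "j = Suc N") auto
    then show ?thesis using on by (intro exI[of _ \<nu>] exI[of _ e]) blast
  next
    case False
    define e' where "e' = e(Suc \<nu> := of_real (1 / norm u) *\<^sub>C u)"
    have e': "e' r = e r" if "r \<in> {1..\<nu>}" for r using that by (simp add: e'_def)
    have e's: "e' (Suc \<nu>) = of_real (1 / norm u) *\<^sub>C u" by (simp add: e'_def)
    have ue: "cinner u (e s) = 0" if s: "s \<in> {1..\<nu>}" for s
    proof -
      have "cinner (\<Sum>r = 1..\<nu>. cinner (y (Suc N)) (e r) *\<^sub>C e r) (e s) =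
          (\<Sum>r = 1..\<nu>. if r = s then cinner (y (Suc N)) (e r) else 0)"
        unfolding cinner_sum_left by (intro sum.cong refl) (use s on in \<open>auto simp: cinner_scaleC_left\<close>)
      also have "\<dots> = cinner (y (Suc N)) (e s)" using s by simp
      finally show ?thesis by (simp add: u_def cinner_diff_left)
    qed
    then have eu: "cinner (e s) u = 0" if "s \<in> {1..\<nu>}" for s
      using that cinner_commute[of "e s" u] by simp
    have uu: "cinner (e' (Suc \<nu>)) (e' (Suc \<nu>)) = 1"
      using False unfolding e's cinner_self norm_scaleC by (simp add: norm_divide)
    have on': "cinner (e' r) (e' s) = (if r = s then 1 else 0)" if "r \<in> {1..Suc \<nu>}" "s \<in> {1..Suc \<nu>}" for r s
    proof (cases "r = Suc \<nu>"; cases "s = Suc \<nu>")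
      assume "r \<noteq> Suc \<nu>" "s \<noteq> Suc \<nu>"
      then have "r \<in> {1..\<nu>}" "s \<in> {1..\<nu>}" using that by auto
      then show ?thesis using on by (simp add: e')
    next
      assume r: "r = Suc \<nu>" and "s \<noteq> Suc \<nu>"
      then have s: "s \<in> {1..\<nu>}" using that by auto
      show ?thesis unfolding r e's e'[OF s] cinner_scaleC_left ue[OF s] using s by auto
    next
      assume s: "s = Suc \<nu>" and "r \<noteq> Suc \<nu>"
      then have r: "r \<in> {1..\<nu>}" using that by auto
      show ?thesis unfolding s e's e'[OF r] cinner_scaleC_right eu[OF r] using r by auto
    qed (use uu in auto)
    have "(\<Sum>r = 1..\<nu>. c r *\<^sub>C e' r) = (\<Sum>r = 1..\<nu>. c r *\<^sub>C e r)" for c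
      by (intro sum.cong refl) (simp add: e')
    then have sum': "(\<Sum>r = 1..Suc \<nu>. c r *\<^sub>C e' r) = (\<Sum>r = 1..\<nu>. c r *\<^sub>C e r) + c (Suc \<nu>) *\<^sub>C e' (Suc \<nu>)" for c
      by simp
    have "\<exists>c. y j = (\<Sum>r = 1..Suc \<nu>. c r *\<^sub>C e' r)" if j: "j \<in> {1..Suc N}" for j
    proof (cases "j = Suc N")
      case True
      have "of_real (norm u) *\<^sub>C e' (Suc \<nu>) = u"
        using False by (simp add: e's scaleC_scaleC)
      moreover have "(\<Sum>r = 1..\<nu>. (if r = Suc \<nu> then of_real (norm u) else cinner (y (Suc N)) (e r)) *\<^sub>C e r) =
          (\<Sum>r = 1..\<nu>. cinner (y (Suc N)) (e r) *\<^sub>C e r)"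
        by (intro sum.cong refl) auto
      ultimately show ?thesis
        unfolding sum' True
        by (intro exI[of _ "\<lambda>r. if r = Suc \<nu> then of_real (norm u) else cinner (y (Suc N)) (e r)"])
           (simp add: u_def)
    next
      case False
      then have "j \<in> {1..N}" using j by auto
      then obtain c where c: "y j = (\<Sum>r = 1..\<nu>. c r *\<^sub>C e r)" using span by blast
      have "(\<Sum>r = 1..\<nu>. (if r = Suc \<nu> then 0 else c r) *\<^sub>C e r) = (\<Sum>r = 1..\<nu>. c r *\<^sub>C e r)"
        by (intro sum.cong refl) auto
      then show ?thesis
        unfolding sum' by (intro exI[of _ "\<lambda>r. if r = Suc \<nu> then 0 else c r"]) (simp add: c)
    qed
    then show ?thesis using on' by (intro exI[of _ "Suc \<nu>"] exI[of _ e']) blast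
  qed
qed

lemma exp_symbol_dense:
  fixes \<phi> :: "real \<Rightarrow> 'e::{complex_hilbert_space, second_countable_topology}"
  assumes \<phi>: "hankel_symbol \<phi>" and \<delta>: "0 < \<delta>"
  obtains N \<nu> e lam \<xi> where "exp_symbol_data N \<nu> (e :: nat \<Rightarrow> 'e) lam" "hankel_symbol (exp_symbol N \<nu> e lam \<xi>)"
    "l2_norm (\<lambda>t. hankel_weight \<phi> t - hankel_weight (exp_symbol N \<nu> e lam \<xi>) t) \<le> \<delta>"
proof -
  have sqrt_meas: "sqrt \<in> borel_measurable half_line"
    by (intro borel_measurable_half_line_continuous continuous_intros)
  have v: "(\<lambda>t. complex_of_real (sqrt t * exp (- t))) \<in> L2"
  proof (rule L2_bound)
    show "(\<lambda>t. exp (- (1 / 2) * complex_of_real t)) \<in> L2" by (rule L2_exp) simp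
    show "(\<lambda>t. complex_of_real (sqrt t * exp (- t))) \<in> borel_measurable half_line"
      by (intro borel_measurable_half_line_continuous continuous_intros)
    fix t :: real assume t: "0 < t"
    \<comment> \<open>Half of the decay of exp (- t) pays for the weight.\<close>
    have "sqrt t \<le> exp (t / 2)"
    proof (rule real_le_lsqrt)
      show "t \<le> (exp (t / 2))\<^sup>2"
      proof -
        have "t \<le> exp t" using exp_ge_add_one_self[of t] by linarith
        then show ?thesis by (simp add: exp_double[symmetric])
      qed
    qed (use t in auto)
    then have "sqrt t * exp (- t) \<le> exp (t / 2) * exp (- t)" by (intro mult_right_mono) auto
    also have "\<dots> = exp (- t / 2)" by (simp add: mult_exp_exp)
    finally show "norm (complex_of_real (sqrt t * exp (- t))) \<le> norm (exp (- (1 / 2) * complex_of_real t))"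
      using t by (simp add: norm_mult norm_exp_eq_Re del: of_real_mult)
  qed
  have pos: "0 < sqrt t" if "0 < t" for t using that by simp
  have "exp_approx sqrt (hankel_weight \<phi>)"
    using \<phi> by (intro exp_approx_L2[OF pos sqrt_meas v]) (auto simp: hankel_symbol_def)
  then obtain N y where y: "l2_norm (\<lambda>t. hankel_weight \<phi> t - sqrt t *\<^sub>R esum N y t) \<le> \<delta>"
    using \<delta> by (auto simp: exp_approx_def)
  obtain \<nu> :: nat and e where on: "\<forall>r\<in>{1..\<nu>}. \<forall>s\<in>{1..\<nu>}. cinner (e r) (e s) = (if r = s then 1 else 0)"
    and span: "\<forall>j\<in>{1..N}. \<exists>c. y j = (\<Sum>r = 1..\<nu>. c r *\<^sub>C e r)"
    using orthonormalize[where y = y and N = N] by blast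
  from bchoice[OF span] obtain c where c: "\<forall>j\<in>{1..N}. y j = (\<Sum>r = 1..\<nu>. c j r *\<^sub>C e r)" by blast
  \<comment> \<open>The rates are those of \<open>esum\<close>. In \<xi> the coordinates are
    conjugated because \<open>row_adjoint\<close> conjugates them back.\<close>
  define lam where "lam j = complex_of_nat j" for j
  define \<xi> where "\<xi> j r = cnj (c j r)" for j r
  have eq: "exp_symbol N \<nu> e lam \<xi> = esum N y"
  proof
    fix t
    have "exp (- cnj (lam j) * complex_of_real t) *\<^sub>C x = exp (- real j * t) *\<^sub>R x" for j and x :: 'e
      unfolding scaleR_scaleC by (simp add: lam_def exp_of_real[symmetric])
    then show "exp_symbol N \<nu> e lam \<xi> t = esum N y t"
      unfolding exp_symbol_def esum_def row_adjoint_def using c by (intro sum.cong refl) (simp add: \<xi>_def)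
  qed
  have m: "exp_symbol N \<nu> e lam \<xi> \<in> borel_measurable half_line"
    unfolding eq esum_def[abs_def] by (intro borel_measurable_half_line_continuous continuous_intros)
  have L: "hankel_weight (exp_symbol N \<nu> e lam \<xi>) \<in> L2"
    unfolding eq hankel_weight_def[abs_def] by (rule esum_L2[OF pos sqrt_meas v])
  show ?thesis
  proof (rule that)
    show "exp_symbol_data N \<nu> e lam"
      using on by unfold_locales (auto simp: lam_def)
    show "hankel_symbol (exp_symbol N \<nu> e lam \<xi>)" using m L by (simp add: hankel_symbol_def)
    show "l2_norm (\<lambda>t. hankel_weight \<phi> t - hankel_weight (exp_symbol N \<nu> e lam \<xi>) t) \<le> \<delta>"
      using y unfolding eq by (simp add: hankel_weight_def)
  qed
qed

section \<open>The approximating operators: rank, series of minors, \<tau>-function\<close>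

context exp_symbol_data
begin

lemma T_bounded: "bounded_op T"
  unfolding T_def by (rule fin_op_bounded[OF g_L2 eps_L2])

lemma T_integral_operator: "integral_operator T"
  unfolding T_def by (rule fin_op_integral_operator[OF g_L2 eps_L2])

lemma T_finite_rank: "finite_rank T"
  unfolding T_def by (rule fin_op_finite_rank[OF g_L2 eps_L2])

text \<open>Convergence comes from the Hilbert-Schmidt estimate, the value from
  \<open>fin_op_det\<close>, which identifies the sum of a series already known to converge.\<close>

lemma T_minors_has_sum:
  assumes "hankel_symbol (exp_symbol N \<nu> e lam \<xi>)" "orthonormal_basis b" "0 \<le> x"
  shows "((\<lambda>S. (- 1) ^ card S * list_det (\<lambda>i j. l2_inner (T (proj_from x (b j))) (b i))
    (sorted_list_of_set S) (sorted_list_of_set S)) has_sum (\<Sum>p\<in>det_pairs N \<nu>. det_term N \<nu> lam \<xi> p x)) {S. finite S}"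
proof -
  have s: "((\<lambda>S. (- 1) ^ card S * list_det (\<lambda>i j. l2_inner (T (proj_from x (b j))) (b i))
    (sorted_list_of_set S) (sorted_list_of_set S)) has_sum
    infsum (\<lambda>S. (- 1) ^ card S * list_det (\<lambda>i j. l2_inner (T (proj_from x (b j))) (b i))
    (sorted_list_of_set S) (sorted_list_of_set S)) {S. finite S}) {S. finite S}"
    by (rule has_sum_infsum[OF square_minors_summable[OF T_bounded assms(1) T_hankel_square assms(2)]])
  from fin_op_det[OF g_L2 eps_L2 assms(2) s[unfolded T_def] row_enum] s show ?thesis
    unfolding sum_det_term[OF assms(3), symmetric] T_def by simp
qed

lemma tau_T:
  assumes "hankel_symbol (exp_symbol N \<nu> e lam \<xi>)" "0 \<le> x"
  shows "tau T x = (\<Sum>p\<in>det_pairs N \<nu>. det_term N \<nu> lam \<xi> p x)"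
  unfolding tau_def by (rule det_id_minus_eqI) (rule T_minors_has_sum[OF assms(1) _ assms(2)])

text \<open>Coercivity yields both T \<le> I and, through the finite rank, the invertibility of I -
  T.\<close>

lemma T_has_tau:
  assumes sym: "hankel_symbol (exp_symbol N \<nu> e lam \<xi>)" and c: "0 < c"
    and coercive: "\<And>f. f \<in> L2 \<Longrightarrow> c * (l2_norm f)\<^sup>2 \<le> (l2_norm f)\<^sup>2 - (l2_norm (hankel (exp_symbol N \<nu> e lam \<xi>) f))\<^sup>2"
  shows "has_tau T"
proof -
  note square = T_bounded sym T_hankel_square
  have form: "Re (l2_inner (\<lambda>t. f t - T f t) f) = (l2_norm f)\<^sup>2 - (l2_norm (hankel (exp_symbol N \<nu> e lam \<xi>) f))\<^sup>2"
    "l2_inner (\<lambda>t. f t - T f t) f \<in> \<real>" if "f \<in> L2" for f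
    using square_form[OF square that] by auto
  have "op_le T (\<lambda>f. f)"
    unfolding op_le_def
  proof (intro ballI conjI)
    fix f :: "real \<Rightarrow> complex" assume f: "f \<in> L2"
    show "l2_inner (\<lambda>t. f t - T f t) f \<in> \<real>" by (rule form[OF f])
    have "0 \<le> c * (l2_norm f)\<^sup>2" using c by simp
    then show "0 \<le> Re (l2_inner (\<lambda>t. f t - T f t) f)"
      using coercive[OF f] form(1)[OF f] by linarith
  qed
  moreover have "invertible_op (\<lambda>f t. f t - T f t)"
    unfolding T_def
    by (rule fin_op_invertible[OF g_L2 eps_L2 c]) (use coercive form in \<open>simp_all add: T_def\<close>)
  ultimately show ?thesis
    unfolding has_tau_def using square_self_adjoint[OF square] square_trace_class[OF square] by blast
qed

end

lemma hankel_symbolI: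
  assumes "\<phi> \<in> borel_measurable half_line" "integrable half_line (\<lambda>t. t * (norm (\<phi> t))\<^sup>2)"
  shows "hankel_symbol \<phi>"
proof -
  note [measurable] = assms(1)
  have [measurable]: "sqrt \<in> borel_measurable half_line"
    by (intro borel_measurable_half_line_continuous continuous_intros)
  have "hankel_weight \<phi> \<in> borel_measurable half_line"
    unfolding hankel_weight_def[abs_def] by measurable
  moreover have "integrable half_line (\<lambda>t. (norm (hankel_weight \<phi> t))\<^sup>2) \<longleftrightarrow> integrable half_line (\<lambda>t. t * (norm (\<phi> t))\<^sup>2)"
    by (intro Bochner_Integration.integrable_cong) (auto simp: hankel_weight_def power_mult_distrib)
  ultimately show ?thesis using assms by (simp add: hankel_symbol_def L2_def)
qed

text \<open>Expanding (|\<Gamma>_\<phi> f| + \<delta> |f|)^2 leaves an error of at most \<delta> (2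
  a + 1) |f|^2, where a is the weighted norm of \<phi> and \<delta> \<le> 1 serves to replace
  \<delta>^2 by \<delta>. The third condition on \<delta> lets this error consume half of the
  constant c.\<close>

lemma perturbed_coercive:
  assumes "hankel_symbol \<phi>" "hankel_symbol \<psi>" "f \<in> L2"
    and \<delta>: "l2_norm (\<lambda>t. hankel_weight \<phi> t - hankel_weight \<psi> t) \<le> \<delta>" "\<delta> \<le> 1"
      "\<delta> * (2 * l2_norm (hankel_weight \<phi>) + 1) \<le> c / 2"
    and c: "c * (l2_norm f)\<^sup>2 \<le> (l2_norm f)\<^sup>2 - (l2_norm (hankel \<phi> f))\<^sup>2"
  shows "c / 2 * (l2_norm f)\<^sup>2 \<le> (l2_norm f)\<^sup>2 - (l2_norm (hankel \<psi> f))\<^sup>2"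
proof -
  define a where "a = l2_norm (hankel_weight \<phi>)"
  define n where "n = l2_norm f"
  have \<delta>0: "0 \<le> \<delta>" using \<delta>(1) l2_norm_nonneg order_trans by blast
  note H = hankel_symbol_L2[OF assms(1,3)] hankel_symbol_L2(1)[OF assms(2,3)]
  have "l2_norm (\<lambda>t. hankel \<psi> f t - hankel \<phi> f t) \<le> \<delta> * n"
  proof -
    have "l2_norm (\<lambda>t. hankel \<psi> f t - hankel \<phi> f t) = l2_norm (hankel (\<lambda>t. \<phi> t - \<psi> t) f)"
      using l2_norm_minus_commute[of "hankel \<psi> f" "hankel \<phi> f"] hankel_diff_norm[OF assms(1-3)] by simp
    also have "\<dots> \<le> l2_norm (hankel_weight (\<lambda>t. \<phi> t - \<psi> t)) * n"
      unfolding n_def by (rule hankel_symbol_L2(2)[OF hankel_symbol_diff(1)[OF assms(1,2)] assms(3)])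
    also have "\<dots> \<le> \<delta> * n"
      unfolding hankel_symbol_diff(2)[OF assms(1,2)] n_def by (intro mult_right_mono \<delta>) simp
    finally show ?thesis .
  qed
  then have "l2_norm (hankel \<psi> f) \<le> l2_norm (hankel \<phi> f) + \<delta> * n"
    using l2_norm_triangle[OF L2_diff[OF H(3,1)] H(1)] by simp
  then have "(l2_norm (hankel \<psi> f))\<^sup>2 \<le> (l2_norm (hankel \<phi> f) + \<delta> * n)\<^sup>2"
    by (intro power_mono) auto
  also have "\<dots> = (l2_norm (hankel \<phi> f))\<^sup>2 + 2 * \<delta> * n * l2_norm (hankel \<phi> f) + \<delta> * \<delta> * n\<^sup>2"
    by (simp add: power2_eq_square algebra_simps)
  also have "\<dots> \<le> (l2_norm (hankel \<phi> f))\<^sup>2 + 2 * \<delta> * n * (a * n) + \<delta> * 1 * n\<^sup>2"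
    using H(2) \<delta> \<delta>0 by (intro add_mono mult_mono) (auto simp: a_def n_def)
  also have "\<dots> = (l2_norm (hankel \<phi> f))\<^sup>2 + \<delta> * (2 * a + 1) * n\<^sup>2"
    by (simp add: power2_eq_square algebra_simps)
  also have "\<dots> \<le> (l2_norm (hankel \<phi> f))\<^sup>2 + c / 2 * n\<^sup>2"
    using \<delta>(3) by (intro add_mono mult_right_mono) (auto simp: a_def)
  finally show ?thesis using c by (simp add: n_def algebra_simps)
qed

theorem theorem6p2:
  fixes K :: l2_op
    and \<phi> :: "real \<Rightarrow> 'e::{complex_hilbert_space, second_countable_topology}"
  assumes "integral_operator K"
    and "op_le (\<lambda>f t. 0) K" and "op_le K (\<lambda>f. f)"
    and "invertible_op (\<lambda>f t. f t - K f t)"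
    and "\<phi> \<in> borel_measurable half_line"
    and "integrable half_line (\<lambda>t. t * (norm (\<phi> t))\<^sup>2)"
    and "is_hankel_square K \<phi>"
  shows "has_tau K \<and>
    (\<exists>Kn :: nat \<Rightarrow> l2_op.
      (\<forall>n. integral_operator (Kn n) \<and> finite_rank (Kn n) \<and> has_tau (Kn n)) \<and>
      (\<lambda>n. trace_norm (\<lambda>f t. Kn n f t - K f t)) \<longlonglongrightarrow> 0 \<and>
      (\<forall>C. compact C \<and> C \<subseteq> {0..} \<longrightarrow> uniform_limit C (\<lambda>n. tau (Kn n)) (tau K) sequentially) \<and>
      (\<forall>n. \<exists>N \<nu> (e :: nat \<Rightarrow> 'e) lam \<xi>.
        (\<forall>j\<in>{1..N}. 0 < Re (lam j)) \<and>
        (\<forall>r\<in>{1..\<nu>}. \<forall>s\<in>{1..\<nu>}. cinner (e r) (e s) = (if r = s then 1 else 0)) \<and>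
        is_hankel_square (Kn n) (exp_symbol N \<nu> e lam \<xi>) \<and>
        (\<forall>x\<ge>0. tau (Kn n) x = (\<Sum>p\<in>det_pairs N \<nu>. det_term N \<nu> lam \<xi> p x)) \<and>
        (\<exists>M p a \<mu>.
          bij_betw p {1..M::nat} (det_pairs N \<nu> - {({}, {})}) \<and>
          (\<forall>j\<in>{1..M}. 0 < Re (\<mu> j) \<and>
            (\<forall>x. det_term N \<nu> lam \<xi> (p j) x = a j * exp (- \<mu> j * of_real x))) \<and>
          (\<forall>x\<ge>0. tau (Kn n) x = 1 + (\<Sum>j = 1..M. a j * exp (- \<mu> j * of_real x))))))"
proof -
  have K: "bounded_op K" using assms(1) by (simp add: integral_operator_def)
  have \<phi>: "hankel_symbol \<phi>" by (rule hankel_symbolI[OF assms(5,6)])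
  note square = K \<phi> assms(7)
  have tauK: "has_tau K"
    unfolding has_tau_def
    using square_self_adjoint[OF square] square_trace_class[OF square] assms(3,4) by blast
  obtain c where c: "0 < c"
    "\<And>f. f \<in> L2 \<Longrightarrow> c * (l2_norm f)\<^sup>2 \<le> (l2_norm f)\<^sup>2 - (l2_norm (hankel \<phi> f))\<^sup>2"
    using square_coercive[OF square assms(3,4)] by blast
  define a where "a = l2_norm (hankel_weight \<phi>)"
  have a: "0 \<le> a" by (simp add: a_def)
  \<comment> \<open>These are the smallness conditions of \<open>perturbed_coercive\<close>. Imposed
    for every n, they give each \<open>Kn n\<close> a \<tau>-function.\<close>
  define \<eta> where "\<eta> = min 1 (c / 2 / (2 * a + 1))"
  define \<delta> where "\<delta> n = min \<eta> (1 / real (Suc n))" for n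
  have \<eta>: "0 < \<eta>" "\<eta> \<le> 1" "\<eta> * (2 * a + 1) \<le> c / 2"
  proof -
    have "\<eta> * (2 * a + 1) \<le> c / 2 / (2 * a + 1) * (2 * a + 1)"
      using a by (intro mult_right_mono) (auto simp: \<eta>_def)
    also have "\<dots> = c / 2" using a by (intro nonzero_divide_eq_eq[THEN iffD1, symmetric] refl) auto
    finally show "\<eta> * (2 * a + 1) \<le> c / 2" .
  qed (use a c in \<open>auto simp: \<eta>_def\<close>)
  have \<delta>: "0 < \<delta> n" "\<delta> n \<le> 1" "\<delta> n * (2 * a + 1) \<le> c / 2" "\<delta> n \<le> 1 / real (Suc n)" for n
  proof -
    have "\<delta> n * (2 * a + 1) \<le> \<eta> * (2 * a + 1)" using a by (intro mult_right_mono) (auto simp: \<delta>_def)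
    then show "\<delta> n * (2 * a + 1) \<le> c / 2" using \<eta>(3) by linarith
  qed (use \<eta> in \<open>auto simp: \<delta>_def\<close>)
  have \<delta>_lim: "\<delta> \<longlonglongrightarrow> 0"
    by (rule tendsto_sandwich[OF always_eventually always_eventually tendsto_const LIMSEQ_inverse_real_of_nat])
       (use \<delta>(1,4) in \<open>auto simp: inverse_eq_divide intro: less_imp_le\<close>)
  have "\<forall>n. \<exists>N \<nu> (e :: nat \<Rightarrow> 'e) lam \<xi>. exp_symbol_data N \<nu> e lam \<and> hankel_symbol (exp_symbol N \<nu> e lam \<xi>) \<and>
      l2_norm (\<lambda>t. hankel_weight \<phi> t - hankel_weight (exp_symbol N \<nu> e lam \<xi>) t) \<le> \<delta> n"
    using exp_symbol_dense[OF \<phi> \<delta>(1)] by metis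
  then obtain N \<nu> :: "nat \<Rightarrow> nat" and e :: "nat \<Rightarrow> nat \<Rightarrow> 'e" and lam \<xi> where
    *: "\<forall>n. exp_symbol_data (N n) (\<nu> n) (e n) (lam n) \<and> hankel_symbol (exp_symbol (N n) (\<nu> n) (e n) (lam n) (\<xi> n)) \<and>
      l2_norm (\<lambda>t. hankel_weight \<phi> t - hankel_weight (exp_symbol (N n) (\<nu> n) (e n) (lam n) (\<xi> n)) t) \<le> \<delta> n"
    unfolding choice_iff by (elim exE) (rule that)
  from * have data: "exp_symbol_data (N n) (\<nu> n) (e n) (lam n)"
    and sym: "hankel_symbol (exp_symbol (N n) (\<nu> n) (e n) (lam n) (\<xi> n))"
    and close: "l2_norm (\<lambda>t. hankel_weight \<phi> t - hankel_weight (exp_symbol (N n) (\<nu> n) (e n) (lam n) (\<xi> n)) t) \<le> \<delta> n" for n :: nat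
    by blast+
  define \<psi> where "\<psi> n = exp_symbol (N n) (\<nu> n) (e n) (lam n) (\<xi> n)" for n
  define Kn where "Kn n = exp_symbol_data.T (N n) (\<nu> n) (lam n) (\<xi> n)" for n
  have bounded: "bounded_op (Kn n)" for n unfolding Kn_def by (rule exp_symbol_data.T_bounded[OF data])
  have sqn: "is_hankel_square (Kn n) (\<psi> n)" for n
    unfolding Kn_def \<psi>_def by (rule exp_symbol_data.T_hankel_square[OF data])
  note \<psi> = sym[folded \<psi>_def] and close' = close[folded \<psi>_def]
  define \<tau> where "\<tau> n x = (\<Sum>p\<in>det_pairs (N n) (\<nu> n). det_term (N n) (\<nu> n) (lam n) (\<xi> n) p x)" for n x
  have tau_n: "tau (Kn n) x = \<tau> n x" if "0 \<le> x" for n x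
    unfolding Kn_def \<tau>_def by (rule exp_symbol_data.tau_T[OF data sym that])
  have has_tau_n: "has_tau (Kn n)" for n
    unfolding Kn_def
  proof (rule exp_symbol_data.T_has_tau[OF data sym])
    show "0 < c / 2" using c by simp
    show "c / 2 * (l2_norm f)\<^sup>2 \<le> (l2_norm f)\<^sup>2 - (l2_norm (hankel (exp_symbol (N n) (\<nu> n) (e n) (lam n) (\<xi> n)) f))\<^sup>2"
      if "f \<in> L2" for f
      by (rule perturbed_coercive[OF \<phi> sym that close \<delta>(2) _ c(2)[OF that]]) (use \<delta>(3) in \<open>simp add: a_def\<close>)
  qed
  \<comment> \<open>As every \<open>\<delta> n\<close> is at most 1, this bounds the weighted norms
    of \<phi> and of all approximating symbols at once.\<close>
  define A where "A = a + 1"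
  have \<psi>_norm: "l2_norm (hankel_weight (\<psi> n)) \<le> A" for n
  proof -
    have L: "hankel_weight \<phi> \<in> L2" "hankel_weight (\<psi> n) \<in> L2"
      using \<phi> \<psi>[of n] by (auto simp: hankel_symbol_def)
    have "l2_norm (hankel_weight (\<psi> n)) \<le> l2_norm (\<lambda>t. hankel_weight (\<psi> n) t - hankel_weight \<phi> t) + l2_norm (hankel_weight \<phi>)"
      using l2_norm_triangle[OF L2_diff[OF L(2,1)] L(1)] by simp
    then show ?thesis
      using close'[of n] \<delta>(2)[of n] l2_norm_minus_commute[of "hankel_weight (\<psi> n)" "hankel_weight \<phi>"]
      by (simp add: A_def a_def)
  qed
  have \<phi>_norm: "l2_norm (hankel_weight \<phi>) \<le> A" by (simp add: A_def a_def)
  define B where "B = 2 * A * exp (2 * A * A)"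
  \<comment> \<open>The basis \<open>b\<close> is arbitrary, which gives independence of the basis
    in the limit; the bound does not involve x, which makes the convergence uniform.\<close>
  have series: "norm (s - \<tau> n x) \<le> \<delta> n * B"
    if b: "orthonormal_basis b" and x: "0 \<le> x"
      and s: "((\<lambda>S. (- 1) ^ card S * list_det (\<lambda>i j. l2_inner (K (proj_from x (b j))) (b i))
        (sorted_list_of_set S) (sorted_list_of_set S)) has_sum s) {S. finite S}" for b s n x
  proof -
    have "norm (s - \<tau> n x) \<le> 2 * \<delta> n * A * exp (2 * A * A)"
    proof (rule minors_series_diff)
      show "((\<lambda>S. (- 1) ^ card S * minor (\<lambda>j. hankel \<phi> (proj_from x (b j))) (\<lambda>i. hankel \<phi> (proj_from 0 (b i))) S) has_sum s) {S. finite S}"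
        using s unfolding square_minors[OF square b] .
      show "((\<lambda>S. (- 1) ^ card S * minor (\<lambda>j. hankel (\<psi> n) (proj_from x (b j))) (\<lambda>i. hankel (\<psi> n) (proj_from 0 (b i))) S) has_sum \<tau> n x) {S. finite S}"
        using exp_symbol_data.T_minors_has_sum[OF data sym b x, of n]
        unfolding Kn_def[symmetric] \<tau>_def[symmetric] square_minors[OF bounded \<psi> sqn b] .
    qed (intro hs_bounded_hankel hs_bounded_hankel_diff \<phi> \<psi> b \<phi>_norm \<psi>_norm close')+
    then show ?thesis by (simp add: B_def mult_ac)
  qed
  \<comment> \<open>In each basis the series of \<open>K\<close> is the limit of the numbers
    \<open>\<tau> n x\<close>, in whose definition no basis occurs. So all bases give the same sum,
    and \<open>det_id_minus_eqI\<close> identifies it with \<open>tau K x\<close>.\<close>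
  have tau_K: "norm (tau K x - \<tau> n x) \<le> \<delta> n * B" if x: "0 \<le> x" for n x
  proof -
    define s where "s b = infsum (\<lambda>S. (- 1) ^ card S * list_det (\<lambda>i j. l2_inner (K (proj_from x (b j))) (b i))
        (sorted_list_of_set S) (sorted_list_of_set S)) {S. finite S}"
      for b :: "nat \<Rightarrow> real \<Rightarrow> complex"
    have s: "((\<lambda>S. (- 1) ^ card S * list_det (\<lambda>i j. l2_inner (K (proj_from x (b j))) (b i))
        (sorted_list_of_set S) (sorted_list_of_set S)) has_sum s b) {S. finite S}" if "orthonormal_basis b" for b
      unfolding s_def by (rule has_sum_infsum[OF square_minors_summable[OF square that]])
    have lim: "(\<lambda>n. \<tau> n x) \<longlonglongrightarrow> s b" if b: "orthonormal_basis b" for b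
    proof (rule LIM_zero_cancel, rule Lim_null_comparison[OF always_eventually[OF allI]])
      show "norm (\<tau> n x - s b) \<le> \<delta> n * B" for n
        using series[OF b x s[OF b], of n] by (simp add: norm_minus_commute)
      show "(\<lambda>n. \<delta> n * B) \<longlonglongrightarrow> 0"
        using tendsto_mult_right[OF \<delta>_lim, of B] by simp
    qed
    obtain b where b: "orthonormal_basis b" using orthonormal_basis_exists by blast
    have "tau K x = s b"
      unfolding tau_def
    proof (rule det_id_minus_eqI)
      fix b' assume b': "orthonormal_basis b'"
      have "s b' = s b" by (rule LIMSEQ_unique[OF lim[OF b'] lim[OF b]])
      then show "((\<lambda>S. (- 1) ^ card S * list_det (\<lambda>i j. l2_inner (K (proj_from x (b' j))) (b' i))
        (sorted_list_of_set S) (sorted_list_of_set S)) has_sum s b) {S. finite S}"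
        using s[OF b'] by simp
    qed
    then show ?thesis using series[OF b x s[OF b], of n] by simp
  qed
  show ?thesis
  proof (intro conjI tauK exI[of _ Kn] allI impI)
    fix n
    show "integral_operator (Kn n)" unfolding Kn_def by (rule exp_symbol_data.T_integral_operator[OF data])
    show "finite_rank (Kn n)" unfolding Kn_def by (rule exp_symbol_data.T_finite_rank[OF data])
    show "has_tau (Kn n)" by (rule has_tau_n)
  next
    show "(\<lambda>n. trace_norm (\<lambda>f t. Kn n f t - K f t)) \<longlonglongrightarrow> 0"
    proof (rule tendsto_sandwich[OF always_eventually always_eventually tendsto_const])
      show "\<forall>n. trace_norm (\<lambda>f t. Kn n f t - K f t) \<le> ennreal (\<delta> n * (A + A))"
      proof
        fix n
        have "trace_norm (\<lambda>f t. Kn n f t - K f t) \<le>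
            ennreal (\<delta> n * (l2_norm (hankel_weight (\<psi> n)) + l2_norm (hankel_weight \<phi>)))"
          by (rule square_diff_trace_norm[OF square bounded \<psi> sqn])
             (subst l2_norm_minus_commute, rule close')
        also have "\<dots> \<le> ennreal (\<delta> n * (A + A))"
          using \<delta>(1)[of n] by (intro ennreal_leI mult_left_mono add_mono \<psi>_norm \<phi>_norm) auto
        finally show "trace_norm (\<lambda>f t. Kn n f t - K f t) \<le> ennreal (\<delta> n * (A + A))" .
      qed
      show "(\<lambda>n. ennreal (\<delta> n * (A + A))) \<longlonglongrightarrow> 0"
        using tendsto_ennrealI[OF tendsto_mult_right[OF \<delta>_lim, of "A + A"]] by simp
    qed simp
  next
    fix C :: "real set" assume C: "compact C \<and> C \<subseteq> {0..}"
    show "uniform_limit C (\<lambda>n. tau (Kn n)) (tau K) sequentially"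
    proof (rule uniform_limitI)
      fix \<epsilon> :: real assume \<epsilon>: "0 < \<epsilon>"
      have "(\<lambda>n. \<delta> n * B) \<longlonglongrightarrow> 0"
        using tendsto_mult_right[OF \<delta>_lim, of B] by simp
      then have "\<forall>\<^sub>F n in sequentially. \<delta> n * B < \<epsilon>" using \<epsilon> by (rule order_tendstoD)
      then show "\<forall>\<^sub>F n in sequentially. \<forall>x\<in>C. dist (tau (Kn n) x) (tau K x) < \<epsilon>"
      proof eventually_elim
        case (elim n)
        show ?case
        proof
          fix x assume "x \<in> C"
          then have "0 \<le> x" using C by auto
          then show "dist (tau (Kn n) x) (tau K x) < \<epsilon>"
            using tau_K[of x n] elim by (simp add: dist_norm tau_n norm_minus_commute)
        qed
      qed
    qed
  next
    fix n
    interpret exp_symbol_data "N n" "\<nu> n" "e n" "lam n" "\<xi> n" by (rule data)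
    from det_pairs_expansion obtain M :: nat and p a' \<mu> where
      ex: "bij_betw p {1..M} (det_pairs (N n) (\<nu> n) - {({}, {})})"
        "\<forall>j\<in>{1..M}. 0 < Re (\<mu> j) \<and>
          (\<forall>x. det_term (N n) (\<nu> n) (lam n) (\<xi> n) (p j) x = a' j * exp (- \<mu> j * of_real x))"
        "\<forall>x. (\<Sum>p\<in>det_pairs (N n) (\<nu> n). det_term (N n) (\<nu> n) (lam n) (\<xi> n) p x) =
          1 + (\<Sum>j = 1..M. a' j * exp (- \<mu> j * of_real x))"
      by (elim exE conjE) (rule that)
    have ex3: "\<forall>x\<ge>0. tau (Kn n) x = 1 + (\<Sum>j = 1..M. a' j * exp (- \<mu> j * of_real x))"
      using ex(3) tau_n[of _ n] by (simp add: \<tau>_def)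
    have dets: "\<forall>x\<ge>0. tau (Kn n) x = (\<Sum>p\<in>det_pairs (N n) (\<nu> n). det_term (N n) (\<nu> n) (lam n) (\<xi> n) p x)"
      using tau_n[of _ n] by (simp add: \<tau>_def)
    have lam': "\<forall>j\<in>{1..N n}. 0 < Re (lam n j)"
      and e': "\<forall>r\<in>{1..\<nu> n}. \<forall>s\<in>{1..\<nu> n}. cinner (e n r) (e n s) = (if r = s then 1 else 0)"
      using lam e_orthonormal by blast+
    show "\<exists>N \<nu> (e :: nat \<Rightarrow> 'e) lam \<xi>.
        (\<forall>j\<in>{1..N}. 0 < Re (lam j)) \<and>
        (\<forall>r\<in>{1..\<nu>}. \<forall>s\<in>{1..\<nu>}. cinner (e r) (e s) = (if r = s then 1 else 0)) \<and>
        is_hankel_square (Kn n) (exp_symbol N \<nu> e lam \<xi>) \<and>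
        (\<forall>x\<ge>0. tau (Kn n) x = (\<Sum>p\<in>det_pairs N \<nu>. det_term N \<nu> lam \<xi> p x)) \<and>
        (\<exists>M p a \<mu>.
          bij_betw p {1..M::nat} (det_pairs N \<nu> - {({}, {})}) \<and>
          (\<forall>j\<in>{1..M}. 0 < Re (\<mu> j) \<and>
            (\<forall>x. det_term N \<nu> lam \<xi> (p j) x = a j * exp (- \<mu> j * of_real x))) \<and>
          (\<forall>x\<ge>0. tau (Kn n) x = 1 + (\<Sum>j = 1..M. a j * exp (- \<mu> j * of_real x))))"
      by (rule exI[of _ "N n"], rule exI[of _ "\<nu> n"], rule exI[of _ "e n"], rule exI[of _ "lam n"],
          rule exI[of _ "\<xi> n"], intro conjI lam' e' sqn[unfolded \<psi>_def] dets,
          rule exI[of _ M], rule exI[of _ p], rule exI[of _ a'], rule exI[of _ \<mu>], intro conjI ex(1,2) ex3)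
  qed
qed

end
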